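(* Let $(\mathcal{U},\|\cdot\|_{\mathcal{U}})$ be a regular Banach ideal of bilinear mappings and let $X_1,X_2,Y$ be Banach spaces. The set of those bilinear mappings in $\mathcal{U}(X_1\times X_2;Y)$ whose (two) Arens extensions attain their norm at the same pair is $\|\cdot\|_{\mathcal{U}}$-dense in $\mathcal{U}(X_1\times X_2;Y)$.
   Context: Notation: $\mathbb{K}$ is the scalar field ($\mathbb{R}$ or $\mathbb{C}$), $X'$ is the topological dual of $X$, $B_X$ the closed unit ball. For $\mathbf{X}=X_1\times\cdots\times X_N$ (here $N=2$), $\mathcal{L}(^N\mathbf{X};Y)$ is the space of continuous $N$-linear mappings $\mathbf{X}\to Y$ with the supremum norm $\|\cdot\|$. Ideal of $N$-linear mappings: a normed ideal of $N$-linear mappings is a pair $(\mathcal{U},\|\cdot\|_{\mathcal{U}})$ such that for every $N$-tuple of Banach spaces $\mathbf{X}$: (i) for every Banach space $Y$, $\mathcal{U}(\mathbf{X};Y)=\mathcal{U}\cap\mathcal{L}(^N\mathbf{X};Y)$ is a linear subspace of $\mathcal{L}(^N\mathbf{X};Y)$ and $\|\cdot\|_{\mathcal{U}}$ is a norm on it; (ii) for all Banach spaces $Z_1,\dots,Z_N,Y,W$, bounded linear operators $T_i:Z_i\to X_i$, $S:Y\to W$ and $\Phi\in\mathcal{U}(\mathbf{X};Y)$, the mapping $S\circ\Phi\circ(T_1,\dots,T_N)$ belongs to $\mathcal{U}(Z_1\times\cdots\times Z_N;W)$ with $\|S\circ\Phi\circ(T_1,\dots,T_N)\|_{\mathcal{U}}\le\|S\|\|\Phi\|_{\mathcal{U}}\|T_1\|\cdots\|T_N\|$;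 (iii) $(z_1,\dots,z_N)\mapsto z_1\cdots z_N$ belongs to $\mathcal{U}(\mathbb{K}^N;\mathbb{K})$ and has $\mathcal{U}$-norm one. It is a Banach ideal if every $(\mathcal{U}(\mathbf{X};Y),\|\cdot\|_{\mathcal{U}})$ is complete. Regular: a Banach ideal $\mathcal{U}$ is regular if, for all $\mathbf{X}$, $Y$ and $\Phi\in\mathcal{L}(^N\mathbf{X};Y)$, $J_Y\circ\Phi\in\mathcal{U}(\mathbf{X};Y'')$ implies $\Phi\in\mathcal{U}(\mathbf{X};Y)$ and $\|\Phi\|_{\mathcal{U}}=\|J_Y\circ\Phi\|_{\mathcal{U}}$, where $J_Y:Y\hookrightarrow Y''$ is the canonical injection. Arens extensions: for each permutation $\sigma$ of $\{1,\dots,N\}$, the corresponding Arens extension of $\Phi\in\mathcal{L}(^N\mathbf{X};Y)$ is the $N$-linear mapping $X_1''\times\cdots\times X_N''\to Y''$ given at $(x_1'',\dots,x_N'')$ by $w^*\text{-}\lim_{\alpha_{\sigma(1)}}\cdots\lim_{\alpha_{\sigma(N)}}\Phi(x_{1,\alpha_1},\dots,x_{N,\alpha_N})$, where $(x_{j,\alpha_j})_{\alpha_j}\subset X_j$ is a bounded net $w^*$-convergent to $x_j''$. There are $N!$ of them, each with norm $\|\Phi\|$. They attain their norm at the same $N$-tuple if there is a single $(a_1'',\dots,a_N'')\in B_{X_1''}\times\cdots\times B_{X_N''}$ at which each of the $N!$ Arens extensions has norm $\|\Phi\|$. *)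

theory Defs
  imports "HOL-Analysis.Analysis"
begin

section \<open>Scalars\<close>

text \<open>The scalar field is \<open>\<real>\<close> or \<open>\<complex>\<close>, up to an isometric isomorphism of fields.\<close>

class real_or_complex = real_normed_field +
  assumes ex_embedding_complex:
    "\<exists>h :: 'a \<Rightarrow> complex. (\<forall>x y. h (x + y) = h x + h y) \<and> (\<forall>x y. h (x * y) = h x * h y)
       \<and> (\<forall>x. cmod (h x) = norm x) \<and> (range h = \<real> \<or> range h = UNIV)"

instance real :: real_or_complex
proof
  show "\<exists>h :: real \<Rightarrow> complex. (\<forall>x y. h (x + y) = h x + h y) \<and> (\<forall>x y. h (x * y) = h x * h y)
       \<and> (\<forall>x. cmod (h x) = norm x) \<and> (range h = \<real> \<or> range h = UNIV)"
    by (rule exI[of _ complex_of_real]) (auto simp: Reals_def)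
qed

instance complex :: real_or_complex
proof
  show "\<exists>h :: complex \<Rightarrow> complex. (\<forall>x y. h (x + y) = h x + h y) \<and> (\<forall>x y. h (x * y) = h x * h y)
       \<and> (\<forall>x. cmod (h x) = norm x) \<and> (range h = \<real> \<or> range h = UNIV)"
    by (rule exI[of _ id]) auto
qed


section \<open>Banach spaces with explicit carrier\<close>

text \<open>
  An ideal assigns a space of mappings to every tuple of Banach spaces, and HOL cannot quantify
  over types inside a formula. Banach spaces are therefore structures on a subset of a type, and
  ``every Banach space'' means every Banach space structure on a subset of one arbitrary type
  \<open>'u\<close>. Mappings between carriers are total functions that are
  \<^const>\<open>undefined\<close> off their domain, so that equality of mappings is equality in HOL.
\<close>

record ('k, 'v) nspace =
  vcarrier :: "'v set"
  vadd :: "'v \<Rightarrow> 'v \<Rightarrow> 'v"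
  vzero :: 'v
  vscale :: "'k \<Rightarrow> 'v \<Rightarrow> 'v"
  vnorm :: "'v \<Rightarrow> real"

definition vdiff :: "('k::real_or_complex, 'v) nspace \<Rightarrow> 'v \<Rightarrow> 'v \<Rightarrow> 'v" where
  "vdiff V x y = vadd V x (vscale V (-1) y)"

definition unit_ball :: "('k::real_or_complex, 'v) nspace \<Rightarrow> 'v set" where
  "unit_ball V = {x \<in> vcarrier V. vnorm V x \<le> 1}"

locale normed_space =
  fixes V :: "('k::real_or_complex, 'v) nspace"
  assumes zero_closed: "vzero V \<in> vcarrier V"
    and add_closed: "x \<in> vcarrier V \<Longrightarrow> y \<in> vcarrier V \<Longrightarrow> vadd V x y \<in> vcarrier V"
    and scale_closed: "x \<in> vcarrier V \<Longrightarrow> vscale V a x \<in> vcarrier V"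
    and add_assoc: "x \<in> vcarrier V \<Longrightarrow> y \<in> vcarrier V \<Longrightarrow> z \<in> vcarrier V \<Longrightarrow>
        vadd V (vadd V x y) z = vadd V x (vadd V y z)"
    and add_commute: "x \<in> vcarrier V \<Longrightarrow> y \<in> vcarrier V \<Longrightarrow> vadd V x y = vadd V y x"
    and add_zero: "x \<in> vcarrier V \<Longrightarrow> vadd V x (vzero V) = x"
    and add_inverse: "x \<in> vcarrier V \<Longrightarrow> \<exists>y\<in>vcarrier V. vadd V x y = vzero V"
    and scale_add_right: "x \<in> vcarrier V \<Longrightarrow> y \<in> vcarrier V \<Longrightarrow>
        vscale V a (vadd V x y) = vadd V (vscale V a x) (vscale V a y)"
    and scale_add_left: "x \<in> vcarrier V \<Longrightarrow>
        vscale V (a + b) x = vadd V (vscale V a x) (vscale V b x)"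
    and scale_scale: "x \<in> vcarrier V \<Longrightarrow> vscale V a (vscale V b x) = vscale V (a * b) x"
    and scale_one: "x \<in> vcarrier V \<Longrightarrow> vscale V 1 x = x"
    and norm_nonneg: "x \<in> vcarrier V \<Longrightarrow> 0 \<le> vnorm V x"
    and norm_eq_zero: "x \<in> vcarrier V \<Longrightarrow> vnorm V x = 0 \<longleftrightarrow> x = vzero V"
    and norm_scale: "x \<in> vcarrier V \<Longrightarrow> vnorm V (vscale V a x) = norm a * vnorm V x"
    and norm_triangle: "x \<in> vcarrier V \<Longrightarrow> y \<in> vcarrier V \<Longrightarrow>
        vnorm V (vadd V x y) \<le> vnorm V x + vnorm V y"

locale banach_space = normed_space +
  assumes complete:
    "(\<And>n. s n \<in> vcarrier V) \<Longrightarrow>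
     (\<And>e. 0 < e \<Longrightarrow> \<exists>M. \<forall>m\<ge>M. \<forall>n\<ge>M. vnorm V (vdiff V (s m) (s n)) < e) \<Longrightarrow>
     \<exists>l\<in>vcarrier V. (\<lambda>n. vnorm V (vdiff V (s n) l)) \<longlonglongrightarrow> 0"

definition scalars :: "('k::real_or_complex, 'k) nspace" where
  "scalars = \<lparr>vcarrier = UNIV, vadd = (+), vzero = 0, vscale = (*), vnorm = norm\<rparr>"


section \<open>Bounded operators, duals and biduals\<close>

definition bounded_ops ::
    "('k::real_or_complex, 'v) nspace \<Rightarrow> ('k, 'w) nspace \<Rightarrow> ('v \<Rightarrow> 'w) set" where
  "bounded_ops V W = {T \<in> vcarrier V \<rightarrow>\<^sub>E vcarrier W.
     (\<forall>x\<in>vcarrier V. \<forall>y\<in>vcarrier V. T (vadd V x y) = vadd W (T x) (T y)) \<and>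
     (\<forall>a. \<forall>x\<in>vcarrier V. T (vscale V a x) = vscale W a (T x)) \<and>
     (\<exists>C. \<forall>x\<in>vcarrier V. vnorm W (T x) \<le> C * vnorm V x)}"

definition op_norm ::
    "('k::real_or_complex, 'v) nspace \<Rightarrow> ('k, 'w) nspace \<Rightarrow> ('v \<Rightarrow> 'w) \<Rightarrow> real" where
  "op_norm V W T = (SUP x\<in>unit_ball V. vnorm W (T x))"

definition op_space ::
    "('k::real_or_complex, 'v) nspace \<Rightarrow> ('k, 'w) nspace \<Rightarrow> ('k, 'v \<Rightarrow> 'w) nspace" where
  "op_space V W = \<lparr>vcarrier = bounded_ops V W,
     vadd = (\<lambda>S T. \<lambda>x\<in>vcarrier V. vadd W (S x) (T x)),
     vzero = (\<lambda>x\<in>vcarrier V. vzero W),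
     vscale = (\<lambda>a T. \<lambda>x\<in>vcarrier V. vscale W a (T x)),
     vnorm = op_norm V W\<rparr>"

definition dual :: "('k::real_or_complex, 'v) nspace \<Rightarrow> ('k, 'v \<Rightarrow> 'k) nspace" where
  "dual V = op_space V scalars"

abbreviation bidual :: "('k::real_or_complex, 'v) nspace \<Rightarrow> ('k, ('v \<Rightarrow> 'k) \<Rightarrow> 'k) nspace" where
  "bidual V \<equiv> dual (dual V)"

definition canonical :: "('k::real_or_complex, 'v) nspace \<Rightarrow> 'v \<Rightarrow> (('v \<Rightarrow> 'k) \<Rightarrow> 'k)" where
  "canonical V x = (\<lambda>f\<in>vcarrier (dual V). f x)"

definition isometric_iso ::
    "('k::real_or_complex, 'v) nspace \<Rightarrow> ('k, 'w) nspace \<Rightarrow> ('v \<Rightarrow> 'w) \<Rightarrow> bool" where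
  "isometric_iso V W T \<longleftrightarrow> T \<in> bounded_ops V W \<and> bij_betw T (vcarrier V) (vcarrier W) \<and>
     (\<forall>x\<in>vcarrier V. vnorm W (T x) = vnorm V x)"


section \<open>Continuous bilinear mappings\<close>

definition bilinear_maps ::
    "('k::real_or_complex, 'v) nspace \<Rightarrow> ('k, 'w) nspace \<Rightarrow> ('k, 'y) nspace \<Rightarrow> ('v \<times> 'w \<Rightarrow> 'y) set"
  where
  "bilinear_maps X1 X2 Y = {\<Phi> \<in> vcarrier X1 \<times> vcarrier X2 \<rightarrow>\<^sub>E vcarrier Y.
     (\<forall>x\<in>vcarrier X1. \<forall>x'\<in>vcarrier X1. \<forall>y\<in>vcarrier X2.
        \<Phi> (vadd X1 x x', y) = vadd Y (\<Phi> (x, y)) (\<Phi> (x', y))) \<and>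
     (\<forall>x\<in>vcarrier X1. \<forall>y\<in>vcarrier X2. \<forall>y'\<in>vcarrier X2.
        \<Phi> (x, vadd X2 y y') = vadd Y (\<Phi> (x, y)) (\<Phi> (x, y'))) \<and>
     (\<forall>a. \<forall>x\<in>vcarrier X1. \<forall>y\<in>vcarrier X2.
        \<Phi> (vscale X1 a x, y) = vscale Y a (\<Phi> (x, y)) \<and>
        \<Phi> (x, vscale X2 a y) = vscale Y a (\<Phi> (x, y))) \<and>
     (\<exists>C. \<forall>x\<in>vcarrier X1. \<forall>y\<in>vcarrier X2. vnorm Y (\<Phi> (x, y)) \<le> C * vnorm X1 x * vnorm X2 y)}"

definition bilinear_norm ::
    "('k::real_or_complex, 'v) nspace \<Rightarrow> ('k, 'w) nspace \<Rightarrow> ('k, 'y) nspace \<Rightarrow> ('v \<times> 'w \<Rightarrow> 'y) \<Rightarrow> real"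
  where
  "bilinear_norm X1 X2 Y \<Phi> = (SUP p\<in>unit_ball X1 \<times> unit_ball X2. vnorm Y (\<Phi> p))"

definition bilinear_space ::
    "('k::real_or_complex, 'v) nspace \<Rightarrow> ('k, 'w) nspace \<Rightarrow> ('k, 'y) nspace \<Rightarrow>
     ('k, 'v \<times> 'w \<Rightarrow> 'y) nspace" where
  "bilinear_space X1 X2 Y = \<lparr>vcarrier = bilinear_maps X1 X2 Y,
     vadd = (\<lambda>\<Phi> \<Psi>. \<lambda>p\<in>vcarrier X1 \<times> vcarrier X2. vadd Y (\<Phi> p) (\<Psi> p)),
     vzero = (\<lambda>p\<in>vcarrier X1 \<times> vcarrier X2. vzero Y),
     vscale = (\<lambda>a \<Phi>. \<lambda>p\<in>vcarrier X1 \<times> vcarrier X2. vscale Y a (\<Phi> p)),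
     vnorm = bilinear_norm X1 X2 Y\<rparr>"


section \<open>Ideals of bilinear mappings\<close>

text \<open>
  \<open>U X1 X2 Y\<close> is the component of the ideal at \<open>X1, X2, Y\<close> and \<open>\<nu> X1 X2 Y\<close> the ideal norm on it.
\<close>

type_synonym ('k, 'u) ideal_class =
  "('k, 'u) nspace \<Rightarrow> ('k, 'u) nspace \<Rightarrow> ('k, 'u) nspace \<Rightarrow> ('u \<times> 'u \<Rightarrow> 'u) set"

type_synonym ('k, 'u) ideal_norm =
  "('k, 'u) nspace \<Rightarrow> ('k, 'u) nspace \<Rightarrow> ('k, 'u) nspace \<Rightarrow> ('u \<times> 'u \<Rightarrow> 'u) \<Rightarrow> real"

definition ideal_space ::
    "('k::real_or_complex, 'u) ideal_class \<Rightarrow> ('k, 'u) ideal_norm \<Rightarrow>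
     ('k, 'u) nspace \<Rightarrow> ('k, 'u) nspace \<Rightarrow> ('k, 'u) nspace \<Rightarrow> ('k, 'u \<times> 'u \<Rightarrow> 'u) nspace" where
  "ideal_space U \<nu> X1 X2 Y =
     (bilinear_space X1 X2 Y)\<lparr>vcarrier := U X1 X2 Y, vnorm := \<nu> X1 X2 Y\<rparr>"

text \<open>
  In the assumption \<open>mult\<close>, \<open>e\<close> identifies the scalar field with a Banach space \<open>L\<close> on
  the type \<open>'u\<close>. Such an \<open>L\<close> exists as soon as there is a nonzero Banach space on \<open>'u\<close>,
  and the ideal property makes the choice of the copy immaterial.
\<close>

locale normed_bilinear_ideal =
  fixes U :: "('k::real_or_complex, 'u) ideal_class"
    and \<nu> :: "('k, 'u) ideal_norm"
  assumes subset: "banach_space X1 \<Longrightarrow> banach_space X2 \<Longrightarrow> banach_space Y \<Longrightarrow>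
        U X1 X2 Y \<subseteq> bilinear_maps X1 X2 Y"
    and normed: "banach_space X1 \<Longrightarrow> banach_space X2 \<Longrightarrow> banach_space Y \<Longrightarrow>
        normed_space (ideal_space U \<nu> X1 X2 Y)"
    and ideal: "banach_space X1 \<Longrightarrow> banach_space X2 \<Longrightarrow> banach_space Y \<Longrightarrow>
        banach_space Z1 \<Longrightarrow> banach_space Z2 \<Longrightarrow> banach_space W \<Longrightarrow>
        T1 \<in> bounded_ops Z1 X1 \<Longrightarrow> T2 \<in> bounded_ops Z2 X2 \<Longrightarrow> S \<in> bounded_ops Y W \<Longrightarrow>
        \<Phi> \<in> U X1 X2 Y \<Longrightarrow>
        \<Psi> = (\<lambda>(z1, z2)\<in>vcarrier Z1 \<times> vcarrier Z2. S (\<Phi> (T1 z1, T2 z2))) \<Longrightarrow>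
        \<Psi> \<in> U Z1 Z2 W \<and>
        \<nu> Z1 Z2 W \<Psi> \<le> op_norm Y W S * \<nu> X1 X2 Y \<Phi> * op_norm Z1 X1 T1 * op_norm Z2 X2 T2"
    and mult: "banach_space L \<Longrightarrow> isometric_iso scalars L e \<Longrightarrow>
        \<Phi> = (\<lambda>(z1, z2)\<in>vcarrier L \<times> vcarrier L. e (inv e z1 * inv e z2)) \<Longrightarrow>
        \<Phi> \<in> U L L L \<and> \<nu> L L L \<Phi> = 1"

locale banach_bilinear_ideal = normed_bilinear_ideal +
  assumes banach: "banach_space X1 \<Longrightarrow> banach_space X2 \<Longrightarrow> banach_space Y \<Longrightarrow>
        banach_space (ideal_space U \<nu> X1 X2 Y)"

text \<open>
  The bidual of a space on \<open>'u\<close> lives on another type, so it enters through an isometric copy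
  \<open>B\<close> on \<open>'u\<close>. Where \<open>'u\<close> is too small to contain a copy of the bidual of \<open>Y\<close>, the assumption
  imposes nothing at \<open>Y\<close>.
\<close>

locale regular_banach_bilinear_ideal = banach_bilinear_ideal +
  assumes regular: "banach_space X1 \<Longrightarrow> banach_space X2 \<Longrightarrow> banach_space Y \<Longrightarrow>
        banach_space B \<Longrightarrow> isometric_iso (bidual Y) B j \<Longrightarrow>
        \<Phi> \<in> bilinear_maps X1 X2 Y \<Longrightarrow>
        \<Psi> = (\<lambda>p\<in>vcarrier X1 \<times> vcarrier X2. j (canonical Y (\<Phi> p))) \<Longrightarrow>
        \<Psi> \<in> U X1 X2 B \<Longrightarrow>
        \<Phi> \<in> U X1 X2 Y \<and> \<nu> X1 X2 Y \<Phi> = \<nu> X1 X2 B \<Psi>"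


section \<open>Arens extensions\<close>

definition wstar_tendsto ::
    "('k::real_or_complex, 'v) nspace \<Rightarrow> ('i \<Rightarrow> (('v \<Rightarrow> 'k) \<Rightarrow> 'k)) \<Rightarrow> (('v \<Rightarrow> 'k) \<Rightarrow> 'k) \<Rightarrow>
     'i filter \<Rightarrow> bool" where
  "wstar_tendsto V g z F \<longleftrightarrow> (\<forall>f\<in>vcarrier (dual V). ((\<lambda>i. g i f) \<longlongrightarrow> z f) F)"

text \<open>
  Bounded nets in \<open>X\<close> are given by proper filters that contain a bounded subset of \<open>X\<close>, namely
  the images of the filters of tails of the nets.
\<close>

definition bounded_wstar_net ::
    "('k::real_or_complex, 'v) nspace \<Rightarrow> 'v filter \<Rightarrow> (('v \<Rightarrow> 'k) \<Rightarrow> 'k) \<Rightarrow> bool" where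
  "bounded_wstar_net X F z \<longleftrightarrow> F \<noteq> bot \<and>
     (\<exists>r. \<forall>\<^sub>F x in F. x \<in> vcarrier X \<and> vnorm X x \<le> r) \<and>
     wstar_tendsto X (canonical X) z F"

text \<open>The limit along \<open>G\<close> is the inner one; both limits are weak-star limits in the bidual of \<open>Y\<close>.\<close>

definition wstar_iterated_limit ::
    "('k::real_or_complex, 'y) nspace \<Rightarrow> 'v filter \<Rightarrow> 'w filter \<Rightarrow> ('v \<Rightarrow> 'w \<Rightarrow> 'y) \<Rightarrow>
     (('y \<Rightarrow> 'k) \<Rightarrow> 'k) \<Rightarrow> bool" where
  "wstar_iterated_limit Y F G h z \<longleftrightarrow>
     (\<exists>g. (\<forall>\<^sub>F u in F. g u \<in> vcarrier (bidual Y) \<and>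
             wstar_tendsto Y (\<lambda>v. canonical Y (h u v)) (g u) G) \<and>
          wstar_tendsto Y g z F)"

definition arens_12 ::
    "('k::real_or_complex, 'v) nspace \<Rightarrow> ('k, 'w) nspace \<Rightarrow> ('k, 'y) nspace \<Rightarrow> ('v \<times> 'w \<Rightarrow> 'y) \<Rightarrow>
     (('v \<Rightarrow> 'k) \<Rightarrow> 'k) \<Rightarrow> (('w \<Rightarrow> 'k) \<Rightarrow> 'k) \<Rightarrow> (('y \<Rightarrow> 'k) \<Rightarrow> 'k)" where
  "arens_12 X1 X2 Y \<Phi> a1 a2 = (THE z. z \<in> vcarrier (bidual Y) \<and>
     (\<forall>F1 F2. bounded_wstar_net X1 F1 a1 \<longrightarrow> bounded_wstar_net X2 F2 a2 \<longrightarrow>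
        wstar_iterated_limit Y F1 F2 (\<lambda>x1 x2. \<Phi> (x1, x2)) z))"

definition arens_21 ::
    "('k::real_or_complex, 'v) nspace \<Rightarrow> ('k, 'w) nspace \<Rightarrow> ('k, 'y) nspace \<Rightarrow> ('v \<times> 'w \<Rightarrow> 'y) \<Rightarrow>
     (('v \<Rightarrow> 'k) \<Rightarrow> 'k) \<Rightarrow> (('w \<Rightarrow> 'k) \<Rightarrow> 'k) \<Rightarrow> (('y \<Rightarrow> 'k) \<Rightarrow> 'k)" where
  "arens_21 X1 X2 Y \<Phi> a1 a2 = (THE z. z \<in> vcarrier (bidual Y) \<and>
     (\<forall>F1 F2. bounded_wstar_net X1 F1 a1 \<longrightarrow> bounded_wstar_net X2 F2 a2 \<longrightarrow>
        wstar_iterated_limit Y F2 F1 (\<lambda>x2 x1. \<Phi> (x1, x2)) z))"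

definition arens_attain_at_same_pair ::
    "('k::real_or_complex, 'v) nspace \<Rightarrow> ('k, 'w) nspace \<Rightarrow> ('k, 'y) nspace \<Rightarrow> ('v \<times> 'w \<Rightarrow> 'y) \<Rightarrow>
     bool" where
  "arens_attain_at_same_pair X1 X2 Y \<Phi> \<longleftrightarrow>
     (\<exists>a1\<in>unit_ball (bidual X1). \<exists>a2\<in>unit_ball (bidual X2).
        vnorm (bidual Y) (arens_12 X1 X2 Y \<Phi> a1 a2) = bilinear_norm X1 X2 Y \<Phi> \<and>
        vnorm (bidual Y) (arens_21 X1 X2 Y \<Phi> a1 a2) = bilinear_norm X1 X2 Y \<Phi>)"

end

theory Submission
  imports Defs
begin

text \<open>
  The iteration is Lindenstrauss's: if \<open>v\<close> is an almost maximal value of \<open>\<Phi>\<close> on the unit balls and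
  \<open>c\<close> is a scalar bilinear form that is large where this value is taken, then a mapping close to
  \<open>\<Phi> + \<epsilon> c v\<close> can almost attain its norm only where \<open>c\<close> is large. Two kinds of forms
  alternate. With \<open>c = f \<circ> \<Phi>\<close> and \<open>f\<close> norming \<open>v\<close>, a new functional \<open>f\<^sub>n\<close> is large on all
  later values. With \<open>c (x, y) = g (\<Phi> (x, y\<^sub>n)) g (\<Phi> (x\<^sub>n, y))\<close>, where \<open>g\<close> is a weighted sum of
  \<open>f\<^sub>0, \<dots>, f\<^sub>n\<close>, the mixed values \<open>f\<^sub>l (\<Phi> (x\<^sub>i, y\<^sub>j))\<close> with \<open>l \<le> min i j\<close> and \<open>i \<noteq> j\<close> become
  large. Both corrections lie in the ideal and are small in the ideal norm. In the limit both iterated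
  limits of \<open>f\<^sub>l (\<Psi> (x\<^sub>i, y\<^sub>j))\<close> have modulus at least \<open>\<parallel>\<Psi>\<parallel> - 6 / 2\<^sup>l\<close>, so both Arens extensions
  attain their norm at the weak-star limits of \<open>x\<^sub>i\<close> and \<open>y\<^sub>j\<close>.
\<close>

section \<open>Scalars\<close>

text \<open>The obstacle is that the two iterated limits read values at (x_i, y_j) off the diagonal,
  whereas almost maximality of a norm informs only about the points (x_i, y_i). The product form
  bridges this gap: at (x_j, y_j) with j > n it can be close to its maximum only if both of its
  factors are, and these are values at (x_j, y_n) and at (x_n, y_j). One correction thus serves both
  orders of the limits. A weak-star limit can be tested only by a functional that stays fixed while
  the indices grow, and no single functional need be nearly norming for all values; hence a sequence
  of functionals, whose error tends to zero with its index. Since stage n chooses one pair only, all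
  functionals found so far have to enter one form, from which each of them must be recovered
  separately. Every estimate is demanded on a whole ball of the ideal norm, so that it survives the
  later corrections and holds for the limit.\<close>

lemma scalar_embedding:
  obtains h :: "'k::real_or_complex \<Rightarrow> complex"
  where "\<And>x y. h (x + y) = h x + h y" "\<And>x y. h (x - y) = h x - h y"
    "\<And>x y. h (x * y) = h x * h y" "\<And>x. cmod (h x) = norm x"
    "\<And>r. h (of_real r) = of_real r" "closed (range h)" "range h = \<real> \<or> range h = UNIV"
proof -
  obtain h :: "'k \<Rightarrow> complex" where add: "\<And>x y. h (x + y) = h x + h y"
    and mult: "\<And>x y. h (x * y) = h x * h y" and norm: "\<And>x. cmod (h x) = norm x"
    and rng: "range h = \<real> \<or> range h = UNIV"
    using ex_embedding_complex by blast
  have diff: "h (x - y) = h x - h y" for x y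
    using add[of "x - y" y] by (simp add: algebra_simps)
  have one: "h 1 = 1"
    using mult[of 1 1] norm[of 1] by auto
  \<comment> \<open>The point h(r) has distance |r| from 0 and |r - 1| from 1 = h(1); the circles
    with these radii meet only at r.\<close>
  have "h (of_real r) = of_real r" for r
  proof -
    have "cmod (h (of_real r)) = \<bar>r\<bar>"
      by (simp add: norm)
    then have 1: "(Re (h (of_real r)))\<^sup>2 + (Im (h (of_real r)))\<^sup>2 = r\<^sup>2"
      by (metis cmod_power2 power2_abs)
    have "cmod (h (of_real r - 1)) = \<bar>r - 1\<bar>"
      by (metis norm norm_of_real of_real_1 of_real_diff)
    then have "cmod (h (of_real r) - 1) = \<bar>r - 1\<bar>"
      by (simp add: diff one)
    then have 2: "(Re (h (of_real r)) - 1)\<^sup>2 + (Im (h (of_real r)))\<^sup>2 = (r - 1)\<^sup>2"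
      by (metis cmod_power2 power2_abs minus_complex.simps one_complex.simps diff_zero)
    have "Re (h (of_real r)) = r"
      using 1 2 by (simp add: power2_eq_square algebra_simps)
    with 1 show ?thesis
      by (simp add: complex_eq_iff)
  qed
  moreover have "closed (range h)"
    using rng closed_complex_Reals by auto
  ultimately show ?thesis
    using that add diff mult norm rng by blast
qed

lemma complete_scalars: "banach_space (scalars :: ('k::real_or_complex, 'k) nspace)"
proof
  fix s :: "nat \<Rightarrow> 'k"
  assume c: "\<And>e. 0 < e \<Longrightarrow> \<exists>M. \<forall>m\<ge>M. \<forall>n\<ge>M. vnorm scalars (vdiff scalars (s m) (s n)) < e"
  obtain h :: "'k \<Rightarrow> complex" where diff: "\<And>x y. h (x - y) = h x - h y"
    and norm: "\<And>x. cmod (h x) = norm x" and cl: "closed (range h)"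
    using scalar_embedding by metis
  have "Cauchy (\<lambda>n. h (s n))"
    using c by (simp add: Cauchy_def dist_norm flip: diff)
      (simp add: norm scalars_def vdiff_def)
  then obtain l where l: "(\<lambda>n. h (s n)) \<longlonglongrightarrow> l"
    using Cauchy_convergent convergent_def by blast
  then have "l \<in> range h"
    by (intro Lim_in_closed_set[OF cl _ _ l]) auto
  then obtain a where "l = h a"
    by blast
  with l have "(\<lambda>n. norm (s n - a)) \<longlonglongrightarrow> 0"
    by (simp add: tendsto_iff dist_norm norm flip: diff)
  then show "\<exists>l\<in>vcarrier scalars. (\<lambda>n. vnorm scalars (vdiff scalars (s n) l)) \<longlonglongrightarrow> 0"
    by (auto simp: scalars_def vdiff_def intro!: exI[of _ a])
next
  fix x :: 'k
  show "\<exists>y\<in>vcarrier scalars. vadd scalars x y = vzero scalars"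
    by (auto simp: scalars_def intro: exI[of _ "- x"])
qed (auto simp: scalars_def algebra_simps norm_mult norm_triangle_ineq)

text \<open>By Tychonoff's theorem applied to the product of discs indexed by all bounded sequences.\<close>

lemma ex_filter_bounded_convergent_complex:
  "\<exists>F :: nat filter. F \<noteq> bot \<and> F \<le> sequentially \<and>
     (\<forall>s :: nat \<Rightarrow> complex. Bseq s \<longrightarrow> (\<exists>l. (s \<longlongrightarrow> l) F))"
proof -
  have "\<forall>s :: nat \<Rightarrow> complex. \<exists>b. Bseq s \<longrightarrow> (\<forall>n. norm (s n) \<le> b)"
    unfolding Bseq_def by blast
  then obtain B where B: "\<And>s :: nat \<Rightarrow> complex. Bseq s \<Longrightarrow> \<forall>n. norm (s n) \<le> B s"
    by metis
  \<comment> \<open>The default 0 at unbounded sequences puts every \<open>E n\<close> into a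
    product of discs, which is compact.\<close>
  define E where "E n s = (if Bseq s then s n else 0)" for n :: nat and s :: "nat \<Rightarrow> complex"
  define K where "K s = cball (0::complex) (if Bseq s then B s else 0)" for s
  have "compactin (product_topology (\<lambda>s. euclidean) UNIV) (PiE UNIV K)"
    by (simp add: compactin_PiE K_def)
  then have "compact (PiE UNIV K)"
    by (simp add: euclidean_product_topology)
  moreover have "E n \<in> PiE UNIV K" for n
    using B by (auto simp: E_def K_def)
  ultimately have "\<exists>z\<in>PiE UNIV K. inf (nhds z) (filtermap E sequentially) \<noteq> bot"
    by (intro compact_filter[THEN iffD1, rule_format])
      (simp_all add: filtermap_bot_iff eventually_filtermap)
  then obtain z where z: "inf (nhds z) (filtermap E sequentially) \<noteq> bot"
    by blast
  \<comment> \<open>Pulling the neighbourhoods of the cluster point back along \<open>E\<close>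
    gives a filter of indices along which \<open>E\<close> converges, hence all of its coordinates
    at once.\<close>
  let ?F = "inf (filtercomap E (nhds z)) sequentially"
  have "?F \<noteq> bot"
  proof
    assume "?F = bot"
    then have "eventually (\<lambda>_. False) ?F"
      by simp
    then obtain Q R where "eventually Q (filtercomap E (nhds z))" "eventually R sequentially"
      and QR: "\<And>n. Q n \<Longrightarrow> R n \<Longrightarrow> False"
      unfolding eventually_inf by blast
    then obtain P where P: "eventually P (nhds z)" "\<And>n. P (E n) \<Longrightarrow> Q n"
      unfolding eventually_filtercomap by blast
    have "eventually (\<lambda>w. \<not> P w) (filtermap E sequentially)"
      unfolding eventually_filtermap using \<open>eventually R sequentially\<close>
      by eventually_elim (use P QR in blast)
    with P(1) have "eventually (\<lambda>_. False) (inf (nhds z) (filtermap E sequentially))"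
      unfolding eventually_inf by blast
    with z show False
      by simp
  qed
  moreover have "\<exists>l. (s \<longlongrightarrow> l) ?F" if "Bseq s" for s :: "nat \<Rightarrow> complex"
  proof -
    have "filterlim E (nhds z) (filtercomap E (nhds z))"
      by (rule filterlim_filtercomap)
    then have "filterlim E (nhds z) ?F"
      by (rule filterlim_mono) auto
    have "((\<lambda>n. E n s) \<longlongrightarrow> z s) ?F"
    proof (rule topological_tendstoI)
      fix S :: "complex set"
      assume "open S" "z s \<in> S"
      moreover have "open ((\<lambda>w. w s) -` S)"
        by (intro open_vimage \<open>open S\<close> continuous_on_product_coordinates)
      ultimately have "eventually (\<lambda>w. w s \<in> S) (nhds z)"
        unfolding eventually_nhds by (intro exI[of _ "(\<lambda>w. w s) -` S"]) auto
      then show "eventually (\<lambda>n. E n s \<in> S) ?F"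
        using \<open>filterlim E (nhds z) ?F\<close> by (rule eventually_compose_filterlim)
    qed
    then show ?thesis
      using that by (auto simp: E_def)
  qed
  ultimately show ?thesis
    by (intro exI[of _ ?F]) auto
qed

text \<open>It is used like a free ultrafilter. One filter for all sequences makes the limit linear
  in the sequence, and below \<open>sequentially\<close> it respects estimates that hold for large
  indices only.\<close>

definition limit_filter :: "nat filter" where
  "limit_filter = (SOME F. F \<noteq> bot \<and> F \<le> sequentially \<and>
     (\<forall>s :: nat \<Rightarrow> complex. Bseq s \<longrightarrow> (\<exists>l. (s \<longlongrightarrow> l) F)))"

lemma limit_filter:
  fixes s :: "nat \<Rightarrow> complex"
  shows "limit_filter \<noteq> bot" and "limit_filter \<le> sequentially"
    and "Bseq s \<Longrightarrow> \<exists>l. (s \<longlongrightarrow> l) limit_filter"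
  using someI_ex[OF ex_filter_bounded_convergent_complex] unfolding limit_filter_def by blast+

text \<open>The limit exists in the complex numbers and stays in the range of the embedding because
  that range is closed.\<close>

lemma limit_filter_convergent:
  fixes s :: "nat \<Rightarrow> 'k::real_or_complex"
  assumes "\<And>n. norm (s n) \<le> B"
  shows "\<exists>l. (s \<longlongrightarrow> l) limit_filter"
proof -
  obtain h :: "'k \<Rightarrow> complex" where diff: "\<And>x y. h (x - y) = h x - h y"
    and norm: "\<And>x. cmod (h x) = norm x" and cl: "closed (range h)"
    using scalar_embedding by metis
  have "Bseq (\<lambda>n. h (s n))"
    by (rule BseqI'[of _ B]) (simp add: norm assms)
  then obtain l where l: "((\<lambda>n. h (s n)) \<longlongrightarrow> l) limit_filter"
    using limit_filter(3) by blast
  then have "l \<in> range h"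
    by (intro Lim_in_closed_set[OF cl _ _ l]) (auto simp: limit_filter)
  then obtain a where "l = h a"
    by blast
  with l have "(s \<longlongrightarrow> a) limit_filter"
    by (simp add: tendsto_iff dist_norm norm flip: diff)
  then show ?thesis ..
qed

section \<open>Normed spaces with carrier\<close>

context normed_space
begin

lemma diff_closed: "x \<in> vcarrier V \<Longrightarrow> y \<in> vcarrier V \<Longrightarrow> vdiff V x y \<in> vcarrier V"
  by (simp add: vdiff_def add_closed scale_closed)

lemmas closed = zero_closed add_closed scale_closed diff_closed

lemma add_left_commute:
  "x \<in> vcarrier V \<Longrightarrow> y \<in> vcarrier V \<Longrightarrow> z \<in> vcarrier V \<Longrightarrow>
    vadd V x (vadd V y z) = vadd V y (vadd V x z)"
  by (metis add_assoc add_commute)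

lemmas add_ac = add_assoc add_commute add_left_commute

lemma zero_add: "x \<in> vcarrier V \<Longrightarrow> vadd V (vzero V) x = x"
  by (simp add: add_commute add_zero zero_closed)

lemma norm_zero: "vnorm V (vzero V) = 0"
  by (simp add: norm_eq_zero zero_closed)

lemma zero_scale: "x \<in> vcarrier V \<Longrightarrow> vscale V 0 x = vzero V"
  using norm_eq_zero[of "vscale V 0 x"] by (simp add: norm_scale scale_closed)

lemma scale_zero: "vscale V a (vzero V) = vzero V"
  using norm_eq_zero[of "vscale V a (vzero V)"]
  by (simp add: norm_scale scale_closed zero_closed norm_zero)

lemma add_minus: "x \<in> vcarrier V \<Longrightarrow> vadd V x (vscale V (- 1) x) = vzero V"
  by (metis add.right_inverse scale_add_left scale_one zero_scale)

lemma diff_self: "x \<in> vcarrier V \<Longrightarrow> vdiff V x x = vzero V"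
  by (simp add: vdiff_def add_minus)

lemma add_diff: "x \<in> vcarrier V \<Longrightarrow> y \<in> vcarrier V \<Longrightarrow> vadd V y (vdiff V x y) = x"
  by (simp add: vdiff_def add_left_commute scale_closed add_minus add_zero)

lemma diff_add: "x \<in> vcarrier V \<Longrightarrow> y \<in> vcarrier V \<Longrightarrow> vdiff V (vadd V x y) x = y"
  by (simp add: vdiff_def add_assoc add_left_commute[of x y] add_closed scale_closed add_minus add_zero)

lemma norm_minus: "x \<in> vcarrier V \<Longrightarrow> vnorm V (vscale V (- 1) x) = vnorm V x"
  by (simp add: norm_scale)

lemma norm_diff_commute:
  assumes "x \<in> vcarrier V" "y \<in> vcarrier V"
  shows "vnorm V (vdiff V x y) = vnorm V (vdiff V y x)"
proof -
  have "vdiff V y x = vscale V (- 1) (vdiff V x y)"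
    using assms by (simp add: vdiff_def scale_add_right scale_closed scale_scale scale_one add_commute)
  then show ?thesis
    using assms by (simp add: norm_minus diff_closed)
qed

lemma norm_diff_triangle:
  assumes "x \<in> vcarrier V" "y \<in> vcarrier V" "z \<in> vcarrier V"
  shows "vnorm V (vdiff V x z) \<le> vnorm V (vdiff V x y) + vnorm V (vdiff V y z)"
proof -
  have "vadd V (vdiff V x y) (vdiff V y z) = vadd V x (vadd V (vadd V y (vscale V (- 1) y)) (vscale V (- 1) z))"
    using assms by (simp only: vdiff_def add_ac closed)
  then have "vdiff V x z = vadd V (vdiff V x y) (vdiff V y z)"
    using assms by (simp add: add_minus zero_add scale_closed vdiff_def)
  then show ?thesis
    using assms by (simp add: norm_triangle diff_closed)
qed

lemma norm_le_add_diff: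
  assumes "x \<in> vcarrier V" "y \<in> vcarrier V"
  shows "vnorm V x \<le> vnorm V y + vnorm V (vdiff V x y)"
  using norm_triangle[of y "vdiff V x y"] assms by (simp add: add_diff diff_closed)

lemma unit_ballD: "x \<in> unit_ball V \<Longrightarrow> x \<in> vcarrier V" "x \<in> unit_ball V \<Longrightarrow> vnorm V x \<le> 1"
  by (simp_all add: unit_ball_def)

lemma zero_in_unit_ball: "vzero V \<in> unit_ball V"
  by (simp add: unit_ball_def zero_closed norm_zero)

end

section \<open>Bounded operators, operator norms and functionals\<close>

lemma normed_space_scalars: "normed_space (scalars :: ('k::real_or_complex, 'k) nspace)"
  using complete_scalars by (rule banach_space.axioms(1))

lemma scalars_simps [simp]:
  "vcarrier scalars = UNIV" "vadd scalars = (+)" "vzero scalars = 0" "vscale scalars = (*)"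
  "vnorm scalars = norm"
  by (simp_all add: scalars_def)

lemma dual_simps [simp]:
  "vcarrier (dual V) = bounded_ops V scalars" "vnorm (dual V) = op_norm V scalars"
  "vadd (dual V) = (\<lambda>f g. \<lambda>x\<in>vcarrier V. f x + g x)" "vscale (dual V) = (\<lambda>a f. \<lambda>x\<in>vcarrier V. a * f x)"
  by (simp_all add: dual_def op_space_def)

lemma bounded_opsI:
  assumes "\<And>x. x \<in> vcarrier V \<Longrightarrow> T x \<in> vcarrier W"
    and "\<And>x y. x \<in> vcarrier V \<Longrightarrow> y \<in> vcarrier V \<Longrightarrow> T (vadd V x y) = vadd W (T x) (T y)"
    and "\<And>a x. x \<in> vcarrier V \<Longrightarrow> T (vscale V a x) = vscale W a (T x)"
    and "\<And>x. x \<in> vcarrier V \<Longrightarrow> vnorm W (T x) \<le> C * vnorm V x"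
    and "normed_space V"
  shows "(\<lambda>x\<in>vcarrier V. T x) \<in> bounded_ops V W"
  unfolding bounded_ops_def mem_Collect_eq using assms
  by (intro conjI exI[of _ C]) (simp_all add: normed_space.closed)

lemma bounded_opsD:
  assumes "T \<in> bounded_ops V W"
  shows "x \<in> vcarrier V \<Longrightarrow> T x \<in> vcarrier W"
    and "x \<in> vcarrier V \<Longrightarrow> y \<in> vcarrier V \<Longrightarrow> T (vadd V x y) = vadd W (T x) (T y)"
    and "x \<in> vcarrier V \<Longrightarrow> T (vscale V a x) = vscale W a (T x)"
    and "\<exists>C. \<forall>x\<in>vcarrier V. vnorm W (T x) \<le> C * vnorm V x"
    and "T \<in> extensional (vcarrier V)"
  using assms by (simp_all add: bounded_ops_def PiE_iff)

lemma bounded_ops_bound_nonneg: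
  assumes "T \<in> bounded_ops V W" "normed_space V"
  obtains C where "0 \<le> C" "\<And>x. x \<in> vcarrier V \<Longrightarrow> vnorm W (T x) \<le> C * vnorm V x"
proof -
  obtain C where "\<forall>x\<in>vcarrier V. vnorm W (T x) \<le> C * vnorm V x"
    using bounded_opsD(4)[OF assms(1)] by blast
  moreover have "C * vnorm V x \<le> \<bar>C\<bar> * vnorm V x" if "x \<in> vcarrier V" for x
    using normed_space.norm_nonneg[OF assms(2) that] by (simp add: mult_right_mono)
  ultimately show ?thesis
    by (intro that[of "\<bar>C\<bar>"]) (auto intro: order_trans)
qed

lemma bdd_above_op_norm:
  assumes "T \<in> bounded_ops V W" "normed_space V"
  shows "bdd_above ((\<lambda>x. vnorm W (T x)) ` unit_ball V)"
proof -
  obtain C where C: "0 \<le> C" "\<And>x. x \<in> vcarrier V \<Longrightarrow> vnorm W (T x) \<le> C * vnorm V x"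
    using bounded_ops_bound_nonneg[OF assms] by blast
  have "vnorm W (T x) \<le> C" if "x \<in> unit_ball V" for x
    using C(2)[of x] C(1) that mult_left_mono[of "vnorm V x" 1 C] by (simp add: unit_ball_def)
  then show ?thesis
    by (intro bdd_aboveI2)
qed

lemma op_norm_le:
  assumes "normed_space V" "0 \<le> K" "\<And>x. x \<in> unit_ball V \<Longrightarrow> vnorm W (T x) \<le> K"
  shows "op_norm V W T \<le> K"
  unfolding op_norm_def using assms(3) normed_space.zero_in_unit_ball[OF assms(1)]
  by (intro cSUP_least) auto

lemma op_norm_le':
  assumes "normed_space V" "0 \<le> K" "\<And>x. x \<in> vcarrier V \<Longrightarrow> vnorm W (T x) \<le> K * vnorm V x"
  shows "op_norm V W T \<le> K"
proof (rule op_norm_le[OF assms(1,2)])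
  fix x assume "x \<in> unit_ball V"
  then show "vnorm W (T x) \<le> K"
    using assms(3)[of x] mult_left_mono[of "vnorm V x" 1 K] assms(2) by (simp add: unit_ball_def)
qed

lemma op_norm_upper:
  assumes "T \<in> bounded_ops V W" "normed_space V" "x \<in> unit_ball V"
  shows "vnorm W (T x) \<le> op_norm V W T"
  unfolding op_norm_def using assms bdd_above_op_norm by (intro cSUP_upper) auto

lemma op_norm_nonneg:
  assumes "T \<in> bounded_ops V W" "normed_space V" "normed_space W"
  shows "0 \<le> op_norm V W T"
  using op_norm_upper[OF assms(1,2) normed_space.zero_in_unit_ball[OF assms(2)]]
    normed_space.norm_nonneg[OF assms(3) bounded_opsD(1)[OF assms(1) normed_space.zero_closed[OF assms(2)]]]
  by simp

lemma op_norm_bound: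
  assumes T: "T \<in> bounded_ops V W" and V: "normed_space V" and W: "normed_space W"
    and x: "x \<in> vcarrier V"
  shows "vnorm W (T x) \<le> op_norm V W T * vnorm V x"
proof (cases "vnorm V x = 0")
  case True
  then have "x = vzero V"
    using normed_space.norm_eq_zero[OF V x] by simp
  then have "T x = T (vscale V 0 x)"
    using V x by (simp add: normed_space.zero_scale)
  also have "\<dots> = vscale W 0 (T x)"
    by (rule bounded_opsD(3)[OF T x])
  finally have "T x = vzero W"
    using W bounded_opsD(1)[OF T x] by (simp add: normed_space.zero_scale)
  then have "vnorm W (T x) = 0"
    using W by (simp add: normed_space.norm_zero)
  then show ?thesis
    using True by simp
next
  case False
  define r where "r = vnorm V x"
  have r: "0 < r"
    using False normed_space.norm_nonneg[OF V x] by (simp add: r_def)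
  define u where "u = vscale V (of_real (1 / r)) x"
  have "vnorm V u = 1 / r * r"
    unfolding u_def normed_space.norm_scale[OF V x] r_def[symmetric] using r
    by (simp add: norm_divide)
  then have "u \<in> unit_ball V"
    using r x normed_space.scale_closed[OF V x] by (simp add: unit_ball_def u_def)
  then have "vnorm W (T u) \<le> op_norm V W T"
    by (rule op_norm_upper[OF T V])
  moreover have "vnorm W (T u) = vnorm W (T x) / r"
    unfolding u_def bounded_opsD(3)[OF T x] normed_space.norm_scale[OF W bounded_opsD(1)[OF T x]]
    using r by (simp add: norm_divide)
  ultimately show ?thesis
    using r unfolding r_def[symmetric] by (simp add: field_simps)
qed

lemma unit_ball_dual_bound:
  assumes "f \<in> unit_ball (dual V)" "normed_space V" "x \<in> vcarrier V"
  shows "norm (f x) \<le> vnorm V x"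
proof -
  have f: "f \<in> bounded_ops V scalars" "op_norm V scalars f \<le> 1"
    using assms(1) by (simp_all add: unit_ball_def)
  have "norm (f x) \<le> op_norm V scalars f * vnorm V x"
    using op_norm_bound[OF f(1) assms(2) normed_space_scalars assms(3)] by simp
  also have "\<dots> \<le> 1 * vnorm V x"
    using f(2) assms normed_space.norm_nonneg by (intro mult_right_mono) auto
  finally show ?thesis
    by simp
qed

section \<open>The Hahn--Banach theorem\<close>

context normed_space
begin

abbreviation rscale :: "real \<Rightarrow> 'v \<Rightarrow> 'v" where
  "rscale t x \<equiv> vscale V (of_real t) x"

definition sublinear :: "('v \<Rightarrow> real) \<Rightarrow> bool" where
  "sublinear q \<longleftrightarrow>
     (\<forall>x\<in>vcarrier V. \<forall>y\<in>vcarrier V. q (vadd V x y) \<le> q x + q y) \<and>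
     (\<forall>t>0. \<forall>x\<in>vcarrier V. q (rscale t x) = t * q x)"

lemma sublinearD:
  assumes "sublinear q"
  shows "x \<in> vcarrier V \<Longrightarrow> y \<in> vcarrier V \<Longrightarrow> q (vadd V x y) \<le> q x + q y"
    and "0 < t \<Longrightarrow> x \<in> vcarrier V \<Longrightarrow> q (rscale t x) = t * q x"
  using assms by (simp_all add: sublinear_def)

lemma rscale_inverse:
  assumes "t \<noteq> 0" "x \<in> vcarrier V"
  shows "rscale t (rscale (1 / t) x) = x"
  using assms by (simp add: scale_scale scale_one flip: of_real_mult)

text \<open>One inequality suffices for homogeneity: applied to 1/t and the scaled vector it yields
  the reverse one.\<close>

lemma sublinearI:
  assumes "\<And>x y. x \<in> vcarrier V \<Longrightarrow> y \<in> vcarrier V \<Longrightarrow> q (vadd V x y) \<le> q x + q y"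
    and le: "\<And>t x. 0 < t \<Longrightarrow> x \<in> vcarrier V \<Longrightarrow> q (rscale t x) \<le> t * q x"
  shows "sublinear q"
proof -
  have "q (rscale t x) = t * q x" if "0 < t" "x \<in> vcarrier V" for t x
  proof (rule antisym)
    have "q x \<le> 1 / t * q (rscale t x)"
      using le[of "1 / t" "rscale t x"] rscale_inverse[of "1 / t" x] that by (simp add: scale_closed)
    then show "t * q x \<le> q (rscale t x)"
      using that by (simp add: field_simps)
  qed (use le that in blast)
  then show ?thesis
    using assms(1) by (simp add: sublinear_def)
qed

lemma sublinear_zero:
  assumes "sublinear q"
  shows "q (vzero V) = 0"
  using sublinearD(2)[OF assms, of 2 "vzero V"] by (simp add: scale_zero zero_closed)

lemma sublinear_minus:
  assumes "sublinear q" "x \<in> vcarrier V"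
  shows "- q (rscale (- 1) x) \<le> q x"
  using sublinearD(1)[OF assms(1,2), of "rscale (- 1) x"] sublinear_zero[OF assms(1)] assms(2)
  by (simp add: scale_closed add_minus)

text \<open>The parameter t = 1 at x = - y shows that this pushes \<open>q\<close> down to at most
  \<open>- q y\<close> at - y. A linear functional below the slope therefore takes the value
  \<open>q y\<close> at \<open>y\<close>.\<close>

definition slope :: "('v \<Rightarrow> real) \<Rightarrow> 'v \<Rightarrow> 'v \<Rightarrow> real" where
  "slope q y x = (INF t\<in>{0..}. q (vadd V x (rscale t y)) - t * q y)"

text \<open>The lower bound - q (- x) comes from subadditivity, as t y is the sum of x + t y and -
  x.\<close>

lemma slope_bdd:
  assumes q: "sublinear q" and x: "x \<in> vcarrier V" and y: "y \<in> vcarrier V"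
  shows "bdd_below ((\<lambda>t. q (vadd V x (rscale t y)) - t * q y) ` {0..})"
proof (rule bdd_belowI2)
  fix t :: real assume "t \<in> {0..}"
  have "rscale t y = vadd V (vadd V x (rscale t y)) (rscale (- 1) x)"
    using x y by (simp add: add_commute[of x] add_assoc scale_closed add_minus add_zero)
  then have "q (rscale t y) \<le> q (vadd V x (rscale t y)) + q (rscale (- 1) x)"
    using x y sublinearD(1)[OF q, of "vadd V x (rscale t y)" "rscale (- 1) x"] by (simp add: closed)
  moreover have "q (rscale t y) = t * q y"
    using \<open>t \<in> {0..}\<close> y sublinearD(2)[OF q, of t y] sublinear_zero[OF q]
    by (cases "t = 0") (simp_all add: zero_scale)
  ultimately show "- q (rscale (- 1) x) \<le> q (vadd V x (rscale t y)) - t * q y"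
    by simp
qed

lemma slope_le:
  assumes "sublinear q" "x \<in> vcarrier V" "y \<in> vcarrier V" "0 \<le> t"
  shows "slope q y x \<le> q (vadd V x (rscale t y)) - t * q y"
  unfolding slope_def using assms by (intro cINF_lower slope_bdd) auto

lemma slope_le_self:
  assumes "sublinear q" "x \<in> vcarrier V" "y \<in> vcarrier V"
  shows "slope q y x \<le> q x"
  using slope_le[OF assms, of 0] assms by (simp add: zero_scale add_zero)

lemma slope_greatest:
  assumes "\<And>t. 0 \<le> t \<Longrightarrow> c \<le> q (vadd V x (rscale t y)) - t * q y"
  shows "c \<le> slope q y x"
  unfolding slope_def using assms by (intro cINF_greatest) auto

text \<open>The parameters of two infima add up, since x + x' + (t + s) y is the sum of x + t y and
  x' + s y; scaling \<open>x\<close> by r turns the parameter t into r t.\<close>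

lemma sublinear_slope:
  assumes q: "sublinear q" and y: "y \<in> vcarrier V"
  shows "sublinear (slope q y)"
proof (rule sublinearI)
  fix x x' assume x: "x \<in> vcarrier V" "x' \<in> vcarrier V"
  have le: "slope q y (vadd V x x') \<le>
      (q (vadd V x (rscale t y)) - t * q y) + (q (vadd V x' (rscale s y)) - s * q y)"
    if "0 \<le> t" "0 \<le> s" for s t
  proof -
    have "vadd V (vadd V x x') (rscale (t + s) y) =
        vadd V (vadd V x (rscale t y)) (vadd V x' (rscale s y))"
      using x y by (simp add: scale_add_left add_ac closed)
    then show ?thesis
      using slope_le[OF q _ y, of "vadd V x x'" "t + s"] that x y
        sublinearD(1)[OF q, of "vadd V x (rscale t y)" "vadd V x' (rscale s y)"]
      by (simp add: closed algebra_simps)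
  qed
  have "slope q y (vadd V x x') - (q (vadd V x (rscale t y)) - t * q y) \<le> slope q y x'"
    if "0 \<le> t" for t
    by (rule slope_greatest) (use le[OF that] in \<open>simp add: diff_le_eq add.commute\<close>)
  then have "slope q y (vadd V x x') - slope q y x' \<le> slope q y x"
    by (intro slope_greatest) (simp add: algebra_simps)
  then show "slope q y (vadd V x x') \<le> slope q y x + slope q y x'"
    by simp
next
  fix r :: real and x assume r: "0 < r" and x: "x \<in> vcarrier V"
  have "1 / r * slope q y (rscale r x) \<le> q (vadd V x (rscale t y)) - t * q y" if "0 \<le> t" for t
  proof -
    have "vadd V (rscale r x) (rscale (r * t) y) = rscale r (vadd V x (rscale t y))"
      using x y by (simp add: scale_add_right scale_scale scale_closed)
    then have "slope q y (rscale r x) \<le> r * q (vadd V x (rscale t y)) - r * t * q y"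
      using slope_le[OF q _ y, of "rscale r x" "r * t"] that r x y
        sublinearD(2)[OF q r, of "vadd V x (rscale t y)"] by (simp add: closed)
    then show ?thesis
      using r by (simp add: field_simps)
  qed
  then have "1 / r * slope q y (rscale r x) \<le> slope q y x"
    by (rule slope_greatest)
  then show "slope q y (rscale r x) \<le> r * slope q y x"
    using r by (simp add: field_simps)
qed

text \<open>An infimum of subadditive functions need not be subadditive. In a chain, however, the
  lower of two members bounds both summands simultaneously. The infima are finite because every
  member lies above - p (- x).\<close>

lemma sublinear_chain_Inf:
  assumes p: "sublinear p" and "C \<noteq> {}"
    and C: "\<And>q. q \<in> C \<Longrightarrow> sublinear q" "\<And>q x. q \<in> C \<Longrightarrow> x \<in> vcarrier V \<Longrightarrow> q x \<le> p x"
    and chain: "\<And>q q'. q \<in> C \<Longrightarrow> q' \<in> C \<Longrightarrow>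
      (\<forall>x\<in>vcarrier V. q x \<le> q' x) \<or> (\<forall>x\<in>vcarrier V. q' x \<le> q x)"
  shows "sublinear (\<lambda>x. INF q\<in>C. q x)" and "\<And>q x. q \<in> C \<Longrightarrow> x \<in> vcarrier V \<Longrightarrow> (INF q\<in>C. q x) \<le> q x"
proof -
  have bdd: "bdd_below ((\<lambda>q. q x) ` C)" if "x \<in> vcarrier V" for x
  proof (rule bdd_belowI2)
    fix q assume "q \<in> C"
    then show "- p (rscale (- 1) x) \<le> q x"
      using C(2)[of q "rscale (- 1) x"] sublinear_minus[OF C(1), of q x] that
      by (simp add: scale_closed)
  qed
  show lower: "(INF q\<in>C. q x) \<le> q x" if "q \<in> C" "x \<in> vcarrier V" for q x
    using that bdd by (intro cINF_lower)
  show "sublinear (\<lambda>x. INF q\<in>C. q x)"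
  proof (rule sublinearI)
    fix x y assume xy: "x \<in> vcarrier V" "y \<in> vcarrier V"
    have le: "(INF q\<in>C. q (vadd V x y)) \<le> q x + q' y" if qq: "q \<in> C" "q' \<in> C" for q q'
    proof -
      obtain r where r: "r \<in> C" "r x \<le> q x" "r y \<le> q' y"
        using chain[OF qq] qq xy by auto
      have "(INF q\<in>C. q (vadd V x y)) \<le> r (vadd V x y)"
        using r xy by (intro lower) (simp_all add: closed)
      then show ?thesis
        using sublinearD(1)[OF C(1)[OF r(1)] xy] r by simp
    qed
    then have "(INF q\<in>C. q (vadd V x y)) - q x \<le> (INF q\<in>C. q y)" if "q \<in> C" for q
      using le[OF that] \<open>C \<noteq> {}\<close> by (intro cINF_greatest) (simp_all add: diff_le_eq add.commute)
    then have "(INF q\<in>C. q (vadd V x y)) - (INF q\<in>C. q y) \<le> (INF q\<in>C. q x)"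
      using \<open>C \<noteq> {}\<close> by (intro cINF_greatest) (auto simp: algebra_simps)
    then show "(INF q\<in>C. q (vadd V x y)) \<le> (INF q\<in>C. q x) + (INF q\<in>C. q y)"
      by simp
  next
    fix t :: real and x assume t: "0 < t" and x: "x \<in> vcarrier V"
    have "1 / t * (INF q\<in>C. q (rscale t x)) \<le> q x" if "q \<in> C" for q
      using lower[OF that, of "rscale t x"] sublinearD(2)[OF C(1)[OF that] t x] t x
      by (simp add: scale_closed field_simps)
    then have "1 / t * (INF q\<in>C. q (rscale t x)) \<le> (INF q\<in>C. q x)"
      using \<open>C \<noteq> {}\<close> by (intro cINF_greatest)
    then show "(INF q\<in>C. q (rscale t x)) \<le> t * (INF q\<in>C. q x)"
      using t by (simp add: field_simps)
  qed
qed

text \<open>A minimal sublinear functional equals each of its slopes, hence it is additive.\<close>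

lemma ex_linear_below_sublinear:
  assumes p: "sublinear p"
  shows "\<exists>q. (\<forall>x\<in>vcarrier V. q x \<le> p x) \<and>
     (\<forall>x\<in>vcarrier V. \<forall>y\<in>vcarrier V. q (vadd V x y) = q x + q y) \<and>
     (\<forall>t. \<forall>x\<in>vcarrier V. q (rscale t x) = t * q x)"
proof -
  \<comment> \<open>Functions are taken extensional so that the pointwise order on the carrier is
    antisymmetric. The order \<open>P\<close> is reversed: a maximal element for \<open>P\<close> is
    a minimal functional.\<close>
  define A where "A = {q \<in> extensional (vcarrier V). sublinear q \<and> (\<forall>x\<in>vcarrier V. q x \<le> p x)}"
  define P where "P q q' \<longleftrightarrow> (\<forall>x\<in>vcarrier V. q' x \<le> q x)" for q q' :: "'v \<Rightarrow> real"
  have sub_restrict: "sublinear (restrict q (vcarrier V)) \<longleftrightarrow> sublinear q" for q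
    by (simp add: sublinear_def closed)
  have "\<exists>m\<in>A. \<forall>a\<in>A. P m a \<longrightarrow> a = m"
  proof (rule predicate_Zorn)
    show "partial_order_on A (relation_of P A)"
      by (rule partial_order_on_relation_ofI)
        (auto simp: P_def A_def intro: order_trans intro!: extensionalityI[of _ "vcarrier V", OF _ _ order.antisym])
    fix C assume C: "C \<in> Chains (relation_of P A)"
    show "\<exists>u\<in>A. \<forall>a\<in>C. P a u"
    proof (cases "C = {}")
      case True
      have "restrict p (vcarrier V) \<in> A"
        using p by (simp add: A_def sub_restrict)
      then show ?thesis
        using True by blast
    next
      case False
      have "C \<subseteq> A"
        using C by (auto simp: Chains_def relation_of_def)
      moreover have "P q q' \<or> P q' q" if "q \<in> C" "q' \<in> C" for q q'
        using C that by (auto simp: Chains_def relation_of_def)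
      ultimately have
        "sublinear (\<lambda>x. INF q\<in>C. q x)" "\<And>q x. q \<in> C \<Longrightarrow> x \<in> vcarrier V \<Longrightarrow> (INF q\<in>C. q x) \<le> q x"
        using sublinear_chain_Inf[OF p False] unfolding A_def P_def by blast+
      moreover have "(INF q\<in>C. q x) \<le> p x" if "x \<in> vcarrier V" for x
      proof -
        obtain q where "q \<in> C"
          using False by blast
        then show ?thesis
          using calculation(2)[of q x] \<open>C \<subseteq> A\<close> that by (force simp: A_def)
      qed
      ultimately have "(\<lambda>x\<in>vcarrier V. INF q\<in>C. q x) \<in> A" "\<forall>q\<in>C. P q (\<lambda>x\<in>vcarrier V. INF q\<in>C. q x)"
        by (simp_all add: A_def P_def sub_restrict)
      then show ?thesis
        by blast
    qed
  qed
  then obtain q where q: "q \<in> A" and min: "\<And>a. a \<in> A \<Longrightarrow> P q a \<Longrightarrow> a = q"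
    by blast
  have sub: "sublinear q" and qp: "\<And>x. x \<in> vcarrier V \<Longrightarrow> q x \<le> p x"
    using q by (auto simp: A_def)
  have "q x + q y \<le> q (vadd V x y)" if xy: "x \<in> vcarrier V" "y \<in> vcarrier V" for x y
  proof -
    have le: "slope q y z \<le> q z" if "z \<in> vcarrier V" for z
      using slope_le_self[OF sub that xy(2)] .
    have "restrict (slope q y) (vcarrier V) \<in> A"
      using sublinear_slope[OF sub xy(2)] le qp by (auto simp: A_def sub_restrict intro: order_trans)
    moreover have "P q (restrict (slope q y) (vcarrier V))"
      using le by (simp add: P_def)
    ultimately have "slope q y x = q x"
      using min xy(1) by (metis restrict_apply')
    then show ?thesis
      using slope_le[OF sub xy, of 1] xy by (simp add: scale_one)
  qed
  then have add: "q (vadd V x y) = q x + q y" if "x \<in> vcarrier V" "y \<in> vcarrier V" for x y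
    using that sublinearD(1)[OF sub] by (simp add: antisym)
  have minus: "q (rscale (- 1) x) = - q x" if "x \<in> vcarrier V" for x
    using add[of x "rscale (- 1) x"] that sublinear_zero[OF sub] by (simp add: scale_closed add_minus)
  have "q (rscale t x) = t * q x" if x: "x \<in> vcarrier V" for t x
  proof -
    consider "0 < t" | "t = 0" | "t < 0"
      by linarith
    then show ?thesis
    proof cases
      case 3
      have "rscale t x = rscale (- 1) (rscale (- t) x)"
        using x by (simp add: scale_scale)
      then show ?thesis
        using minus[of "rscale (- t) x"] sublinearD(2)[OF sub, of "- t" x] 3 x
        by (simp add: scale_closed)
    qed (use sublinearD(2)[OF sub] sublinear_zero[OF sub] x in \<open>simp_all add: zero_scale\<close>)
  qed
  then show ?thesis
    using qp add by blast
qed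

end

section \<open>From real functionals to scalar functionals that norm a vector\<close>

context normed_space
begin

text \<open>Multiplying \<open>x\<close> by the unimodular \<open>c\<close> makes the value of
  \<open>F\<close> real and nonnegative, so that its real part is its modulus.\<close>

lemma norm_le_of_Re_le:
  fixes F :: "'v \<Rightarrow> 'k" and h :: "'k \<Rightarrow> complex"
  assumes scale: "\<And>a x. x \<in> vcarrier V \<Longrightarrow> F (vscale V a x) = a * F x"
    and h: "\<And>r. h (of_real r) = of_real r"
    and le: "\<And>x. x \<in> vcarrier V \<Longrightarrow> Re (h (F x)) \<le> vnorm V x"
    and x: "x \<in> vcarrier V"
  shows "norm (F x) \<le> vnorm V x"
proof (cases "F x = 0")
  case False
  define c where "c = of_real (norm (F x)) / F x"
  have "F (vscale V c x) = of_real (norm (F x))"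
    using scale[OF x] False by (simp add: c_def)
  then show ?thesis
    using le[of "vscale V c x"] x False by (simp add: h norm_scale scale_closed c_def norm_divide)
qed (simp add: norm_nonneg x)

text \<open>In the complex case this is the formula of Bohnenblust and Sobczyk, F(x) = q(x) - i q(i
  x). In the real case every scalar is the image of a real number, and \<open>q\<close> itself
  serves.\<close>

lemma ex_scalar_linear_with_real_part:
  fixes q :: "'v \<Rightarrow> real" and h :: "'k \<Rightarrow> complex"
  assumes add: "\<And>x y. x \<in> vcarrier V \<Longrightarrow> y \<in> vcarrier V \<Longrightarrow> q (vadd V x y) = q x + q y"
    and scale: "\<And>t x. x \<in> vcarrier V \<Longrightarrow> q (rscale t x) = t * q x"
    and h: "\<And>x y. h (x + y) = h x + h y" "\<And>x y. h (x - y) = h x - h y"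
      "\<And>x y. h (x * y) = h x * h y" "\<And>x. cmod (h x) = norm x" "\<And>r. h (of_real r) = of_real r"
      "range h = \<real> \<or> range h = UNIV"
  shows "\<exists>F. (\<forall>x\<in>vcarrier V. \<forall>y\<in>vcarrier V. F (vadd V x y) = F x + F y) \<and>
     (\<forall>a. \<forall>x\<in>vcarrier V. F (vscale V a x) = a * F x) \<and> (\<forall>x\<in>vcarrier V. Re (h (F x)) = q x)"
proof -
  have inj: "a = b" if "h a = h b" for a b
    using h(2)[of a b] h(4)[of "a - b"] that by simp
  from h(6) show ?thesis
  proof
    assume "range h = \<real>"
    then have "a = of_real (Re (h a))" for a
      by (intro inj) (metis Re_complex_of_real Reals_cases h(5) rangeI)
    then have "q (vscale V a x) = Re (h a) * q x" "of_real (Re (h a) * q x) = a * of_real (q x)"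
      if "x \<in> vcarrier V" for a x
      using that scale by (metis, metis of_real_mult)
    then have "of_real (q (vscale V a x)) = a * of_real (q x)" if "x \<in> vcarrier V" for a x
      using that by metis
    then show ?thesis
      by (intro exI[of _ "\<lambda>x. of_real (q x)"]) (simp add: add h(5))
  next
    assume rng: "range h = UNIV"
    then obtain i where i: "h i = \<i>"
      by (metis surjD)
    have ii: "i * i = - 1"
      by (rule inj) (use h(2)[of 0 1] h(5)[of 0] h(5)[of 1] in \<open>simp add: h(3) i\<close>)
    define F where "F x = of_real (q x) - i * of_real (q (vscale V i x))" for x
    have "F (vscale V a x) = a * F x" if x: "x \<in> vcarrier V" for a x
    proof -
      define s t where "s = Re (h a)" and "t = Im (h a)"
      have a: "a = of_real s + of_real t * i"
        by (rule inj) (simp add: h(1,3,5) i s_def t_def complex_eq_iff)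
      have "vscale V a x = vadd V (rscale s x) (rscale t (vscale V i x))"
        using x by (simp add: a scale_add_left scale_scale)
      then have 1: "q (vscale V a x) = s * q x + t * q (vscale V i x)"
        using x by (simp add: add scale closed)
      have "i * a = of_real s * i + of_real t * (i * i)"
        by (simp add: a algebra_simps)
      then have "i * a = of_real s * i + of_real (- t)"
        unfolding ii by simp
      then have "vscale V i (vscale V a x) = vadd V (rscale s (vscale V i x)) (rscale (- t) x)"
        using x by (simp only: scale_scale scale_add_left)
      then have 2: "q (vscale V i (vscale V a x)) = s * q (vscale V i x) - t * q x"
        using x scale[of x "- t"] by (simp add: add scale closed)
      have "a * F x = of_real s * of_real (q x) - (i * i) * (of_real t * of_real (q (vscale V i x)))
          + i * (of_real t * of_real (q x) - of_real s * of_real (q (vscale V i x)))"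
        by (simp add: a F_def algebra_simps)
      then show ?thesis
        unfolding ii by (simp add: F_def 1 2 algebra_simps)
    qed
    moreover have "F (vadd V x y) = F x + F y" if "x \<in> vcarrier V" "y \<in> vcarrier V" for x y
      using that by (simp add: F_def add scale_add_right closed algebra_simps)
    moreover have "Re (h (F x)) = q x" for x
      by (simp add: F_def h i)
    ultimately show ?thesis
      by blast
  qed
qed

text \<open>The majorant is \<open>slope (vnorm V) y\<close> instead of the norm. Domination by it
  forces the value at \<open>y\<close>, so no functional has to be extended from the line through
  \<open>y\<close>.\<close>

theorem ex_norming_functional:
  assumes y: "y \<in> vcarrier V"
  shows "\<exists>f\<in>unit_ball (dual V). f y = of_real (vnorm V y)"
proof -
  have p: "sublinear (vnorm V)"
    by (rule sublinearI) (auto simp: norm_triangle norm_scale)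
  obtain q where q: "\<And>x. x \<in> vcarrier V \<Longrightarrow> q x \<le> slope (vnorm V) y x"
    and add: "\<And>x y. x \<in> vcarrier V \<Longrightarrow> y \<in> vcarrier V \<Longrightarrow> q (vadd V x y) = q x + q y"
    and scale: "\<And>t x. x \<in> vcarrier V \<Longrightarrow> q (rscale t x) = t * q x"
    using ex_linear_below_sublinear[OF sublinear_slope[OF p y]] by blast
  have le: "q x \<le> vnorm V x" if "x \<in> vcarrier V" for x
    using q[OF that] slope_le_self[OF p that y] by simp
  have "vadd V (rscale (- 1) y) (rscale 1 y) = vzero V"
    using y by (simp add: add_commute scale_closed scale_one add_minus)
  then have "slope (vnorm V) y (rscale (- 1) y) \<le> - vnorm V y"
    using slope_le[OF p _ y, of "rscale (- 1) y" 1] y by (simp add: scale_closed norm_zero)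
  then have qy: "q y = vnorm V y"
    using q[of "rscale (- 1) y"] scale[OF y, of "- 1"] le[OF y] y by (simp add: scale_closed)
  obtain h :: "'k \<Rightarrow> complex" where
    h: "\<And>x y. h (x + y) = h x + h y" "\<And>x y. h (x - y) = h x - h y"
      "\<And>x y. h (x * y) = h x * h y" "\<And>x. cmod (h x) = norm x" "\<And>r. h (of_real r) = of_real r"
      "range h = \<real> \<or> range h = UNIV"
    using scalar_embedding by metis
  obtain F where F: "\<And>x y. x \<in> vcarrier V \<Longrightarrow> y \<in> vcarrier V \<Longrightarrow> F (vadd V x y) = F x + F y"
      "\<And>a x. x \<in> vcarrier V \<Longrightarrow> F (vscale V a x) = a * F x"
      "\<And>x. x \<in> vcarrier V \<Longrightarrow> Re (h (F x)) = q x"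
    using ex_scalar_linear_with_real_part[OF add scale h] by blast
  have F_le: "norm (F x) \<le> vnorm V x" if "x \<in> vcarrier V" for x
    using norm_le_of_Re_le[OF F(2) h(5) _ that] F(3) le by simp
  \<comment> \<open>A complex number whose modulus is at most its real part has imaginary part 0;
    this turns the real part of the value into the value.\<close>
  have "cmod (h (F y)) \<le> Re (h (F y))"
    using F_le[OF y] F(3)[OF y] qy by (simp add: h(4))
  then have "(Re (h (F y)))\<^sup>2 + (Im (h (F y)))\<^sup>2 \<le> (Re (h (F y)))\<^sup>2"
    by (metis cmod_power2 norm_ge_zero power_mono)
  then have "h (F y) = h (of_real (vnorm V y))"
    using F(3)[OF y] qy by (simp add: h(5) complex_eq_iff)
  then have "F y = of_real (vnorm V y)"
    using h(2)[of "F y" "of_real (vnorm V y)"] h(4)[of "F y - of_real (vnorm V y)"] by simp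
  moreover have "restrict F (vcarrier V) \<in> bounded_ops V scalars"
    by (rule bounded_opsI[where C = 1]) (use F F_le normed_space_axioms in simp_all)
  moreover have "op_norm V scalars (restrict F (vcarrier V)) \<le> 1"
    by (rule op_norm_le'[OF normed_space_axioms]) (use F_le in simp_all)
  ultimately show ?thesis
    using y by (intro bexI[of _ "restrict F (vcarrier V)"]) (simp_all add: unit_ball_def)
qed

end

section \<open>Linear operations on functionals and elements of the bidual\<close>

lemma dual_closed:
  assumes "normed_space V" "f \<in> bounded_ops V scalars"
  shows "g \<in> bounded_ops V scalars \<Longrightarrow> (\<lambda>x\<in>vcarrier V. f x + g x) \<in> bounded_ops V scalars"
    and "(\<lambda>x\<in>vcarrier V. c * f x) \<in> bounded_ops V scalars"
proof -
  note bound = op_norm_bound[OF _ assms(1) normed_space_scalars, unfolded scalars_simps]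
  show "(\<lambda>x\<in>vcarrier V. f x + g x) \<in> bounded_ops V scalars" if g: "g \<in> bounded_ops V scalars"
  proof (rule bounded_opsI[where C = "op_norm V scalars f + op_norm V scalars g"])
    fix x assume x: "x \<in> vcarrier V"
    show "vnorm scalars (f x + g x) \<le> (op_norm V scalars f + op_norm V scalars g) * vnorm V x"
      using bound[OF assms(2) x] bound[OF g x] norm_triangle_ineq[of "f x" "g x"]
      by (simp add: algebra_simps)
  qed (simp_all add: bounded_opsD[OF g] bounded_opsD[OF assms(2)] assms(1) algebra_simps)
  show "(\<lambda>x\<in>vcarrier V. c * f x) \<in> bounded_ops V scalars"
  proof (rule bounded_opsI[where C = "norm c * op_norm V scalars f"])
    fix x assume x: "x \<in> vcarrier V"
    show "vnorm scalars (c * f x) \<le> norm c * op_norm V scalars f * vnorm V x"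
      using mult_left_mono[OF bound[OF assms(2) x] norm_ge_zero[of c]] by (simp add: norm_mult mult_ac)
  qed (simp_all add: bounded_opsD[OF assms(2)] assms(1) algebra_simps)
qed

lemma bidualI:
  assumes "normed_space V"
    and "\<And>f g. f \<in> bounded_ops V scalars \<Longrightarrow> g \<in> bounded_ops V scalars \<Longrightarrow>
      T (\<lambda>x\<in>vcarrier V. f x + g x) = T f + T g"
    and "\<And>c f. f \<in> bounded_ops V scalars \<Longrightarrow> T (\<lambda>x\<in>vcarrier V. c * f x) = c * T f"
    and "\<And>f. f \<in> bounded_ops V scalars \<Longrightarrow> norm (T f) \<le> C * op_norm V scalars f"
  shows "(\<lambda>f\<in>bounded_ops V scalars. T f) \<in> bounded_ops (dual V) scalars"
  unfolding bounded_ops_def[of "dual V" scalars] mem_Collect_eq dual_simps scalars_simps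
  using assms by (intro conjI exI[of _ C]) (simp_all add: dual_closed)

lemma
  assumes "a \<in> bounded_ops (dual V) scalars" "f \<in> bounded_ops V scalars"
  shows bidual_add: "g \<in> bounded_ops V scalars \<Longrightarrow> a (\<lambda>x\<in>vcarrier V. f x + g x) = a f + a g"
    and bidual_scale: "a (\<lambda>x\<in>vcarrier V. c * f x) = c * a f"
  using bounded_opsD(2,3)[OF assms(1)] assms(2) by simp_all

lemma bidual_bound:
  assumes "a \<in> bounded_ops (dual V) scalars" "normed_space V"
  obtains C where "0 \<le> C" "\<And>f. f \<in> bounded_ops V scalars \<Longrightarrow> norm (a f) \<le> C * op_norm V scalars f"
proof -
  obtain C where C: "\<forall>f\<in>bounded_ops V scalars. norm (a f) \<le> C * op_norm V scalars f"
    using bounded_opsD(4)[OF assms(1)] by auto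
  have "norm (a f) \<le> \<bar>C\<bar> * op_norm V scalars f" if f: "f \<in> bounded_ops V scalars" for f
    using C f mult_right_mono[OF abs_ge_self[of C] op_norm_nonneg[OF f assms(2) normed_space_scalars]]
    by force
  then show ?thesis
    by (intro that[of "\<bar>C\<bar>"]) auto
qed

section \<open>Bilinear mappings\<close>

lemma bilinear_mapsD:
  assumes "\<Phi> \<in> bilinear_maps X1 X2 Y"
  shows "x \<in> vcarrier X1 \<Longrightarrow> y \<in> vcarrier X2 \<Longrightarrow> \<Phi> (x, y) \<in> vcarrier Y"
    and "x \<in> vcarrier X1 \<Longrightarrow> x' \<in> vcarrier X1 \<Longrightarrow> y \<in> vcarrier X2 \<Longrightarrow>
      \<Phi> (vadd X1 x x', y) = vadd Y (\<Phi> (x, y)) (\<Phi> (x', y))"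
    and "x \<in> vcarrier X1 \<Longrightarrow> y \<in> vcarrier X2 \<Longrightarrow> y' \<in> vcarrier X2 \<Longrightarrow>
      \<Phi> (x, vadd X2 y y') = vadd Y (\<Phi> (x, y)) (\<Phi> (x, y'))"
    and "x \<in> vcarrier X1 \<Longrightarrow> y \<in> vcarrier X2 \<Longrightarrow> \<Phi> (vscale X1 a x, y) = vscale Y a (\<Phi> (x, y))"
    and "x \<in> vcarrier X1 \<Longrightarrow> y \<in> vcarrier X2 \<Longrightarrow> \<Phi> (x, vscale X2 a y) = vscale Y a (\<Phi> (x, y))"
    and "\<exists>C. \<forall>x\<in>vcarrier X1. \<forall>y\<in>vcarrier X2. vnorm Y (\<Phi> (x, y)) \<le> C * vnorm X1 x * vnorm X2 y"
    and "\<Phi> \<in> extensional (vcarrier X1 \<times> vcarrier X2)"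
  using assms by (simp_all add: bilinear_maps_def PiE_iff)

locale normed_triple =
  X1: normed_space X1 + X2: normed_space X2 + Y: normed_space Y
  for X1 :: "('k::real_or_complex, 'v) nspace" and X2 :: "('k, 'w) nspace" and Y :: "('k, 'y) nspace"
begin

lemma bilinear_bound:
  assumes "\<Phi> \<in> bilinear_maps X1 X2 Y"
  obtains C where "0 \<le> C"
    "\<And>x y. x \<in> vcarrier X1 \<Longrightarrow> y \<in> vcarrier X2 \<Longrightarrow> vnorm Y (\<Phi> (x, y)) \<le> C * vnorm X1 x * vnorm X2 y"
proof -
  obtain C where C: "\<forall>x\<in>vcarrier X1. \<forall>y\<in>vcarrier X2. vnorm Y (\<Phi> (x, y)) \<le> C * vnorm X1 x * vnorm X2 y"
    using bilinear_mapsD(6)[OF assms] by blast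
  have "vnorm Y (\<Phi> (x, y)) \<le> \<bar>C\<bar> * vnorm X1 x * vnorm X2 y" if "x \<in> vcarrier X1" "y \<in> vcarrier X2" for x y
  proof -
    have "C * vnorm X1 x * vnorm X2 y \<le> \<bar>C\<bar> * vnorm X1 x * vnorm X2 y"
      using that by (intro mult_right_mono X1.norm_nonneg X2.norm_nonneg) auto
    then show ?thesis
      using C that by force
  qed
  then show ?thesis
    by (intro that[of "\<bar>C\<bar>"]) auto
qed

lemma bilinear_norm_upper:
  assumes \<Phi>: "\<Phi> \<in> bilinear_maps X1 X2 Y" and "x \<in> unit_ball X1" "y \<in> unit_ball X2"
  shows "vnorm Y (\<Phi> (x, y)) \<le> bilinear_norm X1 X2 Y \<Phi>"
proof -
  obtain C where C: "0 \<le> C"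
    "\<And>x y. x \<in> vcarrier X1 \<Longrightarrow> y \<in> vcarrier X2 \<Longrightarrow> vnorm Y (\<Phi> (x, y)) \<le> C * vnorm X1 x * vnorm X2 y"
    using bilinear_bound[OF \<Phi>] by blast
  have "vnorm Y (\<Phi> (x, y)) \<le> C" if "x \<in> unit_ball X1" "y \<in> unit_ball X2" for x y
  proof -
    have "C * vnorm X1 x * vnorm X2 y \<le> C * 1 * 1"
      using that C(1) by (intro mult_mono) (auto simp: unit_ball_def X1.norm_nonneg X2.norm_nonneg)
    then show ?thesis
      using C(2)[of x y] that by (simp add: unit_ball_def)
  qed
  then have "bdd_above ((\<lambda>p. vnorm Y (\<Phi> p)) ` (unit_ball X1 \<times> unit_ball X2))"
    by (intro bdd_aboveI2[of _ _ C]) auto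
  then show ?thesis
    unfolding bilinear_norm_def using assms by (intro cSUP_upper) auto
qed

lemma bilinear_norm_le:
  assumes "\<And>x y. x \<in> unit_ball X1 \<Longrightarrow> y \<in> unit_ball X2 \<Longrightarrow> vnorm Y (\<Phi> (x, y)) \<le> c"
  shows "bilinear_norm X1 X2 Y \<Phi> \<le> c"
  unfolding bilinear_norm_def using X1.zero_in_unit_ball X2.zero_in_unit_ball assms
  by (intro cSUP_least) auto

lemma bilinear_norm_nonneg:
  assumes "\<Phi> \<in> bilinear_maps X1 X2 Y"
  shows "0 \<le> bilinear_norm X1 X2 Y \<Phi>"
  using bilinear_norm_upper[OF assms X1.zero_in_unit_ball X2.zero_in_unit_ball]
    Y.norm_nonneg[OF bilinear_mapsD(1)[OF assms X1.zero_closed X2.zero_closed]] by simp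

lemma bilinear_norm_approx:
  assumes "0 < \<eta>"
  shows "\<exists>x\<in>unit_ball X1. \<exists>y\<in>unit_ball X2. bilinear_norm X1 X2 Y \<Phi> - \<eta> \<le> vnorm Y (\<Phi> (x, y))"
proof (rule ccontr)
  assume "\<not> ?thesis"
  then have "bilinear_norm X1 X2 Y \<Phi> \<le> bilinear_norm X1 X2 Y \<Phi> - \<eta>"
    by (intro bilinear_norm_le) (auto simp: not_le intro: less_imp_le)
  then show False
    using assms by simp
qed

lemma comp_functional:
  assumes \<Phi>: "\<Phi> \<in> bilinear_maps X1 X2 Y" and f: "f \<in> bounded_ops Y scalars"
  shows "y \<in> vcarrier X2 \<Longrightarrow> (\<lambda>x\<in>vcarrier X1. f (\<Phi> (x, y))) \<in> bounded_ops X1 scalars"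
    and "x \<in> vcarrier X1 \<Longrightarrow> (\<lambda>y\<in>vcarrier X2. f (\<Phi> (x, y))) \<in> bounded_ops X2 scalars"
proof -
  obtain C where C: "0 \<le> C"
    "\<And>x y. x \<in> vcarrier X1 \<Longrightarrow> y \<in> vcarrier X2 \<Longrightarrow> vnorm Y (\<Phi> (x, y)) \<le> C * vnorm X1 x * vnorm X2 y"
    using bilinear_bound[OF \<Phi>] by blast
  have le: "norm (f (\<Phi> (x, y))) \<le> op_norm Y scalars f * (C * vnorm X1 x * vnorm X2 y)"
    if "x \<in> vcarrier X1" "y \<in> vcarrier X2" for x y
  proof -
    have "norm (f (\<Phi> (x, y))) \<le> op_norm Y scalars f * vnorm Y (\<Phi> (x, y))"
      using op_norm_bound[OF f Y.normed_space_axioms normed_space_scalars bilinear_mapsD(1)[OF \<Phi> that]] by simp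
    also have "\<dots> \<le> op_norm Y scalars f * (C * vnorm X1 x * vnorm X2 y)"
      using C(2)[OF that] op_norm_nonneg[OF f Y.normed_space_axioms normed_space_scalars]
      by (rule mult_left_mono)
    finally show ?thesis .
  qed
  show "(\<lambda>x\<in>vcarrier X1. f (\<Phi> (x, y))) \<in> bounded_ops X1 scalars" if y: "y \<in> vcarrier X2"
    using le[OF _ y] bilinear_mapsD[OF \<Phi>] bounded_opsD[OF f] y
    by (intro bounded_opsI[where C = "op_norm Y scalars f * C * vnorm X2 y"] X1.normed_space_axioms)
      (simp_all add: mult_ac)
  show "(\<lambda>y\<in>vcarrier X2. f (\<Phi> (x, y))) \<in> bounded_ops X2 scalars" if x: "x \<in> vcarrier X1"
    using le[OF x] bilinear_mapsD[OF \<Phi>] bounded_opsD[OF f] x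
    by (intro bounded_opsI[where C = "op_norm Y scalars f * C * vnorm X1 x"] X2.normed_space_axioms)
      (simp_all add: mult_ac)
qed

section \<open>Arens extensions as iterated evaluations\<close>

text \<open>The net-free formula for the Arens extension: \<open>a2\<close> removes the second
  variable, then \<open>a1\<close> the first. It shows that the iterated limit does not depend on
  the nets.\<close>

definition iterated_eval ::
    "('v \<times> 'w \<Rightarrow> 'y) \<Rightarrow> (('v \<Rightarrow> 'k) \<Rightarrow> 'k) \<Rightarrow> (('w \<Rightarrow> 'k) \<Rightarrow> 'k) \<Rightarrow> (('y \<Rightarrow> 'k) \<Rightarrow> 'k)" where
  "iterated_eval \<Phi> a1 a2 = (\<lambda>f\<in>bounded_ops Y scalars.
     a1 (\<lambda>x\<in>vcarrier X1. a2 (\<lambda>y\<in>vcarrier X2. f (\<Phi> (x, y)))))"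

text \<open>All three claims rest on one bound of \<open>a2\<close> on the slices by a multiple of
  the norm of \<open>f\<close> times the norm of \<open>x\<close>. Read in \<open>x\<close> it gives
  a functional on \<open>X1\<close>, read in \<open>f\<close> an element of the bidual of
  \<open>Y\<close>.\<close>

lemma
  assumes \<Phi>: "\<Phi> \<in> bilinear_maps X1 X2 Y" and a2: "a2 \<in> bounded_ops (dual X2) scalars"
  shows inner_functional: "f \<in> bounded_ops Y scalars \<Longrightarrow>
      (\<lambda>x\<in>vcarrier X1. a2 (\<lambda>y\<in>vcarrier X2. f (\<Phi> (x, y)))) \<in> bounded_ops X1 scalars"
    and inner_bidual: "x \<in> vcarrier X1 \<Longrightarrow>
      (\<lambda>f\<in>bounded_ops Y scalars. a2 (\<lambda>y\<in>vcarrier X2. f (\<Phi> (x, y)))) \<in> bounded_ops (dual Y) scalars"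
    and iterated_eval_bidual: "a1 \<in> bounded_ops (dual X1) scalars \<Longrightarrow>
      iterated_eval \<Phi> a1 a2 \<in> bounded_ops (dual Y) scalars"
proof -
  obtain C where C: "0 \<le> C"
    "\<And>x y. x \<in> vcarrier X1 \<Longrightarrow> y \<in> vcarrier X2 \<Longrightarrow> vnorm Y (\<Phi> (x, y)) \<le> C * vnorm X1 x * vnorm X2 y"
    using bilinear_bound[OF \<Phi>] by blast
  note slice = comp_functional(2)[OF \<Phi>]
  let ?g = "\<lambda>f x. \<lambda>y\<in>vcarrier X2. f (\<Phi> (x, y))"
  have nn: "0 \<le> op_norm Y scalars f" if "f \<in> bounded_ops Y scalars" for f
    using op_norm_nonneg[OF that Y.normed_space_axioms normed_space_scalars] .
  have slice_norm: "op_norm X2 scalars (?g f x) \<le> op_norm Y scalars f * C * vnorm X1 x"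
    if f: "f \<in> bounded_ops Y scalars" and x: "x \<in> vcarrier X1" for f x
  proof (rule op_norm_le'[OF X2.normed_space_axioms])
    show "0 \<le> op_norm Y scalars f * C * vnorm X1 x"
      using nn[OF f] C(1) X1.norm_nonneg[OF x] by simp
    fix y assume y: "y \<in> vcarrier X2"
    have "norm (f (\<Phi> (x, y))) \<le> op_norm Y scalars f * vnorm Y (\<Phi> (x, y))"
      using op_norm_bound[OF f Y.normed_space_axioms normed_space_scalars bilinear_mapsD(1)[OF \<Phi> x y]] by simp
    also have "\<dots> \<le> op_norm Y scalars f * (C * vnorm X1 x * vnorm X2 y)"
      using C(2)[OF x y] nn[OF f] by (rule mult_left_mono)
    finally show "vnorm scalars (?g f x y) \<le> op_norm Y scalars f * C * vnorm X1 x * vnorm X2 y"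
      using y by (simp add: mult_ac)
  qed
  obtain C2 where C2: "0 \<le> C2" "\<And>g. g \<in> bounded_ops X2 scalars \<Longrightarrow> norm (a2 g) \<le> C2 * op_norm X2 scalars g"
    using bidual_bound[OF a2 X2.normed_space_axioms] by blast
  have a2_le: "norm (a2 (?g f x)) \<le> op_norm Y scalars f * (C2 * C) * vnorm X1 x"
    if f: "f \<in> bounded_ops Y scalars" and x: "x \<in> vcarrier X1" for f x
    using C2(2)[OF slice[OF f x]] mult_left_mono[OF slice_norm[OF f x] C2(1)] by (simp add: mult_ac)
  have add1: "a2 (?g f (vadd X1 x x')) = a2 (?g f x) + a2 (?g f x')"
    if f: "f \<in> bounded_ops Y scalars" and x: "x \<in> vcarrier X1" "x' \<in> vcarrier X1" for f x x'
    unfolding bidual_add[OF a2 slice[OF f x(1)] slice[OF f x(2)], symmetric]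
    using x by (intro arg_cong[of _ _ a2] restrict_ext)
      (simp add: bilinear_mapsD[OF \<Phi>] bounded_opsD[OF f])
  have scale1: "a2 (?g f (vscale X1 c x)) = c * a2 (?g f x)"
    if f: "f \<in> bounded_ops Y scalars" and x: "x \<in> vcarrier X1" for f x c
    unfolding bidual_scale[OF a2 slice[OF f x], symmetric]
    using x by (intro arg_cong[of _ _ a2] restrict_ext)
      (simp add: bilinear_mapsD[OF \<Phi>] bounded_opsD[OF f])
  have add2: "a2 (?g (\<lambda>v\<in>vcarrier Y. f v + f' v) x) = a2 (?g f x) + a2 (?g f' x)"
    if f: "f \<in> bounded_ops Y scalars" "f' \<in> bounded_ops Y scalars" and x: "x \<in> vcarrier X1" for f f' x
    unfolding bidual_add[OF a2 slice[OF f(1) x] slice[OF f(2) x], symmetric]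
    using x by (intro arg_cong[of _ _ a2] restrict_ext) (simp add: bilinear_mapsD[OF \<Phi>])
  have scale2: "a2 (?g (\<lambda>v\<in>vcarrier Y. c * f v) x) = c * a2 (?g f x)"
    if f: "f \<in> bounded_ops Y scalars" and x: "x \<in> vcarrier X1" for f x c
    unfolding bidual_scale[OF a2 slice[OF f x], symmetric]
    using x by (intro arg_cong[of _ _ a2] restrict_ext) (simp add: bilinear_mapsD[OF \<Phi>])
  show inner: "(\<lambda>x\<in>vcarrier X1. a2 (?g f x)) \<in> bounded_ops X1 scalars" if f: "f \<in> bounded_ops Y scalars" for f
    by (rule bounded_opsI[where C = "op_norm Y scalars f * (C2 * C)"])
      (use a2_le[OF f] add1[OF f] scale1[OF f] X1.normed_space_axioms in simp_all)
  show "(\<lambda>f\<in>bounded_ops Y scalars. a2 (?g f x)) \<in> bounded_ops (dual Y) scalars" if x: "x \<in> vcarrier X1"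
    by (rule bidualI[where C = "C2 * C * vnorm X1 x"])
      (use a2_le[OF _ x] add2[OF _ _ x] scale2[OF _ x] Y.normed_space_axioms in \<open>simp_all add: mult_ac\<close>)
  show "iterated_eval \<Phi> a1 a2 \<in> bounded_ops (dual Y) scalars" if a1: "a1 \<in> bounded_ops (dual X1) scalars"
  proof -
    obtain C1 where C1: "0 \<le> C1" "\<And>g. g \<in> bounded_ops X1 scalars \<Longrightarrow> norm (a1 g) \<le> C1 * op_norm X1 scalars g"
      using bidual_bound[OF a1 X1.normed_space_axioms] by blast
    show ?thesis
      unfolding iterated_eval_def
    proof (rule bidualI[where C = "C1 * (C2 * C)", OF Y.normed_space_axioms])
      fix f f' assume f: "f \<in> bounded_ops Y scalars" "f' \<in> bounded_ops Y scalars"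
      show "a1 (\<lambda>x\<in>vcarrier X1. a2 (?g (\<lambda>v\<in>vcarrier Y. f v + f' v) x)) =
          a1 (\<lambda>x\<in>vcarrier X1. a2 (?g f x)) + a1 (\<lambda>x\<in>vcarrier X1. a2 (?g f' x))"
        unfolding bidual_add[OF a1 inner[OF f(1)] inner[OF f(2)], symmetric]
        by (intro arg_cong[of _ _ a1] restrict_ext) (simp only: restrict_apply' add2[OF f])
    next
      fix c f assume f: "f \<in> bounded_ops Y scalars"
      show "a1 (\<lambda>x\<in>vcarrier X1. a2 (?g (\<lambda>v\<in>vcarrier Y. c * f v) x)) =
          c * a1 (\<lambda>x\<in>vcarrier X1. a2 (?g f x))"
        unfolding bidual_scale[OF a1 inner[OF f], symmetric]
        by (intro arg_cong[of _ _ a1] restrict_ext) (simp only: restrict_apply' scale2[OF f])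
    next
      fix f assume f: "f \<in> bounded_ops Y scalars"
      have "op_norm X1 scalars (\<lambda>x\<in>vcarrier X1. a2 (?g f x)) \<le> op_norm Y scalars f * (C2 * C)"
        by (rule op_norm_le'[OF X1.normed_space_axioms]) (use a2_le[OF f] nn[OF f] C(1) C2(1) in simp_all)
      then show "norm (a1 (\<lambda>x\<in>vcarrier X1. a2 (?g f x))) \<le> C1 * (C2 * C) * op_norm Y scalars f"
        using C1(2)[OF inner[OF f]] mult_left_mono[OF _ C1(1)] by (fastforce simp: mult_ac)
    qed
  qed
qed

text \<open>The description in \<open>arens_12\<close> quantifies over all nets converging to
  \<open>a1\<close> and \<open>a2\<close>. One such pair, \<open>F1\<close> and \<open>F2\<close>,
  is assumed to exist, because otherwise the condition would be vacuous and the point not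
  unique.\<close>

lemma arens_12_eq:
  assumes \<Phi>: "\<Phi> \<in> bilinear_maps X1 X2 Y"
    and a1: "a1 \<in> bounded_ops (dual X1) scalars" and a2: "a2 \<in> bounded_ops (dual X2) scalars"
    and F1: "bounded_wstar_net X1 F1 a1" and F2: "bounded_wstar_net X2 F2 a2"
  shows "arens_12 X1 X2 Y \<Phi> a1 a2 = iterated_eval \<Phi> a1 a2"
  unfolding arens_12_def
proof (rule the_equality, intro conjI allI impI)
  show "iterated_eval \<Phi> a1 a2 \<in> vcarrier (bidual Y)"
    using iterated_eval_bidual[OF \<Phi> a2 a1] by simp
next
  fix F1 F2 assume F: "bounded_wstar_net X1 F1 a1" "bounded_wstar_net X2 F2 a2"
  let ?g = "\<lambda>x. \<lambda>f\<in>bounded_ops Y scalars. a2 (\<lambda>y\<in>vcarrier X2. f (\<Phi> (x, y)))"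
  have ev1: "\<forall>\<^sub>F x in F1. x \<in> vcarrier X1" and ev2: "\<forall>\<^sub>F y in F2. y \<in> vcarrier X2"
    using F by (auto simp: bounded_wstar_net_def elim: eventually_mono)
  have "wstar_tendsto Y (\<lambda>y. canonical Y (\<Phi> (x, y))) (?g x) F2" if x: "x \<in> vcarrier X1" for x
    unfolding wstar_tendsto_def
  proof
    fix f assume "f \<in> vcarrier (dual Y)"
    then have f: "f \<in> bounded_ops Y scalars"
      by simp
    note slice = comp_functional(2)[OF \<Phi> f x]
    have "((\<lambda>y. canonical X2 y (\<lambda>y\<in>vcarrier X2. f (\<Phi> (x, y)))) \<longlongrightarrow> ?g x f) F2"
      using F(2) f slice by (simp add: bounded_wstar_net_def wstar_tendsto_def)
    then show "((\<lambda>y. canonical Y (\<Phi> (x, y)) f) \<longlongrightarrow> ?g x f) F2"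
      by (rule Lim_transform_eventually) (use ev2 in eventually_elim, simp add: canonical_def f slice)
  qed
  moreover have "wstar_tendsto Y ?g (iterated_eval \<Phi> a1 a2) F1"
    unfolding wstar_tendsto_def
  proof
    fix f assume "f \<in> vcarrier (dual Y)"
    then have f: "f \<in> bounded_ops Y scalars"
      by simp
    note inner = inner_functional[OF \<Phi> a2 f]
    have "((\<lambda>x. canonical X1 x (\<lambda>x\<in>vcarrier X1. a2 (\<lambda>y\<in>vcarrier X2. f (\<Phi> (x, y)))))
        \<longlongrightarrow> iterated_eval \<Phi> a1 a2 f) F1"
      using F(1) f inner by (simp add: bounded_wstar_net_def wstar_tendsto_def iterated_eval_def)
    then show "((\<lambda>x. ?g x f) \<longlongrightarrow> iterated_eval \<Phi> a1 a2 f) F1"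
      by (rule Lim_transform_eventually) (use ev1 in eventually_elim, simp add: canonical_def f inner)
  qed
  ultimately show "wstar_iterated_limit Y F1 F2 (\<lambda>x1 x2. \<Phi> (x1, x2)) (iterated_eval \<Phi> a1 a2)"
    unfolding wstar_iterated_limit_def using ev1 inner_bidual[OF \<Phi> a2]
    by (intro exI[of _ ?g]) (auto elim: eventually_mono)
next
  fix z assume z: "z \<in> vcarrier (bidual Y) \<and> (\<forall>F1 F2. bounded_wstar_net X1 F1 a1 \<longrightarrow>
      bounded_wstar_net X2 F2 a2 \<longrightarrow> wstar_iterated_limit Y F1 F2 (\<lambda>x1 x2. \<Phi> (x1, x2)) z)"
  then obtain g where ev: "\<forall>\<^sub>F x in F1. g x \<in> vcarrier (bidual Y) \<and>
      wstar_tendsto Y (\<lambda>y. canonical Y (\<Phi> (x, y))) (g x) F2" and gz: "wstar_tendsto Y g z F1"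
    using F1 F2 unfolding wstar_iterated_limit_def by blast
  have ne: "F1 \<noteq> bot" "F2 \<noteq> bot" and ev1: "\<forall>\<^sub>F x in F1. x \<in> vcarrier X1" and ev2: "\<forall>\<^sub>F y in F2. y \<in> vcarrier X2"
    using F1 F2 by (auto simp: bounded_wstar_net_def elim: eventually_mono)
  show "z = iterated_eval \<Phi> a1 a2"
  proof (rule extensionalityI[of _ "bounded_ops Y scalars"])
    show "z \<in> extensional (bounded_ops Y scalars)"
      using z bounded_opsD(5)[of z "dual Y" scalars] by simp
    show "iterated_eval \<Phi> a1 a2 \<in> extensional (bounded_ops Y scalars)"
      by (simp add: iterated_eval_def)
    fix f assume f: "f \<in> bounded_ops Y scalars"
    note inner = inner_functional[OF \<Phi> a2 f]
    \<comment> \<open>The inner limits \<open>g\<close> are an arbitrary choice; uniqueness of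
      limits identifies them eventually with the values of \<open>a2\<close> on the slices.\<close>
    have "\<forall>\<^sub>F x in F1. g x f = canonical X1 x (\<lambda>x\<in>vcarrier X1. a2 (\<lambda>y\<in>vcarrier X2. f (\<Phi> (x, y))))"
      using ev ev1
    proof eventually_elim
      case (elim x)
      note slice = comp_functional(2)[OF \<Phi> f elim(2)]
      have "((\<lambda>y. canonical X2 y (\<lambda>y\<in>vcarrier X2. f (\<Phi> (x, y)))) \<longlongrightarrow> a2 (\<lambda>y\<in>vcarrier X2. f (\<Phi> (x, y)))) F2"
        using F2 slice by (simp add: bounded_wstar_net_def wstar_tendsto_def)
      then have "((\<lambda>y. canonical Y (\<Phi> (x, y)) f) \<longlongrightarrow> a2 (\<lambda>y\<in>vcarrier X2. f (\<Phi> (x, y)))) F2"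
        by (rule Lim_transform_eventually) (use ev2 in eventually_elim, simp add: canonical_def f slice)
      moreover have "((\<lambda>y. canonical Y (\<Phi> (x, y)) f) \<longlongrightarrow> g x f) F2"
        using elim(1) f by (simp add: wstar_tendsto_def)
      ultimately have "g x f = a2 (\<lambda>y\<in>vcarrier X2. f (\<Phi> (x, y)))"
        using tendsto_unique ne(2) by blast
      then show ?case
        using elim(2) inner by (simp add: canonical_def)
    qed
    moreover have "((\<lambda>x. g x f) \<longlongrightarrow> z f) F1"
      using gz f by (simp add: wstar_tendsto_def)
    ultimately have "((\<lambda>x. canonical X1 x (\<lambda>x\<in>vcarrier X1. a2 (\<lambda>y\<in>vcarrier X2. f (\<Phi> (x, y))))) \<longlongrightarrow> z f) F1"
      by (rule Lim_transform_eventually[rotated])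
    moreover have "((\<lambda>x. canonical X1 x (\<lambda>x\<in>vcarrier X1. a2 (\<lambda>y\<in>vcarrier X2. f (\<Phi> (x, y)))))
        \<longlongrightarrow> iterated_eval \<Phi> a1 a2 f) F1"
      using F1 f inner by (simp add: bounded_wstar_net_def wstar_tendsto_def iterated_eval_def)
    ultimately show "z f = iterated_eval \<Phi> a1 a2 f"
      using tendsto_unique ne(1) by blast
  qed
qed

end

section \<open>Weak-star limits of sequences in the unit ball\<close>

definition wstar_limit ::
    "('k::real_or_complex, 'v) nspace \<Rightarrow> (nat \<Rightarrow> 'v) \<Rightarrow> (('v \<Rightarrow> 'k) \<Rightarrow> 'k)" where
  "wstar_limit V x = (\<lambda>f\<in>bounded_ops V scalars. Lim limit_filter (\<lambda>n. f (x n)))"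

context normed_space
begin

context
  fixes x :: "nat \<Rightarrow> 'v"
  assumes x: "\<And>n. x n \<in> unit_ball V"
begin

text \<open>This takes the place of weak-star compactness of the bidual ball: boundedness of the
  values suffices for a limit along \<open>limit_filter\<close>, without passing to subnets.\<close>

lemma wstar_limit_tendsto:
  assumes f: "f \<in> bounded_ops V scalars"
  shows "((\<lambda>n. f (x n)) \<longlongrightarrow> wstar_limit V x f) limit_filter"
proof -
  have "norm (f (x n)) \<le> op_norm V scalars f" for n
    using op_norm_upper[OF f normed_space_axioms x] by simp
  then obtain l where l: "((\<lambda>n. f (x n)) \<longlongrightarrow> l) limit_filter"
    using limit_filter_convergent[of "\<lambda>n. f (x n)"] by blast
  then have "Lim limit_filter (\<lambda>n. f (x n)) = l"
    by (rule tendsto_Lim[OF limit_filter(1)])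
  then show ?thesis
    using f l by (simp add: wstar_limit_def)
qed

lemma wstar_limit_norm_le:
  assumes f: "f \<in> bounded_ops V scalars"
  shows "norm (wstar_limit V x f) \<le> op_norm V scalars f"
proof (rule tendsto_upperbound[OF tendsto_norm[OF wstar_limit_tendsto[OF f]]])
  show "\<forall>\<^sub>F n in limit_filter. norm (f (x n)) \<le> op_norm V scalars f"
    using op_norm_upper[OF f normed_space_axioms x] by simp
qed (rule limit_filter)

lemma wstar_limit_bidual: "wstar_limit V x \<in> bounded_ops (dual V) scalars"
proof -
  let ?L = "wstar_limit V x"
  have "(\<lambda>f\<in>bounded_ops V scalars. ?L f) \<in> bounded_ops (dual V) scalars"
  proof (rule bidualI[where C = 1, OF normed_space_axioms])
    fix f g assume fg: "f \<in> bounded_ops V scalars" "g \<in> bounded_ops V scalars"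
    have "((\<lambda>n. f (x n) + g (x n)) \<longlongrightarrow> ?L (\<lambda>x\<in>vcarrier V. f x + g x)) limit_filter"
      using wstar_limit_tendsto[OF dual_closed(1)[OF normed_space_axioms fg]] by (simp add: unit_ballD x)
    then show "?L (\<lambda>x\<in>vcarrier V. f x + g x) = ?L f + ?L g"
      using tendsto_add[OF wstar_limit_tendsto[OF fg(1)] wstar_limit_tendsto[OF fg(2)]]
      by (rule tendsto_unique[OF limit_filter(1)])
  next
    fix c f assume f: "f \<in> bounded_ops V scalars"
    have "((\<lambda>n. c * f (x n)) \<longlongrightarrow> ?L (\<lambda>x\<in>vcarrier V. c * f x)) limit_filter"
      using wstar_limit_tendsto[OF dual_closed(2)[OF normed_space_axioms f]] by (simp add: unit_ballD x)
    then show "?L (\<lambda>x\<in>vcarrier V. c * f x) = c * ?L f"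
      using tendsto_mult_left[OF wstar_limit_tendsto[OF f]] by (rule tendsto_unique[OF limit_filter(1)])
  qed (simp add: wstar_limit_norm_le)
  moreover have "(\<lambda>f\<in>bounded_ops V scalars. ?L f) = ?L"
    by (simp add: wstar_limit_def fun_eq_iff)
  ultimately show ?thesis
    by simp
qed

lemma wstar_limit_unit_ball: "wstar_limit V x \<in> unit_ball (bidual V)"
proof -
  have "norm (wstar_limit V x f) \<le> 1" if "f \<in> unit_ball (dual V)" for f
    using wstar_limit_norm_le[of f] that by (simp add: unit_ball_def)
  moreover have "(\<lambda>x\<in>vcarrier V. 0) \<in> bounded_ops V scalars"
    by (rule bounded_opsI[where C = 0]) (simp_all add: normed_space_axioms)
  then have "(\<lambda>x\<in>vcarrier V. 0) \<in> unit_ball (dual V)"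
    using op_norm_le'[OF normed_space_axioms, of 1 scalars "\<lambda>x\<in>vcarrier V. 0"] norm_nonneg
    by (simp add: unit_ball_def)
  ultimately have "op_norm (dual V) scalars (wstar_limit V x) \<le> 1"
    unfolding op_norm_def by (intro cSUP_least) auto
  then show ?thesis
    using wstar_limit_bidual by (simp add: unit_ball_def)
qed

text \<open>The pushed-forward filter is the net that \<open>arens_12_eq\<close> asks for at these
  limits.\<close>

lemma wstar_limit_net: "bounded_wstar_net V (filtermap x limit_filter) (wstar_limit V x)"
  unfolding bounded_wstar_net_def wstar_tendsto_def
proof (intro conjI ballI)
  show "filtermap x limit_filter \<noteq> bot"
    by (simp add: filtermap_bot_iff limit_filter)
  show "\<exists>r. \<forall>\<^sub>F y in filtermap x limit_filter. y \<in> vcarrier V \<and> vnorm V y \<le> r"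
    using x by (intro exI[of _ 1]) (simp add: eventually_filtermap unit_ball_def)
  fix f assume "f \<in> vcarrier (dual V)"
  then show "((\<lambda>y. canonical V y f) \<longlongrightarrow> wstar_limit V x f) (filtermap x limit_filter)"
    using wstar_limit_tendsto[of f] by (simp add: canonical_def filterlim_filtermap)
qed

end
end

section \<open>Norms of both Arens extensions at weak-star limits\<close>

context normed_triple
begin

text \<open>With l fixed, the lower bound passes to the limit in j, where i < j holds eventually,
  and then in i, where l \<le> i holds eventually. Only afterwards does l grow and remove the error.
  The upper bound \<open>N\<close> holds for every functional of the unit ball.\<close>

lemma arens_12_norm:
  assumes \<Phi>: "\<Phi> \<in> bilinear_maps X1 X2 Y"
    and le: "\<And>x y. x \<in> unit_ball X1 \<Longrightarrow> y \<in> unit_ball X2 \<Longrightarrow> vnorm Y (\<Phi> (x, y)) \<le> N"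
    and x: "\<And>n. x n \<in> unit_ball X1" and y: "\<And>n. y n \<in> unit_ball X2"
    and f: "\<And>l. f l \<in> unit_ball (dual Y)"
    and ge: "\<And>l i j. l \<le> i \<Longrightarrow> i < j \<Longrightarrow> N - \<tau> l \<le> norm (f l (\<Phi> (x i, y j)))"
    and \<tau>: "\<tau> \<longlonglongrightarrow> 0"
  shows "vnorm (bidual Y) (arens_12 X1 X2 Y \<Phi> (wstar_limit X1 x) (wstar_limit X2 y)) = N"
proof -
  let ?a1 = "wstar_limit X1 x" and ?a2 = "wstar_limit X2 y"
  let ?z = "iterated_eval \<Phi> ?a1 ?a2"
  note lf = limit_filter(1)
  have a2: "?a2 \<in> bounded_ops (dual X2) scalars"
    by (rule X2.wstar_limit_bidual[OF y])
  have z: "arens_12 X1 X2 Y \<Phi> ?a1 ?a2 = ?z"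
    by (rule arens_12_eq[OF \<Phi> X1.wstar_limit_bidual[OF x] a2 X1.wstar_limit_net[OF x] X2.wstar_limit_net[OF y]])
  have xc: "x n \<in> vcarrier X1" and yc: "y n \<in> vcarrier X2" for n
    using x y by (simp_all add: unit_ball_def)
  have lim2: "((\<lambda>j. norm (g (\<Phi> (x i, y j)))) \<longlongrightarrow> norm (?a2 (\<lambda>v\<in>vcarrier X2. g (\<Phi> (x i, v))))) limit_filter"
    if g: "g \<in> unit_ball (dual Y)" for g i
  proof -
    have "g \<in> bounded_ops Y scalars"
      using g by (simp add: unit_ball_def)
    from X2.wstar_limit_tendsto[OF y comp_functional(2)[OF \<Phi> this xc[of i]]]
    show ?thesis
      by (intro tendsto_norm) (simp add: yc)
  qed
  have lim1: "((\<lambda>i. norm (?a2 (\<lambda>v\<in>vcarrier X2. g (\<Phi> (x i, v))))) \<longlongrightarrow> norm (?z g)) limit_filter"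
    if "g \<in> unit_ball (dual Y)" for g
  proof -
    have g: "g \<in> bounded_ops Y scalars"
      using that by (simp add: unit_ball_def)
    from X1.wstar_limit_tendsto[OF x inner_functional[OF \<Phi> a2 this]]
    show ?thesis
      by (intro tendsto_norm) (simp add: xc iterated_eval_def g)
  qed
  have upper: "norm (?z g) \<le> N" if g: "g \<in> unit_ball (dual Y)" for g
  proof -
    have "norm (g (\<Phi> (x i, y j))) \<le> N" for i j
      using unit_ball_dual_bound[OF g Y.normed_space_axioms bilinear_mapsD(1)[OF \<Phi> xc yc]] le[OF x y]
      by (rule order_trans)
    then have "norm (?a2 (\<lambda>v\<in>vcarrier X2. g (\<Phi> (x i, v)))) \<le> N" for i
      by (intro tendsto_upperbound[OF lim2[OF g] _ lf]) simp
    then show ?thesis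
      by (intro tendsto_upperbound[OF lim1[OF g] _ lf]) simp
  qed
  then have bdd: "bdd_above ((\<lambda>g. norm (?z g)) ` unit_ball (dual Y))"
    by (rule bdd_aboveI2)
  have "N - \<tau> l \<le> norm (?z (f l))" for l
  proof -
    have "N - \<tau> l \<le> norm (?a2 (\<lambda>v\<in>vcarrier X2. f l (\<Phi> (x i, v))))" if "l \<le> i" for i
    proof (rule tendsto_lowerbound[OF lim2[OF f] _ lf])
      show "\<forall>\<^sub>F j in limit_filter. N - \<tau> l \<le> norm (f l (\<Phi> (x i, y j)))"
        using filter_leD[OF limit_filter(2) eventually_gt_at_top[of i]]
        by eventually_elim (use ge that in blast)
    qed
    then show ?thesis
      by (intro tendsto_lowerbound[OF lim1[OF f] _ lf])
        (use filter_leD[OF limit_filter(2) eventually_ge_at_top[of l]] in \<open>auto elim: eventually_mono\<close>)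
  qed
  also have "norm (?z (f l)) \<le> op_norm (dual Y) scalars ?z" for l
    unfolding op_norm_def scalars_simps by (rule cSUP_upper[OF f bdd])
  finally have "N - op_norm (dual Y) scalars ?z \<le> \<tau> l" for l
    by (simp add: algebra_simps)
  then have "N - op_norm (dual Y) scalars ?z \<le> 0"
    by (intro LIMSEQ_le_const[OF \<tau>]) blast
  moreover have "op_norm (dual Y) scalars ?z \<le> N"
    unfolding op_norm_def scalars_simps using f upper by (intro cSUP_least) blast+
  ultimately show ?thesis
    by (simp add: z)
qed

end

lemma bilinear_maps_swap:
  assumes "\<Phi> \<in> bilinear_maps X1 X2 Y"
  shows "\<Phi> \<circ> prod.swap \<in> bilinear_maps X2 X1 Y"
proof -
  note D = bilinear_mapsD[OF assms]
  obtain C where "\<forall>x\<in>vcarrier X1. \<forall>y\<in>vcarrier X2. vnorm Y (\<Phi> (x, y)) \<le> C * vnorm X1 x * vnorm X2 y"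
    using D(6) by blast
  then have "\<forall>y\<in>vcarrier X2. \<forall>x\<in>vcarrier X1. vnorm Y (\<Phi> (x, y)) \<le> C * vnorm X2 y * vnorm X1 x"
    by (simp add: mult_ac)
  moreover have "\<Phi> \<circ> prod.swap \<in> extensional (vcarrier X2 \<times> vcarrier X1)"
    using D(7) by (auto simp: extensional_def)
  ultimately show ?thesis
    using D(1-5) unfolding bilinear_maps_def mem_Collect_eq PiE_iff
    by (intro conjI exI[of _ C]) simp_all
qed

text \<open>Transposing the mapping interchanges the order of the limits, so every estimate has to
  be proved for one extension only.\<close>

lemma arens_21_eq_arens_12_swap:
  "arens_21 X1 X2 Y \<Phi> a1 a2 = arens_12 X2 X1 Y (\<Phi> \<circ> prod.swap) a2 a1"
  unfolding arens_21_def arens_12_def by (intro arg_cong[of _ _ The] ext) auto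

text \<open>Both orders of limits use the same two sequences, hence the same pair of weak-star
  limits; the two hypotheses \<open>ge\<close> are the halves above and below the diagonal.\<close>

lemma (in normed_triple) arens_attain_at_same_pairI:
  assumes \<Phi>: "\<Phi> \<in> bilinear_maps X1 X2 Y"
    and x: "\<And>n. x n \<in> unit_ball X1" and y: "\<And>n. y n \<in> unit_ball X2"
    and f: "\<And>l. f l \<in> unit_ball (dual Y)" and \<tau>: "\<tau> \<longlonglongrightarrow> 0"
    and ge: "\<And>l i j. l \<le> i \<Longrightarrow> i < j \<Longrightarrow> bilinear_norm X1 X2 Y \<Phi> - \<tau> l \<le> norm (f l (\<Phi> (x i, y j)))"
      "\<And>l i j. l \<le> j \<Longrightarrow> j < i \<Longrightarrow> bilinear_norm X1 X2 Y \<Phi> - \<tau> l \<le> norm (f l (\<Phi> (x i, y j)))"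
  shows "arens_attain_at_same_pair X1 X2 Y \<Phi>"
proof -
  interpret swap: normed_triple X2 X1 Y ..
  note le = bilinear_norm_upper[OF \<Phi>]
  show ?thesis
    unfolding arens_attain_at_same_pair_def
  proof (intro bexI conjI)
    show "vnorm (bidual Y) (arens_12 X1 X2 Y \<Phi> (wstar_limit X1 x) (wstar_limit X2 y)) = bilinear_norm X1 X2 Y \<Phi>"
      by (rule arens_12_norm[OF \<Phi> le x y f ge(1) \<tau>])
    show "vnorm (bidual Y) (arens_21 X1 X2 Y \<Phi> (wstar_limit X1 x) (wstar_limit X2 y)) = bilinear_norm X1 X2 Y \<Phi>"
      unfolding arens_21_eq_arens_12_swap
      by (rule swap.arens_12_norm[OF bilinear_maps_swap[OF \<Phi>] _ y x f _ \<tau>]) (use le ge(2) in simp_all)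
  qed (use X1.wstar_limit_unit_ball X2.wstar_limit_unit_ball x y in blast)+
qed

section \<open>Elements of an ideal\<close>

text \<open>The axiom \<open>mult\<close> speaks about copies of the scalar field on the type of the
  spaces; an injection \<open>e\<close> transports the structure there. The norm is that of the
  scalar, so \<open>e\<close> is isometric wherever its values come from.\<close>

definition scalar_copy :: "('k::real_or_complex \<Rightarrow> 'u) \<Rightarrow> ('k, 'u) nspace" where
  "scalar_copy e = \<lparr>vcarrier = range e, vadd = (\<lambda>p q. e (inv e p + inv e q)), vzero = e 0,
     vscale = (\<lambda>a p. e (a * inv e p)), vnorm = (\<lambda>p. norm (inv e p))\<rparr>"

lemma scalar_copy_simps [simp]:
  "vcarrier (scalar_copy e) = range e" "vadd (scalar_copy e) = (\<lambda>p q. e (inv e p + inv e q))"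
  "vscale (scalar_copy e) = (\<lambda>a p. e (a * inv e p))" "vnorm (scalar_copy e) = (\<lambda>p. norm (inv e p))"
  by (simp_all add: scalar_copy_def)

lemma banach_space_scalar_copy:
  fixes e :: "'k::real_or_complex \<Rightarrow> 'u"
  assumes e: "inj e"
  shows "banach_space (scalar_copy e)"
proof -
  interpret normed_space "scalar_copy e"
  proof
    fix x assume "x \<in> vcarrier (scalar_copy e)"
    then obtain a where "x = e a"
      by auto
    then show "\<exists>y\<in>vcarrier (scalar_copy e). vadd (scalar_copy e) x y = vzero (scalar_copy e)"
      by (intro bexI[of _ "e (- a)"]) (simp_all add: scalar_copy_def e)
  qed (auto simp: scalar_copy_def e algebra_simps norm_mult norm_triangle_ineq inj_eq)
  show ?thesis
  proof
    fix s :: "nat \<Rightarrow> 'u"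
    assume s: "\<And>n. s n \<in> vcarrier (scalar_copy e)"
      and c: "\<And>r. 0 < r \<Longrightarrow> \<exists>M. \<forall>m\<ge>M. \<forall>n\<ge>M. vnorm (scalar_copy e) (vdiff (scalar_copy e) (s m) (s n)) < r"
    have "\<exists>l\<in>vcarrier scalars. (\<lambda>n. vnorm scalars (vdiff scalars (inv e (s n)) l)) \<longlonglongrightarrow> 0"
      by (rule banach_space.complete[OF complete_scalars]) (use c e in \<open>simp_all add: vdiff_def\<close>)
    then obtain l where "(\<lambda>n. norm (inv e (s n) - l)) \<longlonglongrightarrow> 0"
      by (auto simp: vdiff_def)
    then show "\<exists>l\<in>vcarrier (scalar_copy e). (\<lambda>n. vnorm (scalar_copy e) (vdiff (scalar_copy e) (s n) l)) \<longlonglongrightarrow> 0"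
      using e by (auto simp: vdiff_def intro!: exI[of _ l])
  qed
qed

lemma isometric_iso_scalar_copy: "inj e \<Longrightarrow> isometric_iso scalars (scalar_copy e) e"
  by (auto simp: isometric_iso_def bounded_ops_def bij_betw_def intro: exI[of _ 1])

text \<open>A line through a nonzero vector supplies the injection from which
  \<open>scalar_copy\<close> is built.\<close>

lemma (in normed_space) inj_scale:
  assumes "x \<in> vcarrier V" "x \<noteq> vzero V"
  shows "inj (\<lambda>a. vscale V a x)"
proof (rule injI)
  fix a b assume eq: "vscale V a x = vscale V b x"
  have "vscale V (a - b) x = vdiff V (vscale V a x) (vscale V b x)"
    using assms scale_add_left[of x a "- b"] by (simp add: vdiff_def scale_scale)
  also have "\<dots> = vzero V"
    using eq assms by (simp add: diff_self scale_closed)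
  finally have "norm (a - b) * vnorm V x = 0"
    using assms by (simp add: norm_zero flip: norm_scale)
  then show "a = b"
    using assms norm_eq_zero by simp
qed

locale bilinear_ideal_at =
  banach_bilinear_ideal U \<nu> + X1: banach_space X1 + X2: banach_space X2 + Y: banach_space Y
  for U :: "('k::real_or_complex, 'u) ideal_class" and \<nu> :: "('k, 'u) ideal_norm"
    and X1 X2 Y :: "('k, 'u) nspace"
begin

sublocale normed_triple X1 X2 Y ..

abbreviation I :: "('k, 'u \<times> 'u \<Rightarrow> 'u) nspace" where
  "I \<equiv> ideal_space U \<nu> X1 X2 Y"

sublocale I: banach_space I
  by (rule banach) (rule X1.banach_space_axioms X2.banach_space_axioms Y.banach_space_axioms)+

lemmas banach_axioms = X1.banach_space_axioms X2.banach_space_axioms Y.banach_space_axioms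

lemma I_simps [simp]:
  "vcarrier I = U X1 X2 Y" "vnorm I = \<nu> X1 X2 Y"
  "vadd I = (\<lambda>\<Phi> \<Psi>. \<lambda>p\<in>vcarrier X1 \<times> vcarrier X2. vadd Y (\<Phi> p) (\<Psi> p))"
  "vscale I = (\<lambda>a \<Phi>. \<lambda>p\<in>vcarrier X1 \<times> vcarrier X2. vscale Y a (\<Phi> p))"
  by (simp_all add: ideal_space_def bilinear_space_def)

lemma mem_bilinear: "\<Phi> \<in> U X1 X2 Y \<Longrightarrow> \<Phi> \<in> bilinear_maps X1 X2 Y"
  using subset[OF banach_axioms] by blast

lemma \<nu>_nonneg: "\<Phi> \<in> U X1 X2 Y \<Longrightarrow> 0 \<le> \<nu> X1 X2 Y \<Phi>"
  using I.norm_nonneg[of \<Phi>] by simp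

lemma op_norm_id_le: "normed_space V \<Longrightarrow> op_norm V V (\<lambda>x\<in>vcarrier V. x) \<le> 1"
  by (rule op_norm_le') simp_all

lemma id_bounded: "normed_space V \<Longrightarrow> (\<lambda>x\<in>vcarrier V. x) \<in> bounded_ops V V"
  by (rule bounded_opsI[where C = 1]) simp_all

text \<open>The ideal property is used with identities as inner operators. Their norms are only
  bounded by 1, since they are 0 on trivial spaces.\<close>

lemma comp_mem:
  assumes \<Phi>: "\<Phi> \<in> U X1 X2 Y" and S: "S \<in> bounded_ops Y Y"
  shows "(\<lambda>p\<in>vcarrier X1 \<times> vcarrier X2. S (\<Phi> p)) \<in> U X1 X2 Y"
    and "\<nu> X1 X2 Y (\<lambda>p\<in>vcarrier X1 \<times> vcarrier X2. S (\<Phi> p)) \<le> op_norm Y Y S * \<nu> X1 X2 Y \<Phi>"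
proof -
  let ?\<Psi> = "\<lambda>p\<in>vcarrier X1 \<times> vcarrier X2. S (\<Phi> p)"
  let ?I1 = "\<lambda>x\<in>vcarrier X1. x" and ?I2 = "\<lambda>x\<in>vcarrier X2. x"
  have "?\<Psi> = (\<lambda>(z1, z2)\<in>vcarrier X1 \<times> vcarrier X2. S (\<Phi> (?I1 z1, ?I2 z2)))"
    by (intro restrict_ext) auto
  from ideal[OF banach_axioms banach_axioms id_bounded[OF X1.normed_space_axioms]
      id_bounded[OF X2.normed_space_axioms] S \<Phi> this]
  have mem: "?\<Psi> \<in> U X1 X2 Y"
    and le: "\<nu> X1 X2 Y ?\<Psi> \<le> op_norm Y Y S * \<nu> X1 X2 Y \<Phi> * op_norm X1 X1 ?I1 * op_norm X2 X2 ?I2"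
    by blast+
  note id1 = op_norm_id_le[OF X1.normed_space_axioms] op_norm_id_le[OF X2.normed_space_axioms]
    op_norm_nonneg[OF id_bounded[OF X1.normed_space_axioms] X1.normed_space_axioms X1.normed_space_axioms]
    op_norm_nonneg[OF id_bounded[OF X2.normed_space_axioms] X2.normed_space_axioms X2.normed_space_axioms]
  note nn = op_norm_nonneg[OF S Y.normed_space_axioms Y.normed_space_axioms] \<nu>_nonneg[OF \<Phi>]
  have "op_norm Y Y S * \<nu> X1 X2 Y \<Phi> * op_norm X1 X1 ?I1 * op_norm X2 X2 ?I2 \<le>
      op_norm Y Y S * \<nu> X1 X2 Y \<Phi> * 1 * 1"
    using nn id1 by (intro mult_mono mult_nonneg_nonneg) simp_all
  with le show "\<nu> X1 X2 Y ?\<Psi> \<le> op_norm Y Y S * \<nu> X1 X2 Y \<Phi>"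
    by simp
  show "?\<Psi> \<in> U X1 X2 Y"
    by (rule mem)
qed

lemma scale_vector_bounded:
  assumes f: "f \<in> bounded_ops Y scalars" and v: "v \<in> vcarrier Y"
  shows "(\<lambda>y\<in>vcarrier Y. vscale Y (f y) v) \<in> bounded_ops Y Y"
    and "op_norm Y Y (\<lambda>y\<in>vcarrier Y. vscale Y (f y) v) \<le> op_norm Y scalars f * vnorm Y v"
proof -
  note fb = op_norm_bound[OF f Y.normed_space_axioms normed_space_scalars, unfolded scalars_simps]
  have le: "vnorm Y (vscale Y (f y) v) \<le> op_norm Y scalars f * vnorm Y v * vnorm Y y"
    if "y \<in> vcarrier Y" for y
    using mult_right_mono[OF fb[OF that] Y.norm_nonneg[OF v]] v by (simp add: Y.norm_scale mult_ac)
  show "(\<lambda>y\<in>vcarrier Y. vscale Y (f y) v) \<in> bounded_ops Y Y"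
    by (rule bounded_opsI[OF _ _ _ le])
      (use v in \<open>simp_all add: bounded_opsD[OF f] Y.closed Y.scale_add_left Y.scale_scale Y.normed_space_axioms\<close>)
  show "op_norm Y Y (\<lambda>y\<in>vcarrier Y. vscale Y (f y) v) \<le> op_norm Y scalars f * vnorm Y v"
    by (rule op_norm_le'[OF Y.normed_space_axioms])
      (use le op_norm_nonneg[OF f Y.normed_space_axioms normed_space_scalars] Y.norm_nonneg[OF v] in simp_all)
qed

text \<open>The first kind of correction: \<open>\<Phi>\<close> followed by a rank-one operator on
  \<open>Y\<close>. The bound makes small multiples of it small in the ideal norm.\<close>

lemma comp_functional_mem:
  assumes \<Phi>: "\<Phi> \<in> U X1 X2 Y" and f: "f \<in> bounded_ops Y scalars" and v: "v \<in> vcarrier Y"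
  shows "(\<lambda>p\<in>vcarrier X1 \<times> vcarrier X2. vscale Y (f (\<Phi> p)) v) \<in> U X1 X2 Y"
    and "\<nu> X1 X2 Y (\<lambda>p\<in>vcarrier X1 \<times> vcarrier X2. vscale Y (f (\<Phi> p)) v)
      \<le> op_norm Y scalars f * vnorm Y v * \<nu> X1 X2 Y \<Phi>"
proof -
  let ?S = "\<lambda>y\<in>vcarrier Y. vscale Y (f y) v"
  have eq: "(\<lambda>p\<in>vcarrier X1 \<times> vcarrier X2. ?S (\<Phi> p)) =
      (\<lambda>p\<in>vcarrier X1 \<times> vcarrier X2. vscale Y (f (\<Phi> p)) v)"
    by (intro restrict_ext) (auto simp: bilinear_mapsD(1)[OF mem_bilinear[OF \<Phi>]])
  note S = scale_vector_bounded[OF f v]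
  show "(\<lambda>p\<in>vcarrier X1 \<times> vcarrier X2. vscale Y (f (\<Phi> p)) v) \<in> U X1 X2 Y"
    using comp_mem(1)[OF \<Phi> S(1)] unfolding eq .
  show "\<nu> X1 X2 Y (\<lambda>p\<in>vcarrier X1 \<times> vcarrier X2. vscale Y (f (\<Phi> p)) v)
      \<le> op_norm Y scalars f * vnorm Y v * \<nu> X1 X2 Y \<Phi>"
    using comp_mem(2)[OF \<Phi> S(1)] mult_right_mono[OF S(2) \<nu>_nonneg[OF \<Phi>]] unfolding eq
    by (rule order_trans)
qed

text \<open>The second kind of correction. It factors through multiplication on a copy of the
  scalars, with \<open>u\<close> and \<open>w\<close> applied before it and multiplication of
  \<open>v\<close> by the resulting scalar after it. The nonzero \<open>v\<close> also provides the
  copy.\<close>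

lemma rank_one_mem:
  assumes u: "u \<in> bounded_ops X1 scalars" and w: "w \<in> bounded_ops X2 scalars"
    and v: "v \<in> vcarrier Y" "v \<noteq> vzero Y"
  shows "(\<lambda>(x, y)\<in>vcarrier X1 \<times> vcarrier X2. vscale Y (u x * w y) v) \<in> U X1 X2 Y"
    and "\<nu> X1 X2 Y (\<lambda>(x, y)\<in>vcarrier X1 \<times> vcarrier X2. vscale Y (u x * w y) v)
      \<le> vnorm Y v * op_norm X1 scalars u * op_norm X2 scalars w"
proof -
  define e where "e a = vscale Y a v" for a
  have e: "inj e"
    using Y.inj_scale[OF v] unfolding e_def .
  let ?L = "scalar_copy e"
  let ?T1 = "\<lambda>x\<in>vcarrier X1. e (u x)" and ?T2 = "\<lambda>y\<in>vcarrier X2. e (w y)"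
  let ?S = "\<lambda>p\<in>vcarrier ?L. vscale Y (inv e p) v"
  let ?M = "\<lambda>(z1, z2)\<in>vcarrier ?L \<times> vcarrier ?L. e (inv e z1 * inv e z2)"
  let ?\<Psi> = "\<lambda>(x, y)\<in>vcarrier X1 \<times> vcarrier X2. vscale Y (u x * w y) v"
  have L: "banach_space ?L"
    using banach_space_scalar_copy[OF e] .
  then have Ln: "normed_space ?L"
    by (rule banach_space.axioms(1))
  have M: "?M \<in> U ?L ?L ?L" "\<nu> ?L ?L ?L ?M = 1"
    using mult[OF L isometric_iso_scalar_copy[OF e] refl] by auto
  note ub = op_norm_bound[OF u X1.normed_space_axioms normed_space_scalars, unfolded scalars_simps]
  note wb = op_norm_bound[OF w X2.normed_space_axioms normed_space_scalars, unfolded scalars_simps]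
  note nn = op_norm_nonneg[OF u X1.normed_space_axioms normed_space_scalars]
    op_norm_nonneg[OF w X2.normed_space_axioms normed_space_scalars] Y.norm_nonneg[OF v(1)]
  have T1: "?T1 \<in> bounded_ops X1 ?L"
    by (rule bounded_opsI[where C = "op_norm X1 scalars u"])
      (use ub in \<open>simp_all add: e bounded_opsD[OF u] X1.normed_space_axioms\<close>)
  have T2: "?T2 \<in> bounded_ops X2 ?L"
    by (rule bounded_opsI[where C = "op_norm X2 scalars w"])
      (use wb in \<open>simp_all add: e bounded_opsD[OF w] X2.normed_space_axioms\<close>)
  have S: "?S \<in> bounded_ops ?L Y"
    by (rule bounded_opsI[where C = "vnorm Y v"])
      (use v(1) Ln in \<open>auto simp: e Y.closed Y.scale_add_left Y.scale_scale Y.norm_scale\<close>)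
  have n1: "op_norm X1 ?L ?T1 \<le> op_norm X1 scalars u"
    by (rule op_norm_le'[OF X1.normed_space_axioms nn(1)]) (use ub in \<open>simp add: e\<close>)
  have n2: "op_norm X2 ?L ?T2 \<le> op_norm X2 scalars w"
    by (rule op_norm_le'[OF X2.normed_space_axioms nn(2)]) (use wb in \<open>simp add: e\<close>)
  have n3: "op_norm ?L Y ?S \<le> vnorm Y v"
    by (rule op_norm_le'[OF Ln nn(3)]) (use v(1) in \<open>auto simp: e Y.norm_scale\<close>)
  have "?\<Psi> = (\<lambda>(x, y)\<in>vcarrier X1 \<times> vcarrier X2. ?S (?M (?T1 x, ?T2 y)))"
    by (intro restrict_ext) (auto simp: e)
  from ideal[OF L L L X1.banach_space_axioms X2.banach_space_axioms Y.banach_space_axioms T1 T2 S M(1) this]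
  have mem: "?\<Psi> \<in> U X1 X2 Y"
    and le: "\<nu> X1 X2 Y ?\<Psi> \<le> op_norm ?L Y ?S * 1 * op_norm X1 ?L ?T1 * op_norm X2 ?L ?T2"
    unfolding M(2) by blast+
  have "op_norm ?L Y ?S * 1 * op_norm X1 ?L ?T1 * op_norm X2 ?L ?T2 \<le>
      vnorm Y v * 1 * op_norm X1 scalars u * op_norm X2 scalars w"
    using n1 n2 n3 nn op_norm_nonneg[OF T1 X1.normed_space_axioms Ln] op_norm_nonneg[OF T2 X2.normed_space_axioms Ln]
    by (intro mult_mono mult_nonneg_nonneg) simp_all
  with le show "\<nu> X1 X2 Y ?\<Psi> \<le> vnorm Y v * op_norm X1 scalars u * op_norm X2 scalars w"
    by simp
  show "?\<Psi> \<in> U X1 X2 Y"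
    by (rule mem)
qed

text \<open>Restricting \<open>\<Phi>\<close> to multiples of \<open>x\<close> and \<open>y\<close>
  and composing with a functional norming \<open>\<Phi> (x, y)\<close> leaves the multiplication of
  scalars times the norm of that value, and multiplication has ideal norm 1. The copy of the scalars
  is built from this value, hence the separate case where it is zero.\<close>

lemma norm_le_\<nu>:
  assumes \<Phi>: "\<Phi> \<in> U X1 X2 Y" and x: "x \<in> unit_ball X1" and y: "y \<in> unit_ball X2"
  shows "vnorm Y (\<Phi> (x, y)) \<le> \<nu> X1 X2 Y \<Phi>"
proof (cases "\<Phi> (x, y) = vzero Y")
  case True
  then show ?thesis
    using \<nu>_nonneg[OF \<Phi>] by (simp add: Y.norm_zero)
next
  case False
  have xc: "x \<in> vcarrier X1" "vnorm X1 x \<le> 1" and yc: "y \<in> vcarrier X2" "vnorm X2 y \<le> 1"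
    using x y by (simp_all add: unit_ball_def)
  note D = bilinear_mapsD[OF mem_bilinear[OF \<Phi>]]
  define v where "v = \<Phi> (x, y)"
  have v: "v \<in> vcarrier Y" "v \<noteq> vzero Y"
    using D(1)[OF xc(1) yc(1)] False by (simp_all add: v_def)
  define e where "e a = vscale Y a v" for a
  have e: "inj e"
    using Y.inj_scale[OF v] unfolding e_def .
  obtain f where "f \<in> unit_ball (dual Y)" and fv: "f v = of_real (vnorm Y v)"
    using Y.ex_norming_functional[OF v(1)] by blast
  then have f: "f \<in> bounded_ops Y scalars" "op_norm Y scalars f \<le> 1"
    by (simp_all add: unit_ball_def)
  let ?L = "scalar_copy e"
  let ?T1 = "\<lambda>p\<in>vcarrier ?L. vscale X1 (inv e p) x" and ?T2 = "\<lambda>p\<in>vcarrier ?L. vscale X2 (inv e p) y"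
  let ?S = "\<lambda>z\<in>vcarrier Y. e (f z)"
  let ?M = "\<lambda>(z1, z2)\<in>vcarrier ?L \<times> vcarrier ?L. e (inv e z1 * inv e z2)"
  let ?\<Psi> = "\<lambda>(z1, z2)\<in>vcarrier ?L \<times> vcarrier ?L. ?S (\<Phi> (?T1 z1, ?T2 z2))"
  have L: "banach_space ?L"
    using banach_space_scalar_copy[OF e] .
  then have Ln: "normed_space ?L"
    by (rule banach_space.axioms(1))
  have M: "?M \<in> U ?L ?L ?L" "\<nu> ?L ?L ?L ?M = 1"
    using mult[OF L isometric_iso_scalar_copy[OF e] refl] by auto
  note fb = op_norm_bound[OF f(1) Y.normed_space_axioms normed_space_scalars, unfolded scalars_simps]
  have T1: "?T1 \<in> bounded_ops ?L X1"
    by (rule bounded_opsI[where C = "vnorm X1 x"])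
      (use xc(1) Ln in \<open>auto simp: e X1.closed X1.scale_add_left X1.scale_scale X1.norm_scale\<close>)
  have T2: "?T2 \<in> bounded_ops ?L X2"
    by (rule bounded_opsI[where C = "vnorm X2 y"])
      (use yc(1) Ln in \<open>auto simp: e X2.closed X2.scale_add_left X2.scale_scale X2.norm_scale\<close>)
  have S: "?S \<in> bounded_ops Y ?L"
    by (rule bounded_opsI[where C = "op_norm Y scalars f"])
      (use fb in \<open>simp_all add: e bounded_opsD[OF f(1)] Y.normed_space_axioms\<close>)
  have n1: "op_norm ?L X1 ?T1 \<le> 1"
    by (rule op_norm_le'[OF Ln]) (use xc in \<open>auto simp: e X1.norm_scale mult_left_le\<close>)
  have n2: "op_norm ?L X2 ?T2 \<le> 1"
    by (rule op_norm_le'[OF Ln]) (use yc in \<open>auto simp: e X2.norm_scale mult_left_le\<close>)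
  have n3: "op_norm Y ?L ?S \<le> 1"
    by (rule op_norm_le'[OF Y.normed_space_axioms])
      (use unit_ball_dual_bound[OF \<open>f \<in> unit_ball (dual Y)\<close> Y.normed_space_axioms] in \<open>simp_all add: e\<close>)
  let ?IL = "ideal_space U \<nu> ?L ?L ?L"
  interpret IL: normed_space ?IL
    using normed[OF L L L] .
  have "?\<Psi> = vscale ?IL (f v) ?M"
  proof -
    have "f (\<Phi> (vscale X1 a x, vscale X2 b y)) = f v * (a * b)" for a b
      using xc(1) yc(1) D f(1)
      by (simp add: X1.closed X2.closed v_def Y.scale_scale bounded_opsD mult_ac)
    then show ?thesis
      by (simp add: ideal_space_def bilinear_space_def, intro restrict_ext)
        (auto simp: e D X1.closed X2.closed Y.closed xc yc)
  qed
  then have "\<nu> ?L ?L ?L ?\<Psi> = vnorm Y v"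
    using IL.norm_scale[of ?M "f v"] M by (simp add: ideal_space_def fv Y.norm_nonneg v)
  moreover have "\<nu> ?L ?L ?L ?\<Psi> \<le> op_norm Y ?L ?S * \<nu> X1 X2 Y \<Phi> * op_norm ?L X1 ?T1 * op_norm ?L X2 ?T2"
    using ideal[OF banach_axioms L L L T1 T2 S \<Phi> refl] by blast
  moreover have "\<dots> \<le> 1 * \<nu> X1 X2 Y \<Phi> * 1 * 1"
    using n1 n2 n3 \<nu>_nonneg[OF \<Phi>] op_norm_nonneg[OF T1 Ln X1.normed_space_axioms]
      op_norm_nonneg[OF T2 Ln X2.normed_space_axioms] op_norm_nonneg[OF S Y.normed_space_axioms Ln]
    by (intro mult_mono mult_nonneg_nonneg) simp_all
  ultimately show ?thesis
    by (simp add: v_def)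
qed

end

section \<open>Lindenstrauss perturbations\<close>

context bilinear_ideal_at
begin

abbreviation N :: "('u \<times> 'u \<Rightarrow> 'u) \<Rightarrow> real" where
  "N \<equiv> bilinear_norm X1 X2 Y"

abbreviation d :: "('u \<times> 'u \<Rightarrow> 'u) \<Rightarrow> ('u \<times> 'u \<Rightarrow> 'u) \<Rightarrow> real" where
  "d \<Phi> \<Psi> \<equiv> \<nu> X1 X2 Y (vdiff I \<Phi> \<Psi>)"

lemma d_commute: "\<Phi> \<in> U X1 X2 Y \<Longrightarrow> \<Psi> \<in> U X1 X2 Y \<Longrightarrow> d \<Phi> \<Psi> = d \<Psi> \<Phi>"
  using I.norm_diff_commute[of \<Phi> \<Psi>] by simp

lemma d_triangle:
  "\<Phi> \<in> U X1 X2 Y \<Longrightarrow> \<Psi> \<in> U X1 X2 Y \<Longrightarrow> \<Theta> \<in> U X1 X2 Y \<Longrightarrow> d \<Phi> \<Theta> \<le> d \<Phi> \<Psi> + d \<Psi> \<Theta>"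
  using I.norm_diff_triangle[of \<Phi> \<Psi> \<Theta>] by simp

lemma d_self: "\<Phi> \<in> U X1 X2 Y \<Longrightarrow> d \<Phi> \<Phi> = 0"
  using I.diff_self[of \<Phi>] I.norm_zero by simp

lemma eval_closed: "\<Phi> \<in> U X1 X2 Y \<Longrightarrow> x \<in> unit_ball X1 \<Longrightarrow> y \<in> unit_ball X2 \<Longrightarrow> \<Phi> (x, y) \<in> vcarrier Y"
  using bilinear_mapsD(1)[OF mem_bilinear] by (simp add: unit_ball_def)

lemma
  assumes "\<Phi> \<in> U X1 X2 Y" "\<Psi> \<in> U X1 X2 Y" and x: "x \<in> unit_ball X1" and y: "y \<in> unit_ball X2"
  shows norm_eval_le: "vnorm Y (\<Phi> (x, y)) \<le> vnorm Y (\<Psi> (x, y)) + d \<Phi> \<Psi>"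
    and functional_eval_le: "f \<in> unit_ball (dual Y) \<Longrightarrow> norm (f (\<Phi> (x, y))) \<le> norm (f (\<Psi> (x, y))) + d \<Phi> \<Psi>"
proof -
  note c = eval_closed[OF assms(1) x y] eval_closed[OF assms(2) x y]
  have "vdiff I \<Phi> \<Psi> (x, y) = vdiff Y (\<Phi> (x, y)) (\<Psi> (x, y))"
    using x y by (simp add: vdiff_def unit_ball_def)
  then have le: "vnorm Y (vdiff Y (\<Phi> (x, y)) (\<Psi> (x, y))) \<le> d \<Phi> \<Psi>"
    using norm_le_\<nu>[OF _ x y, of "vdiff I \<Phi> \<Psi>"] I.diff_closed[of \<Phi> \<Psi>] assms(1,2) by simp
  then show "vnorm Y (\<Phi> (x, y)) \<le> vnorm Y (\<Psi> (x, y)) + d \<Phi> \<Psi>"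
    using Y.norm_le_add_diff[OF c] by simp
  assume f: "f \<in> unit_ball (dual Y)"
  then have "f \<in> bounded_ops Y scalars"
    by (simp add: unit_ball_def)
  then have "f (\<Phi> (x, y)) = f (\<Psi> (x, y)) + f (vdiff Y (\<Phi> (x, y)) (\<Psi> (x, y)))"
    using bounded_opsD(2)[of f Y scalars "\<Psi> (x, y)" "vdiff Y (\<Phi> (x, y)) (\<Psi> (x, y))"] c
    by (simp add: Y.add_diff Y.diff_closed)
  then show "norm (f (\<Phi> (x, y))) \<le> norm (f (\<Psi> (x, y))) + d \<Phi> \<Psi>"
    using le unit_ball_dual_bound[OF f Y.normed_space_axioms Y.diff_closed[OF c]]
      norm_triangle_ineq[of "f (\<Psi> (x, y))" "f (vdiff Y (\<Phi> (x, y)) (\<Psi> (x, y)))"] by simp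
qed

lemma N_upper: "\<Phi> \<in> U X1 X2 Y \<Longrightarrow> x \<in> unit_ball X1 \<Longrightarrow> y \<in> unit_ball X2 \<Longrightarrow> vnorm Y (\<Phi> (x, y)) \<le> N \<Phi>"
  using bilinear_norm_upper[OF mem_bilinear] .

lemma N_le_add_d:
  assumes "\<Phi> \<in> U X1 X2 Y" "\<Psi> \<in> U X1 X2 Y"
  shows "N \<Phi> \<le> N \<Psi> + d \<Phi> \<Psi>"
proof (rule bilinear_norm_le)
  fix x y assume "x \<in> unit_ball X1" "y \<in> unit_ball X2"
  then show "vnorm Y (\<Phi> (x, y)) \<le> N \<Psi> + d \<Phi> \<Psi>"
    using norm_eval_le[OF assms] N_upper[OF assms(2)] by fastforce
qed

lemma functional_N_le:
  assumes "\<Phi> \<in> U X1 X2 Y" "f \<in> unit_ball (dual Y)" "x \<in> unit_ball X1" "y \<in> unit_ball X2"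
  shows "norm (f (\<Phi> (x, y))) \<le> N \<Phi>"
  using unit_ball_dual_bound[OF assms(2) Y.normed_space_axioms eval_closed[OF assms(1,3,4)]]
    N_upper[OF assms(1,3,4)] by simp

text \<open>The corrected mapping is \<open>\<Phi>\<close> plus \<epsilon> c v. At (x0, y0) the
  correction points in the direction of \<open>v\<close> and lengthens it by the factor 1 +
  \<epsilon> \<gamma>, while elsewhere the norm is at most 1 + \<epsilon> |c| times
  \<open>N \<Phi>\<close>. A point that almost attains the norm must therefore have |c| close to
  \<gamma>. The factor \<open>N \<Phi> * \<epsilon>\<close> is not cancelled, so that \<eta> and
  \<theta> can later be chosen small relative to it.\<close>

lemma perturbation:
  assumes \<Phi>: "\<Phi> \<in> U X1 X2 Y" and x0: "x0 \<in> unit_ball X1" and y0: "y0 \<in> unit_ball X2"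
    and v: "v = \<Phi> (x0, y0)" "N \<Phi> - \<eta> \<le> vnorm Y v" and C: "C \<in> U X1 X2 Y"
    and Cc: "\<And>x y. x \<in> unit_ball X1 \<Longrightarrow> y \<in> unit_ball X2 \<Longrightarrow> C (x, y) = vscale Y (c x y) v"
    and K: "\<And>x y. x \<in> unit_ball X1 \<Longrightarrow> y \<in> unit_ball X2 \<Longrightarrow> norm (c x y) \<le> K"
    and \<gamma>: "c x0 y0 = of_real \<gamma>" "0 \<le> \<gamma>" and \<epsilon>: "0 < \<epsilon>"
  obtains \<Phi>' where "\<Phi>' \<in> U X1 X2 Y" "d \<Phi>' \<Phi> = \<epsilon> * \<nu> X1 X2 Y C"
    "\<And>\<Psi> \<theta>. \<Psi> \<in> U X1 X2 Y \<Longrightarrow> d \<Psi> \<Phi>' \<le> \<theta> \<Longrightarrow> N \<Psi> - (\<eta> + \<epsilon> * K * N \<Phi> + 2 * \<theta>) \<le> vnorm Y (\<Psi> (x0, y0))"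
    "\<And>\<Psi> \<theta> x y. \<Psi> \<in> U X1 X2 Y \<Longrightarrow> d \<Psi> \<Phi>' \<le> \<theta> \<Longrightarrow> x \<in> unit_ball X1 \<Longrightarrow> y \<in> unit_ball X2 \<Longrightarrow>
      N \<Psi> - \<theta> \<le> vnorm Y (\<Psi> (x, y)) \<Longrightarrow>
      N \<Phi> * \<epsilon> * \<gamma> - ((1 + \<epsilon> * K) * \<eta> + 3 * \<theta>) \<le> N \<Phi> * \<epsilon> * norm (c x y)"
proof -
  define \<Phi>' where "\<Phi>' = vadd I \<Phi> (vscale I (of_real \<epsilon>) C)"
  have eC: "vscale I (of_real \<epsilon>) C \<in> vcarrier I"
    using C by (intro I.scale_closed) simp
  have \<Phi>': "\<Phi>' \<in> U X1 X2 Y"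
    using I.add_closed[OF _ eC, of \<Phi>] \<Phi> by (simp add: \<Phi>'_def)
  have "d \<Phi>' \<Phi> = \<nu> X1 X2 Y (vscale I (of_real \<epsilon>) C)"
    using I.diff_add[OF _ eC, of \<Phi>] \<Phi> by (simp add: \<Phi>'_def)
  also have "\<dots> = \<epsilon> * \<nu> X1 X2 Y C"
    using I.norm_scale[of C "of_real \<epsilon>"] C \<epsilon> by simp
  finally have d: "d \<Phi>' \<Phi> = \<epsilon> * \<nu> X1 X2 Y C" .
  have vc: "v \<in> vcarrier Y" and vN: "vnorm Y v \<le> N \<Phi>"
    using eval_closed[OF \<Phi> x0 y0] N_upper[OF \<Phi> x0 y0] v(1) by simp_all
  have ev: "\<Phi>' (x, y) = vadd Y (\<Phi> (x, y)) (vscale Y (of_real \<epsilon> * c x y) v)"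
    if "x \<in> unit_ball X1" "y \<in> unit_ball X2" for x y
    using Cc[OF that] that vc by (simp add: \<Phi>'_def unit_ball_def Y.scale_scale)
  have up: "vnorm Y (\<Phi>' (x, y)) \<le> N \<Phi> + \<epsilon> * norm (c x y) * N \<Phi>"
    if xy: "x \<in> unit_ball X1" "y \<in> unit_ball X2" for x y
  proof -
    have "vnorm Y (\<Phi>' (x, y)) \<le> vnorm Y (\<Phi> (x, y)) + \<epsilon> * norm (c x y) * vnorm Y v"
      unfolding ev[OF xy] using \<epsilon> vc eval_closed[OF \<Phi> xy]
        Y.norm_triangle[of "\<Phi> (x, y)" "vscale Y (of_real \<epsilon> * c x y) v"]
      by (simp add: Y.norm_scale Y.scale_closed norm_mult)
    also have "\<dots> \<le> N \<Phi> + \<epsilon> * norm (c x y) * N \<Phi>"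
      using \<epsilon> vN N_upper[OF \<Phi> xy] by (intro add_mono mult_left_mono) simp_all
    finally show ?thesis .
  qed
  have "\<Phi>' (x0, y0) = vscale Y (of_real (1 + \<epsilon> * \<gamma>)) v"
    using ev[OF x0 y0] vc Y.scale_add_left[OF vc, of 1 "of_real (\<epsilon> * \<gamma>)"] by (simp add: \<gamma> Y.scale_one flip: v(1))
  then have v0: "vnorm Y (\<Phi>' (x0, y0)) = (1 + \<epsilon> * \<gamma>) * vnorm Y v"
    using \<epsilon> \<gamma>(2) vc by (simp add: Y.norm_scale del: of_real_add of_real_mult)
  have \<gamma>K: "\<gamma> \<le> K"
    using K[OF x0 y0] \<gamma> by simp
  have \<eta>: "0 \<le> \<eta>"
    using v(2) vN by simp
  have N0: "0 \<le> N \<Phi>"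
    using bilinear_norm_nonneg[OF mem_bilinear[OF \<Phi>]] .
  \<comment> \<open>Passing between \<open>\<Psi>\<close> and the corrected mapping costs \<theta>
    for the norm and \<theta> for the value at (x0, y0).\<close>
  have 1: "N \<Psi> - (\<eta> + \<epsilon> * K * N \<Phi> + 2 * \<theta>) \<le> vnorm Y (\<Psi> (x0, y0))"
    if \<Psi>: "\<Psi> \<in> U X1 X2 Y" "d \<Psi> \<Phi>' \<le> \<theta>" for \<Psi> \<theta>
  proof -
    have "N \<Phi>' \<le> N \<Phi> + \<epsilon> * K * N \<Phi>"
    proof (rule bilinear_norm_le)
      fix x y assume xy: "x \<in> unit_ball X1" "y \<in> unit_ball X2"
      have "\<epsilon> * norm (c x y) * N \<Phi> \<le> \<epsilon> * K * N \<Phi>"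
        using K[OF xy] \<epsilon> N0 by (intro mult_right_mono mult_left_mono) simp_all
      then show "vnorm Y (\<Phi>' (x, y)) \<le> N \<Phi> + \<epsilon> * K * N \<Phi>"
        using up[OF xy] by simp
    qed
    moreover have "vnorm Y v \<le> (1 + \<epsilon> * \<gamma>) * vnorm Y v"
      using \<epsilon> \<gamma>(2) Y.norm_nonneg[OF vc] by (simp add: algebra_simps)
    ultimately show ?thesis
      using N_le_add_d[OF \<Psi>(1) \<Phi>'] norm_eval_le[OF \<Phi>' \<Psi>(1) x0 y0] d_commute[OF \<Psi>(1) \<Phi>'] \<Psi>(2) v0 v(2)
      by simp
  qed
  \<comment> \<open>The three \<theta> pay for the value at (x0, y0), for almost maximality at (x,
    y), and for the value at (x, y).\<close>
  have 2: "N \<Phi> * \<epsilon> * \<gamma> - ((1 + \<epsilon> * K) * \<eta> + 3 * \<theta>) \<le> N \<Phi> * \<epsilon> * norm (c x y)"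
    if \<Psi>: "\<Psi> \<in> U X1 X2 Y" "d \<Psi> \<Phi>' \<le> \<theta>" and xy: "x \<in> unit_ball X1" "y \<in> unit_ball X2"
      and max: "N \<Psi> - \<theta> \<le> vnorm Y (\<Psi> (x, y))" for \<Psi> \<theta> x y
  proof -
    have "(1 + \<epsilon> * \<gamma>) * vnorm Y v \<le> vnorm Y (\<Psi> (x0, y0)) + \<theta>"
      using norm_eval_le[OF \<Phi>' \<Psi>(1) x0 y0] d_commute[OF \<Psi>(1) \<Phi>'] \<Psi>(2) v0 by simp
    also have "\<dots> \<le> vnorm Y (\<Psi> (x, y)) + 2 * \<theta>"
      using N_upper[OF \<Psi>(1) x0 y0] max by simp
    also have "\<dots> \<le> N \<Phi> + \<epsilon> * norm (c x y) * N \<Phi> + 3 * \<theta>"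
      using norm_eval_le[OF \<Psi>(1) \<Phi>' xy] \<Psi>(2) up[OF xy] by simp
    finally have "(1 + \<epsilon> * \<gamma>) * vnorm Y v \<le> N \<Phi> + \<epsilon> * norm (c x y) * N \<Phi> + 3 * \<theta>" .
    moreover have "(1 + \<epsilon> * \<gamma>) * (N \<Phi> - \<eta>) \<le> (1 + \<epsilon> * \<gamma>) * vnorm Y v"
      using v(2) \<epsilon> \<gamma>(2) by (intro mult_left_mono) simp_all
    moreover have "(1 + \<epsilon> * \<gamma>) * \<eta> \<le> (1 + \<epsilon> * K) * \<eta>"
      using \<gamma>K \<epsilon> \<eta> by (intro mult_right_mono) simp_all
    ultimately show ?thesis
      by (simp add: algebra_simps)
  qed
  show ?thesis
    by (rule that[OF \<Phi>' d 1 2])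
qed

text \<open>The scalar form is f composed with \<open>\<Phi>\<close>, with f norming the value v: it
  equals the norm of v at the chosen point and is bounded by \<open>N \<Phi>\<close>. Its ideal norm
  after multiplication by v has a bound that depends on \<open>\<Phi>\<close> only, so \<epsilon>
  can be fixed before \<theta>, and \<theta> before the point.\<close>

lemma ex_peak_functional:
  assumes \<Phi>: "\<Phi> \<in> U X1 X2 Y" and m: "0 < N \<Phi>" and s: "0 < s" and r: "0 < r"
  obtains \<Phi>' f \<theta> where "\<Phi>' \<in> U X1 X2 Y" "d \<Phi>' \<Phi> \<le> r" "f \<in> unit_ball (dual Y)" "0 < \<theta>"
    "\<And>\<Psi> x y. \<Psi> \<in> U X1 X2 Y \<Longrightarrow> d \<Psi> \<Phi>' \<le> \<theta> \<Longrightarrow> x \<in> unit_ball X1 \<Longrightarrow> y \<in> unit_ball X2 \<Longrightarrow>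
      N \<Psi> - \<theta> \<le> vnorm Y (\<Psi> (x, y)) \<Longrightarrow> N \<Psi> - s \<le> norm (f (\<Psi> (x, y)))"
proof -
  let ?m = "N \<Phi>"
  \<comment> \<open>The product \<open>?m * \<nu> X1 X2 Y \<Phi>\<close> bounds the ideal norm of
    the unscaled correction; the added 1 keeps the denominator positive.\<close>
  define \<epsilon> where "\<epsilon> = min r (s / 8) / (?m * \<nu> X1 X2 Y \<Phi> + 1)"
  have \<nu>: "0 \<le> ?m * \<nu> X1 X2 Y \<Phi>"
    using m \<nu>_nonneg[OF \<Phi>] by simp
  have \<epsilon>: "0 < \<epsilon>"
    using r s \<nu> by (simp add: \<epsilon>_def)
  have "\<epsilon> * (?m * \<nu> X1 X2 Y \<Phi> + 1) = min r (s / 8)"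
    using \<nu> by (simp add: \<epsilon>_def)
  then have "\<epsilon> * (?m * \<nu> X1 X2 Y \<Phi>) + \<epsilon> = min r (s / 8)"
    by (simp only: distrib_left mult_1_right)
  then have \<epsilon>\<nu>: "\<epsilon> * (?m * \<nu> X1 X2 Y \<Phi>) \<le> min r (s / 8)"
    using \<epsilon> by linarith
  \<comment> \<open>With \<eta> = \<theta> the error of \<open>perturbation\<close> is (4 +
    \<epsilon> m) \<theta>. The second bound reduces it to s / 4 once m \<epsilon> is
    cancelled.\<close>
  define \<theta> where "\<theta> = min (s / 8) (?m * \<epsilon> * s / (4 * (4 + \<epsilon> * ?m)))"
  have \<theta>: "0 < \<theta>" "\<theta> \<le> s / 8"
    unfolding \<theta>_def using s m \<epsilon> by (simp add: add_pos_pos) (rule min.cobounded1)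
  have "\<theta> \<le> ?m * \<epsilon> * s / (4 * (4 + \<epsilon> * ?m))"
    by (simp add: \<theta>_def)
  then have \<theta>': "(4 + \<epsilon> * ?m) * \<theta> \<le> ?m * \<epsilon> * (s / 4)"
    using m \<epsilon> by (simp add: field_simps add_pos_pos)
  obtain x0 y0 where x0: "x0 \<in> unit_ball X1" and y0: "y0 \<in> unit_ball X2"
    and max: "?m - \<theta> \<le> vnorm Y (\<Phi> (x0, y0))"
    using bilinear_norm_approx[OF \<theta>(1)] by blast
  define v where "v = \<Phi> (x0, y0)"
  have vc: "v \<in> vcarrier Y" and vN: "vnorm Y v \<le> ?m"
    using eval_closed[OF \<Phi> x0 y0] N_upper[OF \<Phi> x0 y0] by (simp_all add: v_def)
  obtain f where f: "f \<in> unit_ball (dual Y)" and fv: "f v = of_real (vnorm Y v)"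
    using Y.ex_norming_functional[OF vc] by blast
  have f': "f \<in> bounded_ops Y scalars" "op_norm Y scalars f \<le> 1"
    using f by (simp_all add: unit_ball_def)
  define C where "C = (\<lambda>p\<in>vcarrier X1 \<times> vcarrier X2. vscale Y (f (\<Phi> p)) v)"
  have C: "C \<in> U X1 X2 Y"
    using comp_functional_mem(1)[OF \<Phi> f'(1) vc] by (simp add: C_def)
  have "\<nu> X1 X2 Y C \<le> op_norm Y scalars f * vnorm Y v * \<nu> X1 X2 Y \<Phi>"
    using comp_functional_mem(2)[OF \<Phi> f'(1) vc] by (simp add: C_def)
  also have "\<dots> \<le> 1 * ?m * \<nu> X1 X2 Y \<Phi>"
    using f'(2) vN \<nu>_nonneg[OF \<Phi>] Y.norm_nonneg[OF vc] m by (intro mult_right_mono mult_mono) simp_all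
  finally have \<nu>C: "\<epsilon> * \<nu> X1 X2 Y C \<le> min r (s / 8)"
    using \<epsilon>\<nu> mult_left_mono[of "\<nu> X1 X2 Y C" "?m * \<nu> X1 X2 Y \<Phi>" \<epsilon>] \<epsilon> by linarith
  obtain \<Phi>' where \<Phi>': "\<Phi>' \<in> U X1 X2 Y" "d \<Phi>' \<Phi> = \<epsilon> * \<nu> X1 X2 Y C"
    and peak: "\<And>\<Psi> \<theta>' x y. \<Psi> \<in> U X1 X2 Y \<Longrightarrow> d \<Psi> \<Phi>' \<le> \<theta>' \<Longrightarrow> x \<in> unit_ball X1 \<Longrightarrow> y \<in> unit_ball X2 \<Longrightarrow>
      N \<Psi> - \<theta>' \<le> vnorm Y (\<Psi> (x, y)) \<Longrightarrow>
      ?m * \<epsilon> * vnorm Y v - ((1 + \<epsilon> * ?m) * \<theta> + 3 * \<theta>') \<le> ?m * \<epsilon> * norm (f (\<Phi> (x, y)))"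
    by (rule perturbation[OF \<Phi> x0 y0 v_def _ C _ _ _ _ \<epsilon>, where \<eta> = \<theta> and K = ?m
        and c = "\<lambda>x y. f (\<Phi> (x, y))" and \<gamma> = "vnorm Y v"])
      (use max fv vc functional_N_le[OF \<Phi> f] Y.norm_nonneg in \<open>simp_all add: v_def C_def unit_ball_def\<close>)
  have "N \<Psi> - s \<le> norm (f (\<Psi> (x, y)))"
    if \<Psi>: "\<Psi> \<in> U X1 X2 Y" "d \<Psi> \<Phi>' \<le> \<theta>" and xy: "x \<in> unit_ball X1" "y \<in> unit_ball X2"
      and max': "N \<Psi> - \<theta> \<le> vnorm Y (\<Psi> (x, y))" for \<Psi> x y
  proof -
    have "?m * \<epsilon> * vnorm Y v - ?m * \<epsilon> * (s / 4) \<le> ?m * \<epsilon> * norm (f (\<Phi> (x, y)))"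
      using peak[OF \<Psi> xy max'] \<theta>' by (simp add: algebra_simps)
    then have "?m * \<epsilon> * (vnorm Y v - s / 4) \<le> ?m * \<epsilon> * norm (f (\<Phi> (x, y)))"
      by (simp add: right_diff_distrib)
    then have "vnorm Y v - s / 4 \<le> norm (f (\<Phi> (x, y)))"
      using m \<epsilon> by (simp add: mult_le_cancel_left_pos)
    moreover have "d \<Psi> \<Phi> \<le> s / 4"
      using d_triangle[OF \<Psi>(1) \<Phi>'(1) \<Phi>] \<Psi>(2) \<Phi>'(2) \<nu>C \<theta>(2) by simp
    moreover note functional_eval_le[OF \<Phi> \<Psi>(1) xy f] N_le_add_d[OF \<Psi>(1) \<Phi>] d_commute[OF \<Psi>(1) \<Phi>]
    \<comment> \<open>The losses are s / 4 in the norm, s / 8 for v, s / 4 from the peak and s / 4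
      in the value, together less than s.\<close>
    ultimately show ?thesis
      using max \<theta>(2) s by (simp add: v_def)
  qed
  then show ?thesis
    using that[OF \<Phi>'(1) _ f \<theta>(1)] \<Phi>'(2) \<nu>C by simp
qed

text \<open>The unimodular factors \<sigma> align the phases at the single vector \<open>z\<close>,
  where no cancellation occurs; elsewhere the triangle inequality gives the upper bound.\<close>

lemma ex_weighted_functional:
  fixes f :: "nat \<Rightarrow> 'u \<Rightarrow> 'k" and \<omega> :: "nat \<Rightarrow> real"
  assumes f: "\<And>l. l \<le> n \<Longrightarrow> f l \<in> unit_ball (dual Y)" and \<omega>: "\<And>l. 0 \<le> \<omega> l"
    and z: "z \<in> vcarrier Y"
  shows "\<exists>g\<in>bounded_ops Y scalars. g z = of_real (\<Sum>l\<le>n. \<omega> l * norm (f l z)) \<and>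
    (\<forall>y\<in>vcarrier Y. norm (g y) \<le> (\<Sum>l\<le>n. \<omega> l * norm (f l y)))"
proof -
  \<comment> \<open>The value 1 at zeros of \<open>f l z\<close> keeps all factors
    unimodular.\<close>
  define \<sigma> :: "nat \<Rightarrow> 'k" where "\<sigma> l = (if f l z = 0 then 1 else of_real (norm (f l z)) / f l z)" for l
  have \<sigma>: "norm (\<sigma> l) = 1" "\<sigma> l * f l z = of_real (norm (f l z))" for l
    by (simp_all add: \<sigma>_def norm_divide)
  define g where "g y = (\<Sum>l\<le>n. of_real (\<omega> l) * (\<sigma> l * f l y))" for y
  have f': "f l \<in> bounded_ops Y scalars" if "l \<le> n" for l
    using f[OF that] by (simp add: unit_ball_def)
  have g_le: "norm (g y) \<le> (\<Sum>l\<le>n. \<omega> l * norm (f l y))" for y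
    unfolding g_def by (rule sum_norm_le) (simp add: norm_mult \<sigma> \<omega>)
  have "restrict g (vcarrier Y) \<in> bounded_ops Y scalars"
  proof (rule bounded_opsI[where C = "\<Sum>l\<le>n. \<omega> l"])
    fix x y assume "x \<in> vcarrier Y" "y \<in> vcarrier Y"
    then show "g (vadd Y x y) = vadd scalars (g x) (g y)"
      by (simp add: g_def bounded_opsD(2)[OF f'] algebra_simps sum.distrib)
  next
    fix a x assume "x \<in> vcarrier Y"
    then show "g (vscale Y a x) = vscale scalars a (g x)"
      by (simp add: g_def bounded_opsD(3)[OF f'] sum_distrib_left mult_ac)
  next
    fix x assume x: "x \<in> vcarrier Y"
    have "(\<Sum>l\<le>n. \<omega> l * norm (f l x)) \<le> (\<Sum>l\<le>n. \<omega> l * vnorm Y x)"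
      using unit_ball_dual_bound[OF f Y.normed_space_axioms x] \<omega>
      by (intro sum_mono mult_left_mono) simp_all
    then show "vnorm scalars (g x) \<le> (\<Sum>l\<le>n. \<omega> l) * vnorm Y x"
      using g_le[of x] by (simp add: sum_distrib_right)
  qed (simp_all add: Y.normed_space_axioms)
  moreover have "g z = of_real (\<Sum>l\<le>n. \<omega> l * norm (f l z))"
    by (simp add: g_def \<sigma>)
  ultimately show ?thesis
    using g_le z by (intro bexI[of _ "restrict g (vcarrier Y)"]) simp_all
qed

text \<open>
  The weights \<open>2\<^sup>l\<close> grow slower than the errors \<open>1 / 4\<^sup>l\<close> decay. Equal weights would fail: the error of the sum
  is at least that of the first term and does not tend to \<open>0\<close> for large \<open>l\<close>.
\<close>

lemma weighted_product_terms_large: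
  fixes t :: "nat \<Rightarrow> real" and m G A B W :: real and n :: nat
  assumes W_def: "W = (\<Sum>l\<le>n. 2 ^ l)" and m: "0 < m" and G: "0 \<le> G" "W * m - 2 \<le> G"
    and AB: "G\<^sup>2 - m \<le> A * B" "0 \<le> A" "B \<le> W * m" and A: "A \<le> (\<Sum>l\<le>n. 2 ^ l * t l)"
    and t: "\<And>k. k \<le> n \<Longrightarrow> t k \<le> m" and l: "l \<le> n"
  shows "m - 5 / 2 ^ l \<le> t l"
proof -
  have "(2::real) ^ 0 \<le> W"
    unfolding W_def by (rule member_le_sum) simp_all
  then have W: "1 \<le> W"
    by simp
  then have mW: "m \<le> W * m"
    using m by simp
  \<comment> \<open>Squaring W m - 2 \<le> G is allowed only if the left side is nonnegative;
    otherwise the claimed bound is at most 0.\<close>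
  have "W * m * (W * m - 4) \<le> G\<^sup>2"
  proof (cases "2 \<le> W * m")
    case True
    then have "(W * m - 2)\<^sup>2 \<le> G\<^sup>2"
      using G by (intro power_mono) simp_all
    then show ?thesis
      by (simp add: power2_eq_square algebra_simps)
  next
    case False
    then have "W * m * (W * m - 4) \<le> 0"
      using m W by (intro mult_nonneg_nonpos) simp_all
    then show ?thesis
      by (rule order_trans) simp
  qed
  moreover have "A * B \<le> A * (W * m)"
    using AB by (intro mult_left_mono)
  \<comment> \<open>The constant 5 is the 4 from squaring plus 1 for the error m, which is at most W
    m. Dividing by W m, the upper bound of \<open>B\<close>, bounds \<open>A\<close> from
    below.\<close>
  ultimately have "W * m * (W * m - 5) \<le> W * m * A"
    using AB(1) mW by (simp add: algebra_simps)
  then have "W * m - 5 \<le> A"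
    using m W by (simp add: mult_le_cancel_left_pos)
  also note A
  \<comment> \<open>The other terms cannot exceed their weight times m, so the whole deficit 5 is
    charged to term l and divided by its weight.\<close>
  also have "(\<Sum>l\<le>n. 2 ^ l * t l) = 2 ^ l * t l + (\<Sum>k\<in>{..n} - {l}. 2 ^ k * t k)"
    using l by (intro sum.remove) simp_all
  also have "\<dots> \<le> 2 ^ l * t l + (\<Sum>k\<in>{..n} - {l}. 2 ^ k * m)"
    using t by (intro add_left_mono sum_mono mult_left_mono) simp_all
  also have "(\<Sum>k\<in>{..n} - {l}. 2 ^ k * m) = W * m - 2 ^ l * m"
    using l sum.remove[of "{..n}" l "\<lambda>k. 2 ^ k * m"] by (simp add: W_def sum_distrib_right)
  finally have "2 ^ l * m - 5 \<le> 2 ^ l * t l"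
    by simp
  then show ?thesis
    by (simp add: field_simps)
qed

text \<open>At the chosen point the product of u = g (\<Phi> (., y0)) and w = g (\<Phi> (x0, .))
  equals the square of G, nearly the largest conceivable value for two factors bounded by W m. Where
  the product stays that large, both factors are large, and each weighted sum then makes each of its
  terms large.\<close>

lemma ex_cross_functionals:
  fixes f :: "nat \<Rightarrow> 'u \<Rightarrow> 'k"
  assumes \<Phi>: "\<Phi> \<in> U X1 X2 Y" and m: "0 < N \<Phi>" and \<rho>: "0 < \<rho>" and \<theta>0: "0 < \<theta>0"
    and f: "\<And>l. l \<le> n \<Longrightarrow> f l \<in> unit_ball (dual Y)"
    and H: "\<And>x y l. x \<in> unit_ball X1 \<Longrightarrow> y \<in> unit_ball X2 \<Longrightarrow> N \<Phi> - \<theta>0 \<le> vnorm Y (\<Phi> (x, y)) \<Longrightarrow>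
      l \<le> n \<Longrightarrow> N \<Phi> - 1 / 4 ^ l \<le> norm (f l (\<Phi> (x, y)))"
  obtains \<Phi>' x0 y0 \<theta> where "\<Phi>' \<in> U X1 X2 Y" "d \<Phi>' \<Phi> \<le> \<rho>" "x0 \<in> unit_ball X1" "y0 \<in> unit_ball X2" "0 < \<theta>"
    "\<And>\<Psi>. \<Psi> \<in> U X1 X2 Y \<Longrightarrow> d \<Psi> \<Phi>' \<le> \<theta> \<Longrightarrow> N \<Psi> - \<rho> \<le> vnorm Y (\<Psi> (x0, y0))"
    "\<And>\<Psi> x y l. \<Psi> \<in> U X1 X2 Y \<Longrightarrow> d \<Psi> \<Phi>' \<le> \<theta> \<Longrightarrow> x \<in> unit_ball X1 \<Longrightarrow> y \<in> unit_ball X2 \<Longrightarrow>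
      N \<Psi> - \<theta> \<le> vnorm Y (\<Psi> (x, y)) \<Longrightarrow> l \<le> n \<Longrightarrow>
      N \<Psi> - 6 / 2 ^ l \<le> norm (f l (\<Psi> (x0, y))) \<and> N \<Psi> - 6 / 2 ^ l \<le> norm (f l (\<Psi> (x, y0)))"
proof -
  let ?m = "N \<Phi>"
  define W where "W = (\<Sum>l\<le>n. (2::real) ^ l)"
  have "(2::real) ^ 0 \<le> W"
    unfolding W_def by (rule member_le_sum) simp_all
  then have W: "1 \<le> W"
    by simp
  define K where "K = (W * ?m)\<^sup>2"
  have K: "0 < K"
    using W m by (simp add: K_def)
  \<comment> \<open>All changes are measured by \<kappa>. Almost maximality of (x0, y0) costs at
    most 4 \<kappa> \<le> \<rho>. Passing from \<open>\<Phi>\<close> to \<Psi> costs at most 4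
    \<kappa> \<le> 1 / 2^n, which raises the constant 5 to 6.\<close>
  define \<kappa> where "\<kappa> = min (\<rho> / 4) (1 / (8 * 2 ^ n))"
  have \<kappa>: "0 < \<kappa>" "4 * \<kappa> \<le> \<rho>" "\<kappa> \<le> 1 / (8 * 2 ^ n)"
    using \<rho> by (simp_all add: \<kappa>_def)
  \<comment> \<open>\<open>K * ?m\<close> bounds the ideal norm of the rank-one correction, so the
    scaled correction has norm at most \<kappa>.\<close>
  define \<epsilon> where "\<epsilon> = \<kappa> / (?m * K)"
  have \<epsilon>: "0 < \<epsilon>" and \<epsilon>K: "\<epsilon> * K * ?m = \<kappa>"
    using \<kappa>(1) m K by (simp_all add: \<epsilon>_def)
  \<comment> \<open>The bound \<open>?m / 2\<close> keeps v nonzero and \<theta>0 makes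
    \<open>H\<close> applicable at (x0, y0). The last bound leaves an error m after cancelling m
    \<epsilon>, which is tolerable beside the square of W m.\<close>
  define \<theta> where "\<theta> = min (min (min \<kappa> (?m / 2)) \<theta>0) (?m * \<epsilon> * ?m / (4 + \<epsilon> * K))"
  have "0 < \<theta>"
    using \<kappa>(1) \<theta>0 m \<epsilon> K by (simp add: \<theta>_def add_pos_pos)
  then have \<theta>: "0 < \<theta>" "\<theta> \<le> \<kappa>" "\<theta> \<le> \<theta>0" "\<theta> \<le> ?m * \<epsilon> * ?m / (4 + \<epsilon> * K)" "\<theta> \<le> ?m / 2"
    unfolding \<theta>_def by linarith+
  then have \<theta>': "(4 + \<epsilon> * K) * \<theta> \<le> ?m * \<epsilon> * ?m"
    using \<epsilon> K by (simp add: pos_le_divide_eq add_pos_pos mult.commute)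
  obtain x0 y0 where x0: "x0 \<in> unit_ball X1" and y0: "y0 \<in> unit_ball X2"
    and max: "?m - \<theta> \<le> vnorm Y (\<Phi> (x0, y0))"
    using bilinear_norm_approx[OF \<theta>(1)] by blast
  have x0c: "x0 \<in> vcarrier X1" and y0c: "y0 \<in> vcarrier X2"
    using x0 y0 by (simp_all add: unit_ball_def)
  define v where "v = \<Phi> (x0, y0)"
  have vc: "v \<in> vcarrier Y" and vN: "vnorm Y v \<le> ?m"
    using eval_closed[OF \<Phi> x0 y0] N_upper[OF \<Phi> x0 y0] by (simp_all add: v_def)
  define G where "G = (\<Sum>l\<le>n. 2 ^ l * norm (f l v))"
  obtain g where g: "g \<in> bounded_ops Y scalars" and gv: "g v = of_real G"
    and g_le: "\<And>y. y \<in> vcarrier Y \<Longrightarrow> norm (g y) \<le> (\<Sum>l\<le>n. 2 ^ l * norm (f l y))"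
    using ex_weighted_functional[of n f "\<lambda>l. 2 ^ l" v] f vc unfolding G_def by auto
  have gW: "norm (g (\<Phi> (x, y))) \<le> W * ?m" if "x \<in> unit_ball X1" "y \<in> unit_ball X2" for x y
  proof -
    have "norm (g (\<Phi> (x, y))) \<le> (\<Sum>l\<le>n. 2 ^ l * norm (f l (\<Phi> (x, y))))"
      by (rule g_le[OF eval_closed[OF \<Phi> that]])
    also have "\<dots> \<le> (\<Sum>l\<le>n. 2 ^ l * ?m)"
      using functional_N_le[OF \<Phi> f that] by (intro sum_mono mult_left_mono) simp_all
    finally show ?thesis
      by (simp add: W_def sum_distrib_right)
  qed
  have G0: "0 \<le> G"
    by (simp add: G_def sum_nonneg)
  \<comment> \<open>Weights 2^l times errors 1 / 4^l form a geometric series, so the total error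
    stays below 2 for every n.\<close>
  have "W * ?m - (\<Sum>l\<le>n. (1 / 2) ^ l) = (\<Sum>l\<le>n. 2 ^ l * (?m - 1 / 4 ^ l))"
  proof -
    have "(2::real) ^ l * (1 / 4 ^ l) = (1 / 2) ^ l" for l
      by (simp add: power_divide flip: power_mult_distrib) (simp add: field_simps flip: power_mult_distrib)
    then show ?thesis
      by (simp add: W_def right_diff_distrib sum_subtractf sum_distrib_right)
  qed
  also have "\<dots> \<le> G"
    unfolding G_def using H[OF x0 y0] max \<theta>(3) by (intro sum_mono mult_left_mono) (simp_all add: v_def)
  finally have "W * ?m - (\<Sum>l\<le>n. (1 / 2) ^ l) \<le> G" .
  moreover have "(\<Sum>l\<le>n. (1 / 2 :: real) ^ l) \<le> 2"
    by (simp add: sum_gp0)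
  ultimately have GW: "W * ?m - 2 \<le> G"
    by simp
  define u w where "u = (\<lambda>x\<in>vcarrier X1. g (\<Phi> (x, y0)))" and "w = (\<lambda>y\<in>vcarrier X2. g (\<Phi> (x0, y)))"
  have u: "u \<in> bounded_ops X1 scalars" and w: "w \<in> bounded_ops X2 scalars"
    using comp_functional[OF mem_bilinear[OF \<Phi>] g] x0c y0c by (simp_all add: u_def w_def)
  have Wm: "0 \<le> W * ?m"
    using W m by simp
  have un: "op_norm X1 scalars u \<le> W * ?m" and wn: "op_norm X2 scalars w \<le> W * ?m"
    using gW x0 y0 Wm
    by (auto intro!: op_norm_le X1.normed_space_axioms X2.normed_space_axioms simp: u_def w_def unit_ball_def)
  define C where "C = (\<lambda>(x, y)\<in>vcarrier X1 \<times> vcarrier X2. vscale Y (u x * w y) v)"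
  have "v \<noteq> vzero Y"
    using max \<theta>(5) m by (auto simp: v_def Y.norm_zero)
  note C = rank_one_mem[OF u w vc this, folded C_def]
  have "\<nu> X1 X2 Y C \<le> vnorm Y v * op_norm X1 scalars u * op_norm X2 scalars w"
    by (rule C(2))
  also have "\<dots> \<le> ?m * (W * ?m) * (W * ?m)"
    using vN un wn m W Y.norm_nonneg[OF vc] op_norm_nonneg[OF u X1.normed_space_axioms normed_space_scalars]
      op_norm_nonneg[OF w X2.normed_space_axioms normed_space_scalars]
    by (intro mult_mono mult_nonneg_nonneg) simp_all
  also have "\<dots> = K * ?m"
    by (simp add: K_def power2_eq_square)
  finally have "\<epsilon> * \<nu> X1 X2 Y C \<le> \<epsilon> * (K * ?m)"
    using \<epsilon> by (intro mult_left_mono) simp_all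
  then have \<nu>C: "\<epsilon> * \<nu> X1 X2 Y C \<le> \<kappa>"
    by (simp add: mult.assoc flip: \<epsilon>K)
  have uw: "u x = g (\<Phi> (x, y0))" "w y = g (\<Phi> (x0, y))" "norm (u x) \<le> W * ?m" "norm (w y) \<le> W * ?m"
    if "x \<in> unit_ball X1" "y \<in> unit_ball X2" for x y
    using gW that x0 y0 by (simp_all add: u_def w_def unit_ball_def)
  have "C (x, y) = vscale Y (u x * w y) v" if "x \<in> unit_ball X1" "y \<in> unit_ball X2" for x y
    using that by (simp add: C_def unit_ball_def)
  moreover have "norm (u x * w y) \<le> K" if xy: "x \<in> unit_ball X1" "y \<in> unit_ball X2" for x y
    unfolding norm_mult K_def power2_eq_square using uw(3,4)[OF xy] Wm by (intro mult_mono) simp_all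
  moreover have "u x0 * w y0 = of_real (G\<^sup>2)"
    using uw(1,2)[OF x0 y0] gv by (simp add: v_def power2_eq_square)
  ultimately obtain \<Phi>' where \<Phi>': "\<Phi>' \<in> U X1 X2 Y" "d \<Phi>' \<Phi> = \<epsilon> * \<nu> X1 X2 Y C"
    and max0: "\<And>\<Psi> \<theta>'. \<Psi> \<in> U X1 X2 Y \<Longrightarrow> d \<Psi> \<Phi>' \<le> \<theta>' \<Longrightarrow>
      N \<Psi> - (\<theta> + \<epsilon> * K * ?m + 2 * \<theta>') \<le> vnorm Y (\<Psi> (x0, y0))"
    and peak: "\<And>\<Psi> \<theta>' x y. \<Psi> \<in> U X1 X2 Y \<Longrightarrow> d \<Psi> \<Phi>' \<le> \<theta>' \<Longrightarrow> x \<in> unit_ball X1 \<Longrightarrow> y \<in> unit_ball X2 \<Longrightarrow>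
      N \<Psi> - \<theta>' \<le> vnorm Y (\<Psi> (x, y)) \<Longrightarrow>
      ?m * \<epsilon> * G\<^sup>2 - ((1 + \<epsilon> * K) * \<theta> + 3 * \<theta>') \<le> ?m * \<epsilon> * norm (u x * w y)"
    using perturbation[OF \<Phi> x0 y0 v_def max[folded v_def] C(1), of "\<lambda>x y. u x * w y" K "G\<^sup>2" \<epsilon>] \<epsilon>
      zero_le_power2[of G] by blast
  have d\<Phi>: "d \<Psi> \<Phi> \<le> 2 * \<kappa>" if \<Psi>: "\<Psi> \<in> U X1 X2 Y" "d \<Psi> \<Phi>' \<le> \<theta>" for \<Psi>
    using d_triangle[OF \<Psi>(1) \<Phi>'(1) \<Phi>] \<Psi>(2) \<Phi>'(2) \<nu>C \<theta>(2) by simp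
  have transfer: "N \<Psi> - 6 / 2 ^ l \<le> norm (f l (\<Psi> (x, y)))"
    if \<Psi>: "\<Psi> \<in> U X1 X2 Y" "d \<Psi> \<Phi>' \<le> \<theta>" and xy: "x \<in> unit_ball X1" "y \<in> unit_ball X2"
      and l: "l \<le> n" and le: "?m - 5 / 2 ^ l \<le> norm (f l (\<Phi> (x, y)))" for \<Psi> x y l
  proof -
    have "(2::real) ^ l \<le> 2 ^ n"
      using l by (intro power_increasing) simp_all
    then have "1 / 2 ^ n \<le> 1 / (2::real) ^ l"
      by (simp add: frac_le)
    moreover have "4 * \<kappa> \<le> 1 / 2 ^ n"
      using \<kappa>(1,3) by (simp add: field_simps)
    moreover have "6 / 2 ^ l = 5 / 2 ^ l + 1 / (2::real) ^ l"
      by (simp flip: add_divide_distrib)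
    ultimately show ?thesis
      using functional_eval_le[OF \<Phi> \<Psi>(1) xy f[OF l]] N_le_add_d[OF \<Psi>(1) \<Phi>] d_commute[OF \<Psi>(1) \<Phi>]
        d\<Phi>[OF \<Psi>] le by linarith
  qed
  show ?thesis
  proof (rule that[OF \<Phi>'(1) _ x0 y0 \<theta>(1)])
    show "d \<Phi>' \<Phi> \<le> \<rho>"
      using \<Phi>'(2) \<nu>C \<kappa> by simp
    show "N \<Psi> - \<rho> \<le> vnorm Y (\<Psi> (x0, y0))" if "\<Psi> \<in> U X1 X2 Y" "d \<Psi> \<Phi>' \<le> \<theta>" for \<Psi>
      using max0[OF that] \<epsilon>K \<theta>(2) \<kappa>(2) by simp
    fix \<Psi> x y l
    assume \<Psi>: "\<Psi> \<in> U X1 X2 Y" "d \<Psi> \<Phi>' \<le> \<theta>" and xy: "x \<in> unit_ball X1" "y \<in> unit_ball X2"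
      and max': "N \<Psi> - \<theta> \<le> vnorm Y (\<Psi> (x, y))" and l: "l \<le> n"
    have "?m * \<epsilon> * G\<^sup>2 - ?m * \<epsilon> * ?m \<le> ?m * \<epsilon> * norm (u x * w y)"
      using peak[OF \<Psi> xy max'] \<theta>' by (simp add: algebra_simps)
    then have "?m * \<epsilon> * (G\<^sup>2 - ?m) \<le> ?m * \<epsilon> * norm (u x * w y)"
      by (simp add: right_diff_distrib)
    then have prod: "G\<^sup>2 - ?m \<le> norm (u x) * norm (w y)"
      using m \<epsilon> by (simp add: mult_le_cancel_left_pos norm_mult)
    have ux: "norm (u x) \<le> (\<Sum>l\<le>n. 2 ^ l * norm (f l (\<Phi> (x, y0))))"
      and wy: "norm (w y) \<le> (\<Sum>l\<le>n. 2 ^ l * norm (f l (\<Phi> (x0, y))))"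
      using g_le[OF eval_closed[OF \<Phi> xy(1) y0]] g_le[OF eval_closed[OF \<Phi> x0 xy(2)]] uw(1,2)[OF xy] by simp_all
    have "?m - 5 / 2 ^ l \<le> norm (f l (\<Phi> (x, y0)))"
      by (rule weighted_product_terms_large[OF W_def m G0 GW prod norm_ge_zero uw(4)[OF xy] ux
            functional_N_le[OF \<Phi> f xy(1) y0] l])
    moreover have "?m - 5 / 2 ^ l \<le> norm (f l (\<Phi> (x0, y)))"
      by (rule weighted_product_terms_large[OF W_def m G0 GW prod[unfolded mult.commute[of "norm (u x)"]]
            norm_ge_zero uw(3)[OF xy] wy functional_N_le[OF \<Phi> f x0 xy(2)] l])
    ultimately show "N \<Psi> - 6 / 2 ^ l \<le> norm (f l (\<Psi> (x0, y))) \<and> N \<Psi> - 6 / 2 ^ l \<le> norm (f l (\<Psi> (x, y0)))"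
      using transfer[OF \<Psi> x0 xy(2) l] transfer[OF \<Psi> xy(1) y0 l] by simp
  qed
qed

end

section \<open>The iteration and its limit\<close>

context bilinear_ideal_at
begin

text \<open>The condition ranges over the ball of radius \<open>r\<close>, which will contain all
  later mappings and their limit. Since \<open>r < N \<Phi>\<close>, every mapping in this ball has
  positive norm.\<close>

definition peaking :: "nat \<Rightarrow> (nat \<Rightarrow> 'u \<Rightarrow> 'k) \<Rightarrow> ('u \<times> 'u \<Rightarrow> 'u) \<Rightarrow> real \<Rightarrow> bool" where
  "peaking n f \<Phi> r \<longleftrightarrow> \<Phi> \<in> U X1 X2 Y \<and> 0 < r \<and> r < N \<Phi> \<and> (\<forall>l<n. f l \<in> unit_ball (dual Y)) \<and>
     (\<forall>\<Psi>\<in>U X1 X2 Y. d \<Psi> \<Phi> \<le> r \<longrightarrow> (\<forall>x\<in>unit_ball X1. \<forall>y\<in>unit_ball X2. N \<Psi> - r \<le> vnorm Y (\<Psi> (x, y)) \<longrightarrow>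
        (\<forall>l<n. N \<Psi> - 1 / 4 ^ l \<le> norm (f l (\<Psi> (x, y))))))"

text \<open>Two tolerances are kept: \<open>r\<close> is the tolerance for points met later, while
  \<rho> is the tolerance to which (x0, y0) itself is almost maximal. In the iteration \<rho> is the
  radius of the preceding stage, so (x0, y0) is admissible for all earlier stages.\<close>

definition cross_peaking ::
    "nat \<Rightarrow> (nat \<Rightarrow> 'u \<Rightarrow> 'k) \<Rightarrow> 'u \<Rightarrow> 'u \<Rightarrow> ('u \<times> 'u \<Rightarrow> 'u) \<Rightarrow> real \<Rightarrow> real \<Rightarrow> bool" where
  "cross_peaking n f x0 y0 \<Phi> r \<rho> \<longleftrightarrow> x0 \<in> unit_ball X1 \<and> y0 \<in> unit_ball X2 \<and>
     (\<forall>\<Psi>\<in>U X1 X2 Y. d \<Psi> \<Phi> \<le> r \<longrightarrow> N \<Psi> - \<rho> \<le> vnorm Y (\<Psi> (x0, y0)) \<and>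
        (\<forall>x\<in>unit_ball X1. \<forall>y\<in>unit_ball X2. N \<Psi> - r \<le> vnorm Y (\<Psi> (x, y)) \<longrightarrow>
        (\<forall>l\<le>n. N \<Psi> - 6 / 2 ^ l \<le> norm (f l (\<Psi> (x0, y))) \<and>
          N \<Psi> - 6 / 2 ^ l \<le> norm (f l (\<Psi> (x, y0))))))"

text \<open>The new functional is found before the new pair, so that the cross estimates include the
  index n. The first correction uses at most r / 4, the second at most r / 4, and the new radius is
  at most r / 4, so the new ball lies inside the old one.\<close>

lemma peaking_step:
  assumes "peaking n f \<Phi> r"
  shows "\<exists>f' \<Phi>' r' x0 y0. peaking (Suc n) f' \<Phi>' r' \<and> (\<forall>l<n. f' l = f l) \<and>
    d \<Phi>' \<Phi> + r' \<le> r \<and> r' \<le> r / 2 \<and> cross_peaking n f' x0 y0 \<Phi>' r' r"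
proof -
  have \<Phi>: "\<Phi> \<in> U X1 X2 Y" and r: "0 < r" "r < N \<Phi>" and f: "\<And>l. l < n \<Longrightarrow> f l \<in> unit_ball (dual Y)"
    and peak: "\<And>\<Psi> x y l. \<Psi> \<in> U X1 X2 Y \<Longrightarrow> d \<Psi> \<Phi> \<le> r \<Longrightarrow> x \<in> unit_ball X1 \<Longrightarrow> y \<in> unit_ball X2 \<Longrightarrow>
      N \<Psi> - r \<le> vnorm Y (\<Psi> (x, y)) \<Longrightarrow> l < n \<Longrightarrow> N \<Psi> - 1 / 4 ^ l \<le> norm (f l (\<Psi> (x, y)))"
    using assms by (simp_all add: peaking_def)
  obtain \<Phi>1 g \<theta>1 where \<Phi>1: "\<Phi>1 \<in> U X1 X2 Y" "d \<Phi>1 \<Phi> \<le> r / 4" and g: "g \<in> unit_ball (dual Y)"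
    and \<theta>1: "0 < \<theta>1"
    and peak1: "\<And>\<Psi> x y. \<Psi> \<in> U X1 X2 Y \<Longrightarrow> d \<Psi> \<Phi>1 \<le> \<theta>1 \<Longrightarrow> x \<in> unit_ball X1 \<Longrightarrow> y \<in> unit_ball X2 \<Longrightarrow>
      N \<Psi> - \<theta>1 \<le> vnorm Y (\<Psi> (x, y)) \<Longrightarrow> N \<Psi> - 1 / 4 ^ n \<le> norm (g (\<Psi> (x, y)))"
    using ex_peak_functional[OF \<Phi>, of "1 / 4 ^ n" "r / 4"] r by auto
  define f' where "f' = f(n := g)"
  \<comment> \<open>A mapping within 2 \<rho> of \<open>\<Phi>1\<close> is within \<theta>1 of
    \<open>\<Phi>1\<close> and within r of \<open>\<Phi>\<close>, so both the new and the old
    functionals peak on it.\<close>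
  define \<rho> where "\<rho> = min \<theta>1 r / 4"
  have \<rho>: "0 < \<rho>" "4 * \<rho> \<le> \<theta>1" "4 * \<rho> \<le> r"
    using \<theta>1 r by (simp_all add: \<rho>_def)
  have f': "f' l \<in> unit_ball (dual Y)" if "l \<le> n" for l
    using f g that by (simp add: f'_def)
  have peak': "N \<Psi> - 1 / 4 ^ l \<le> norm (f' l (\<Psi> (x, y)))"
    if \<Psi>: "\<Psi> \<in> U X1 X2 Y" "d \<Psi> \<Phi>1 \<le> 2 * \<rho>" and xy: "x \<in> unit_ball X1" "y \<in> unit_ball X2"
      and max: "N \<Psi> - 2 * \<rho> \<le> vnorm Y (\<Psi> (x, y))" and l: "l \<le> n" for \<Psi> x y l
  proof (cases "l = n")
    case True
    then show ?thesis
      using peak1[OF \<Psi>(1) _ xy] \<Psi>(2) max \<rho> by (simp add: f'_def)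
  next
    case False
    have "d \<Psi> \<Phi> \<le> r"
      using d_triangle[OF \<Psi>(1) \<Phi>1(1) \<Phi>] \<Psi>(2) \<Phi>1(2) \<rho> by simp
    then show ?thesis
      using peak[OF \<Psi>(1) _ xy] max \<rho> l False by (simp add: f'_def)
  qed
  have m1: "0 < N \<Phi>1"
    using N_le_add_d[OF \<Phi> \<Phi>1(1)] d_commute[OF \<Phi> \<Phi>1(1)] \<Phi>1(2) r by simp
  obtain \<Phi>2 x0 y0 \<theta>2 where \<Phi>2: "\<Phi>2 \<in> U X1 X2 Y" "d \<Phi>2 \<Phi>1 \<le> \<rho>"
    and xy0: "x0 \<in> unit_ball X1" "y0 \<in> unit_ball X2" and \<theta>2: "0 < \<theta>2"
    and max0: "\<And>\<Psi>. \<Psi> \<in> U X1 X2 Y \<Longrightarrow> d \<Psi> \<Phi>2 \<le> \<theta>2 \<Longrightarrow> N \<Psi> - \<rho> \<le> vnorm Y (\<Psi> (x0, y0))"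
    and cross: "\<And>\<Psi> x y l. \<Psi> \<in> U X1 X2 Y \<Longrightarrow> d \<Psi> \<Phi>2 \<le> \<theta>2 \<Longrightarrow> x \<in> unit_ball X1 \<Longrightarrow> y \<in> unit_ball X2 \<Longrightarrow>
      N \<Psi> - \<theta>2 \<le> vnorm Y (\<Psi> (x, y)) \<Longrightarrow> l \<le> n \<Longrightarrow>
      N \<Psi> - 6 / 2 ^ l \<le> norm (f' l (\<Psi> (x0, y))) \<and> N \<Psi> - 6 / 2 ^ l \<le> norm (f' l (\<Psi> (x, y0)))"
  proof (rule ex_cross_functionals[OF \<Phi>1(1) m1 \<rho>(1) \<rho>(1), of n f'])
    show "f' l \<in> unit_ball (dual Y)" if "l \<le> n" for l
      using f'[OF that] .
    show "N \<Phi>1 - 1 / 4 ^ l \<le> norm (f' l (\<Phi>1 (x, y)))"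
      if "x \<in> unit_ball X1" "y \<in> unit_ball X2" "N \<Phi>1 - \<rho> \<le> vnorm Y (\<Phi>1 (x, y))" "l \<le> n" for x y l
      by (rule peak'[OF \<Phi>1(1) _ that(1,2) _ that(4)]) (use \<rho> that(3) d_self[OF \<Phi>1(1)] in simp_all)
  qed (rule that)
  define r' where "r' = min \<rho> \<theta>2"
  have r': "0 < r'" "r' \<le> \<rho>" "r' \<le> \<theta>2"
    using \<rho> \<theta>2 by (simp_all add: r'_def)
  have d2: "d \<Phi>2 \<Phi> + r' \<le> 3 * r / 4"
    using d_triangle[OF \<Phi>2(1) \<Phi>1(1) \<Phi>] \<Phi>2(2) \<Phi>1(2) r' \<rho> by simp
  have "peaking (Suc n) f' \<Phi>2 r'"
    unfolding peaking_def
  proof (intro conjI ballI allI impI)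
    show "\<Phi>2 \<in> U X1 X2 Y" "0 < r'"
      using \<Phi>2 r' by simp_all
    show "r' < N \<Phi>2"
      using N_le_add_d[OF \<Phi> \<Phi>2(1)] d_commute[OF \<Phi> \<Phi>2(1)] d2 r by simp
    show "f' l \<in> unit_ball (dual Y)" if "l < Suc n" for l
      using f' that by simp
    fix \<Psi> x y l assume \<Psi>: "\<Psi> \<in> U X1 X2 Y" "d \<Psi> \<Phi>2 \<le> r'" and xy: "x \<in> unit_ball X1" "y \<in> unit_ball X2"
      and "N \<Psi> - r' \<le> vnorm Y (\<Psi> (x, y))" "l < Suc n"
    then show "N \<Psi> - 1 / 4 ^ l \<le> norm (f' l (\<Psi> (x, y)))"
      using d_triangle[OF \<Psi>(1) \<Phi>2(1) \<Phi>1(1)] \<Phi>2(2) r' \<rho>(1) by (intro peak' \<Psi>(1) xy) simp_all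
  qed
  moreover have "cross_peaking n f' x0 y0 \<Phi>2 r' r"
    unfolding cross_peaking_def
  proof (intro conjI ballI allI impI xy0)
    fix \<Psi> assume \<Psi>: "\<Psi> \<in> U X1 X2 Y" "d \<Psi> \<Phi>2 \<le> r'"
    then show "N \<Psi> - r \<le> vnorm Y (\<Psi> (x0, y0))"
      using max0[OF \<Psi>(1)] r' \<rho> by simp
    fix x y l assume "x \<in> unit_ball X1" "y \<in> unit_ball X2" "N \<Psi> - r' \<le> vnorm Y (\<Psi> (x, y))" "l \<le> n"
    then show "N \<Psi> - 6 / 2 ^ l \<le> norm (f' l (\<Psi> (x0, y)))" "N \<Psi> - 6 / 2 ^ l \<le> norm (f' l (\<Psi> (x, y0)))"
      using cross[OF \<Psi>(1), of x y l] \<Psi>(2) r' by simp_all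
  qed
  ultimately show ?thesis
    using d2 r r' \<rho> by (intro exI[of _ f'] exI[of _ \<Phi>2] exI[of _ r'] exI[of _ x0] exI[of _ y0])
      (simp add: f'_def)
qed

text \<open>Cantor's intersection theorem in the ideal norm: the inequality \<open>nest\<close>
  telescopes, and closedness of the balls passes the bound to the limit.\<close>

lemma ex_limit_of_nested_balls:
  assumes \<Phi>: "\<And>n. \<Phi> n \<in> U X1 X2 Y" and nest: "\<And>n. d (\<Phi> (Suc n)) (\<Phi> n) + r (Suc n) \<le> r n"
    and r: "\<And>n. 0 < r n" "r \<longlonglongrightarrow> 0"
  shows "\<exists>\<Psi>\<in>U X1 X2 Y. \<forall>n. d \<Psi> (\<Phi> n) \<le> r n"
proof -
  have le: "d (\<Phi> k) (\<Phi> n) + r k \<le> r n" if "n \<le> k" for k n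
    using that
  proof (induction k rule: dec_induct)
    case base
    then show ?case
      using d_self[OF \<Phi>] by simp
  next
    case (step k)
    then show ?case
      using nest[of k] d_triangle[OF \<Phi>[of "Suc k"] \<Phi>[of k] \<Phi>[of n]] by simp
  qed
  have "\<exists>M. \<forall>i\<ge>M. \<forall>j\<ge>M. vnorm I (vdiff I (\<Phi> i) (\<Phi> j)) < e" if "0 < e" for e
  proof -
    obtain M where M: "r M < e / 2"
      using order_tendstoD(2)[OF r(2), of "e / 2"] \<open>0 < e\<close> by (auto simp: eventually_sequentially)
    have "d (\<Phi> i) (\<Phi> j) < e" if "M \<le> i" "M \<le> j" for i j
      using le[OF that(1)] le[OF that(2)] r(1)[of i] r(1)[of j] M d_commute[OF \<Phi>[of M] \<Phi>[of j]]
        d_triangle[OF \<Phi>[of i] \<Phi>[of M] \<Phi>[of j]] by linarith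
    then show ?thesis
      by auto
  qed
  then obtain \<Psi> where \<Psi>: "\<Psi> \<in> U X1 X2 Y" "(\<lambda>n. d (\<Phi> n) \<Psi>) \<longlonglongrightarrow> 0"
    using I.complete[of \<Phi>] \<Phi> by auto
  have "d \<Psi> (\<Phi> n) \<le> r n" for n
  proof (rule tendsto_lowerbound)
    show "(\<lambda>k. d (\<Phi> k) \<Psi> + r n) \<longlonglongrightarrow> r n"
      using tendsto_add[OF \<Psi>(2) tendsto_const[of "r n"]] by simp
    show "\<forall>\<^sub>F k in sequentially. d \<Psi> (\<Phi> n) \<le> d (\<Phi> k) \<Psi> + r n"
      using eventually_ge_at_top[of n]
    proof eventually_elim
      case (elim k)
      then show ?case
        using le[OF elim] r(1)[of k] d_triangle[OF \<Psi>(1) \<Phi>[of k] \<Phi>[of n]] d_commute[OF \<Psi>(1) \<Phi>[of k]] by simp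
    qed
  qed simp
  with \<Psi>(1) show ?thesis
    by blast
qed

theorem dense_arens_attaining:
  assumes \<Phi>: "\<Phi> \<in> U X1 X2 Y" and \<epsilon>: "0 < \<epsilon>"
  shows "\<exists>\<Psi>\<in>U X1 X2 Y. arens_attain_at_same_pair X1 X2 Y \<Psi> \<and> d \<Phi> \<Psi> < \<epsilon>"
proof (cases "N \<Phi> = 0")
  case True
  \<comment> \<open>The iteration needs a positive norm. If the norm is 0, all lower bounds are
    trivial, and constant zero sequences with any functional of the unit ball do.\<close>
  obtain f where f: "f \<in> unit_ball (dual Y)"
    using Y.ex_norming_functional[OF Y.zero_closed] by blast
  have "arens_attain_at_same_pair X1 X2 Y \<Phi>"
    by (rule arens_attain_at_same_pairI[OF mem_bilinear[OF \<Phi>], where x = "\<lambda>_. vzero X1" and y = "\<lambda>_. vzero X2"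
        and f = "\<lambda>_. f" and \<tau> = "\<lambda>_. 0"])
      (simp_all add: X1.zero_in_unit_ball X2.zero_in_unit_ball f[simplified] True)
  then show ?thesis
    using \<Phi> \<epsilon> d_self[OF \<Phi>] by auto
next
  case False
  then have m: "0 < N \<Phi>"
    using bilinear_norm_nonneg[OF mem_bilinear[OF \<Phi>]] by simp
  \<comment> \<open>The initial radius bounds the total displacement; halving makes it strictly
    smaller than both \<epsilon> and the norm.\<close>
  define r0 where "r0 = min \<epsilon> (N \<Phi>) / 2"
  have r0: "0 < r0" "r0 < \<epsilon>" "r0 < N \<Phi>"
    using m \<epsilon> by (auto simp: r0_def min_def)
  \<comment> \<open>Dependent choice does not fix the initial state, so the predicate itself ties
    stage 0 to \<open>\<Phi>\<close> and r0.\<close>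
  define P where "P n s \<longleftrightarrow> (case s of (f, \<Psi>, r, x, y) \<Rightarrow>
      peaking n f \<Psi> r \<and> (n = 0 \<longrightarrow> \<Psi> = \<Phi> \<and> r = r0))"
    for n and s :: "(nat \<Rightarrow> 'u \<Rightarrow> 'k) \<times> ('u \<times> 'u \<Rightarrow> 'u) \<times> real \<times> 'u \<times> 'u"
  define Q where "Q n s s' \<longleftrightarrow> (case s of (f, \<Psi>, r, x, y) \<Rightarrow> case s' of (f', \<Psi>', r', x', y') \<Rightarrow>
      (\<forall>l<n. f' l = f l) \<and> d \<Psi>' \<Psi> + r' \<le> r \<and> r' \<le> r / 2 \<and> cross_peaking n f' x' y' \<Psi>' r' r)"
    for n and s s' :: "(nat \<Rightarrow> 'u \<Rightarrow> 'k) \<times> ('u \<times> 'u \<Rightarrow> 'u) \<times> real \<times> 'u \<times> 'u"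
  have "\<exists>S. \<forall>n. P n (S n) \<and> Q n (S n) (S (Suc n))"
  proof (rule dependent_nat_choice)
    have "peaking 0 f \<Phi> r0" for f
      using \<Phi> r0 by (simp add: peaking_def)
    then show "\<exists>s. P 0 s"
      by (intro exI[of _ "(\<lambda>_. undefined, \<Phi>, r0, undefined, undefined)"]) (simp add: P_def)
    fix s n assume "P n s"
    obtain f \<Psi> r x y where s: "s = (f, \<Psi>, r, x, y)"
      by (cases s)
    then have "peaking n f \<Psi> r"
      using \<open>P n s\<close> by (simp add: P_def)
    then obtain f' \<Psi>' r' x' y' where "peaking (Suc n) f' \<Psi>' r'" "\<forall>l<n. f' l = f l"
      "d \<Psi>' \<Psi> + r' \<le> r" "r' \<le> r / 2" "cross_peaking n f' x' y' \<Psi>' r' r"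
      using peaking_step by blast
    then show "\<exists>s'. P (Suc n) s' \<and> Q n s s'"
      by (intro exI[of _ "(f', \<Psi>', r', x', y')"]) (simp add: P_def Q_def s)
  qed
  then obtain S where S: "\<And>n. P n (S n)" "\<And>n. Q n (S n) (S (Suc n))"
    by blast
  \<comment> \<open>The points stored in stage 0 are arbitrary, so the pair of index n is read from
    stage n + 1, which creates it.\<close>
  define f \<Theta> r x y where "f n = fst (S n)" and "\<Theta> n = fst (snd (S n))" and "r n = fst (snd (snd (S n)))"
    and "x n = fst (snd (snd (snd (S (Suc n)))))" and "y n = snd (snd (snd (snd (S (Suc n)))))" for n
  have peak: "peaking n (f n) (\<Theta> n) (r n)" and start: "\<Theta> 0 = \<Phi>" "r 0 = r0" for n
    using S(1)[of n] S(1)[of 0] by (simp_all add: P_def f_def \<Theta>_def r_def case_prod_unfold)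
  have keep: "l < n \<Longrightarrow> f (Suc n) l = f n l" and nest: "d (\<Theta> (Suc n)) (\<Theta> n) + r (Suc n) \<le> r n"
    and half: "r (Suc n) \<le> r n / 2"
    and cross: "cross_peaking n (f (Suc n)) (x n) (y n) (\<Theta> (Suc n)) (r (Suc n)) (r n)" for n l
    using S(2)[of n] by (simp_all add: Q_def f_def \<Theta>_def r_def x_def y_def case_prod_unfold)
  have \<Theta>: "\<Theta> n \<in> U X1 X2 Y" and r: "0 < r n" for n
    using peak[of n] unfolding peaking_def by blast+
  have "r n \<le> r0 * (1 / 2) ^ n" for n
  proof (induction n)
    case (Suc n)
    have "r (Suc n) \<le> r n / 2"
      by (rule half)
    also have "\<dots> \<le> r0 * (1 / 2) ^ n / 2"
      using Suc.IH by simp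
    finally show ?case
      by simp
  qed (simp add: start)
  moreover have "(\<lambda>n. r0 * (1 / 2) ^ n) \<longlonglongrightarrow> 0"
    using tendsto_mult_right_zero[OF LIMSEQ_power_zero[of "1 / 2 :: real"], of r0] by simp
  ultimately have "r \<longlonglongrightarrow> 0"
    using r by (intro tendsto_sandwich[of "\<lambda>_. 0" r sequentially "\<lambda>n. r0 * (1 / 2) ^ n"])
      (simp_all add: less_imp_le)
  then obtain \<Psi> where \<Psi>: "\<Psi> \<in> U X1 X2 Y" "\<And>n. d \<Psi> (\<Theta> n) \<le> r n"
    using ex_limit_of_nested_balls[of \<Theta> r, OF \<Theta> nest r] by blast
  have "r (Suc n) \<le> r n" for n
    using half[of n] r[of n] by simp
  then have decreasing: "r k \<le> r n" if "n \<le> k" for n k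
    using that by (rule lift_Suc_antimono_le)
  \<comment> \<open>Entry l is set in the step from stage l to stage l + 1 and kept afterwards, so
    the diagonal collects the final functionals.\<close>
  define g where "g l = f (Suc l) l" for l
  have fg: "f n l = g l" if "l < n" for n l
    using Suc_leI[OF that] by (induction n rule: dec_induct) (use keep in \<open>simp_all add: g_def\<close>)
  have xy: "x n \<in> unit_ball X1" "y n \<in> unit_ball X2" and max: "N \<Psi> - r n \<le> vnorm Y (\<Psi> (x n, y n))" for n
    using cross[of n] \<Psi>(1) \<Psi>(2)[of "Suc n"] unfolding cross_peaking_def by blast+
  have large: "N \<Psi> - 6 / 2 ^ l \<le> norm (g l (\<Psi> (x i, y j)))" "N \<Psi> - 6 / 2 ^ l \<le> norm (g l (\<Psi> (x j, y i)))"
    if l: "l \<le> i" and ij: "i < j" for l i j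
  proof -
    \<comment> \<open>The pair of index j is almost maximal up to r j, which is at most r (i + 1) as
      i < j; this is the tolerance in the cross estimates of stage i.\<close>
    have "N \<Psi> - r (Suc i) \<le> vnorm Y (\<Psi> (x j, y j))"
      using max[of j] decreasing[of "Suc i" j] ij by simp
    then have "N \<Psi> - 6 / 2 ^ l \<le> norm (f (Suc i) l (\<Psi> (x i, y j))) \<and>
        N \<Psi> - 6 / 2 ^ l \<le> norm (f (Suc i) l (\<Psi> (x j, y i)))"
      using cross[of i] \<Psi>(1) \<Psi>(2)[of "Suc i"] xy[of j] l unfolding cross_peaking_def by blast
    then show "N \<Psi> - 6 / 2 ^ l \<le> norm (g l (\<Psi> (x i, y j)))" "N \<Psi> - 6 / 2 ^ l \<le> norm (g l (\<Psi> (x j, y i)))"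
      using l by (simp_all add: fg)
  qed
  have "g l \<in> unit_ball (dual Y)" for l
    using peak[of "Suc l"] unfolding peaking_def g_def by blast
  moreover have "(\<lambda>l. 6 * (1 / 2) ^ l :: real) \<longlonglongrightarrow> 0"
    using tendsto_mult_right_zero[OF LIMSEQ_power_zero[of "1 / 2 :: real"], of 6] by simp
  then have "(\<lambda>l. 6 / 2 ^ l :: real) \<longlonglongrightarrow> 0"
    by (simp add: power_divide)
  ultimately have "arens_attain_at_same_pair X1 X2 Y \<Psi>"
    by (intro arens_attain_at_same_pairI[OF mem_bilinear[OF \<Psi>(1)] xy, where f = g and \<tau> = "\<lambda>l. 6 / 2 ^ l"] large)
  moreover have "d \<Phi> \<Psi> < \<epsilon>"
    using \<Psi>(2)[of 0] r0(2) d_commute[OF \<Phi> \<Psi>(1)] by (simp add: start)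
  ultimately show ?thesis
    using \<Psi>(1) by blast
qed

end

theorem corollary1p5:
  fixes U :: "('k::real_or_complex, 'u) ideal_class"
    and \<nu> :: "('k, 'u) ideal_norm"
    and X1 X2 Y :: "('k, 'u) nspace"
  assumes "regular_banach_bilinear_ideal U \<nu>"
    and "banach_space X1" and "banach_space X2" and "banach_space Y"
  shows "\<forall>\<Phi>\<in>U X1 X2 Y. \<forall>\<epsilon>>0. \<exists>\<Psi>\<in>U X1 X2 Y.
           arens_attain_at_same_pair X1 X2 Y \<Psi> \<and>
           vnorm (ideal_space U \<nu> X1 X2 Y) (vdiff (ideal_space U \<nu> X1 X2 Y) \<Phi> \<Psi>) < \<epsilon>"
proof -
  interpret bilinear_ideal_at U \<nu> X1 X2 Y
    by (intro bilinear_ideal_at.intro assms regular_banach_bilinear_ideal.axioms(1)[OF assms(1)])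
  show ?thesis
    using dense_arens_attaining by simp
qed

end
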